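(* There is a function $f$ with $f(t)=2^{2^{2^{O(t)}}}$ and a decision algorithm which, given as input an ordered graph $(G,<)$ with $n$ vertices and $m$ edges (given explicitly) and a positive integer $t$, satisfies: if the algorithm returns Yes then $(G,<)$ contains $K_t$ as an interval minor; if the algorithm returns No then $(G,<)$ does not contain $K_{f(t)}$ as an interval minor; and the algorithm runs in time $O(t\cdot mn^2)$.
   Context: An ordered graph $(G,<)$ is a finite simple graph with a linear order on its vertices. $(G,<)$ contains $K_t$ as an interval minor iff $V(G)$ can be partitioned into $t$ nonempty intervals of $<$ (sets of consecutive vertices) such that between any two of these intervals there is an edge of $G$. The input is given explicitly: a list of edges and the list of vertices sorted according to $<$. *)

theory Defs
  imports
    Complex_Main
    "HOL-Library.Disjoint_Sets"
    "HOL-Library.Landau_Symbols"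
begin

section \<open>Ordered graphs and interval minors\<close>

text \<open>The relation \<open>r\<close> is the reflexive version of the linear order on the vertices.\<close>

definition ordered_graph :: "'a set \<Rightarrow> 'a set set \<Rightarrow> 'a rel \<Rightarrow> bool" where
  "ordered_graph V E r \<longleftrightarrow>
     finite V \<and> (\<forall>e\<in>E. e \<subseteq> V \<and> card e = 2) \<and> linear_order_on V r"

definition interval_of :: "'a set \<Rightarrow> 'a rel \<Rightarrow> 'a set \<Rightarrow> bool" where
  "interval_of V r I \<longleftrightarrow>
     I \<subseteq> V \<and> (\<forall>x\<in>I. \<forall>z\<in>I. \<forall>y\<in>V. (x, y) \<in> r \<and> (y, z) \<in> r \<longrightarrow> y \<in> I)"

text \<open>Nonemptiness of the parts is included in \<^const>\<open>partition_on\<close>.\<close>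

definition has_clique_interval_minor :: "'a set \<Rightarrow> 'a set set \<Rightarrow> 'a rel \<Rightarrow> nat \<Rightarrow> bool" where
  "has_clique_interval_minor V E r t \<longleftrightarrow>
     (\<exists>P. partition_on V P \<and> finite P \<and> card P = t \<and>
          (\<forall>I\<in>P. interval_of V r I) \<and>
          (\<forall>I\<in>P. \<forall>J\<in>P. I \<noteq> J \<longrightarrow> (\<exists>u\<in>I. \<exists>v\<in>J. {u, v} \<in> E)))"

text \<open>Explicit presentation: \<open>vs\<close> is the increasing list of all vertices, and \<open>es\<close> lists every
  edge exactly once, in an arbitrary order and with arbitrarily ordered endpoints.\<close>

definition presents ::
  "'a list \<Rightarrow> ('a \<times> 'a) list \<Rightarrow> 'a set \<Rightarrow> 'a set set \<Rightarrow> 'a rel \<Rightarrow> bool" where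
  "presents vs es V E r \<longleftrightarrow>
     distinct vs \<and> set vs = V \<and> sorted_wrt (\<lambda>u v. (u, v) \<in> r) vs \<and>
     length es = card E \<and> (\<lambda>(u, v). {u, v}) ` set es = E"

section \<open>A word RAM\<close>

text \<open>
  Algorithms are programs of a word RAM with structured control flow. A program mentions finitely
  many registers and finitely many arrays by constant names; array cells are addressed indirectly
  through registers. Each elementary instruction and each evaluation of a test costs one time unit.
  The parameter \<open>W\<close> is the largest number that fits into a machine word: an instruction whose
  result exceeds \<open>W\<close> has no transition, so an execution that overflows does not exist.
\<close>

record ram_state =
  reg :: "nat \<Rightarrow> nat"
  arr :: "nat \<Rightarrow> nat \<Rightarrow> nat"

datatype ram_op = Add | Sub | Mul | Div

fun apply_op :: "ram_op \<Rightarrow> nat \<Rightarrow> nat \<Rightarrow> nat" where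
  "apply_op Add a b = a + b"
| "apply_op Sub a b = a - b"
| "apply_op Mul a b = a * b"
| "apply_op Div a b = a div b"

datatype ram_prog =
    Skip
  | Const nat nat             \<comment> \<open>register := constant\<close>
  | Copy nat nat              \<comment> \<open>register := register\<close>
  | Op ram_op nat nat nat     \<comment> \<open>register := register op register\<close>
  | Load nat nat nat          \<comment> \<open>register := array[register]\<close>
  | Store nat nat nat         \<comment> \<open>array[register] := register\<close>
  | Seq ram_prog ram_prog
  | IfLess nat nat ram_prog ram_prog
  | WhileLess nat nat ram_prog

text \<open>\<open>exec W c s k s'\<close>: with words bounded by \<open>W\<close>, program \<open>c\<close> started in \<open>s\<close> halts in \<open>s'\<close>
  after exactly \<open>k\<close> steps.\<close>

inductive exec :: "nat \<Rightarrow> ram_prog \<Rightarrow> ram_state \<Rightarrow> nat \<Rightarrow> ram_state \<Rightarrow> bool" for W :: nat where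
  Skip: "exec W Skip s 1 s"
| Const: "a \<le> W \<Longrightarrow> exec W (Const x a) s 1 (s\<lparr>reg := (reg s)(x := a)\<rparr>)"
| Copy: "exec W (Copy x y) s 1 (s\<lparr>reg := (reg s)(x := reg s y)\<rparr>)"
| Op: "a = apply_op f (reg s y) (reg s z) \<Longrightarrow> a \<le> W \<Longrightarrow>
    exec W (Op f x y z) s 1 (s\<lparr>reg := (reg s)(x := a)\<rparr>)"
| Load: "exec W (Load x A y) s 1 (s\<lparr>reg := (reg s)(x := arr s A (reg s y))\<rparr>)"
| Store: "exec W (Store A y z) s 1
    (s\<lparr>arr := (arr s)(A := (arr s A)(reg s y := reg s z))\<rparr>)"
| Seq: "exec W c s k s' \<Longrightarrow> exec W d s' l s'' \<Longrightarrow> exec W (Seq c d) s (k + l) s''"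
| IfTrue: "reg s x < reg s y \<Longrightarrow> exec W c s k s' \<Longrightarrow> exec W (IfLess x y c d) s (Suc k) s'"
| IfFalse: "\<not> reg s x < reg s y \<Longrightarrow> exec W d s k s' \<Longrightarrow> exec W (IfLess x y c d) s (Suc k) s'"
| WhileFalse: "\<not> reg s x < reg s y \<Longrightarrow> exec W (WhileLess x y c) s 1 s"
| WhileTrue: "reg s x < reg s y \<Longrightarrow> exec W c s k s' \<Longrightarrow> exec W (WhileLess x y c) s' l s'' \<Longrightarrow>
    exec W (WhileLess x y c) s (Suc (k + l)) s''"

inductive_cases exec_SkipE: "exec W Skip s k s'"
inductive_cases exec_ConstE: "exec W (Const x a) s k s'"
inductive_cases exec_CopyE: "exec W (Copy x y) s k s'"
inductive_cases exec_OpE: "exec W (Op f x y z) s k s'"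
inductive_cases exec_LoadE: "exec W (Load x A y) s k s'"
inductive_cases exec_StoreE: "exec W (Store A y z) s k s'"
inductive_cases exec_SeqE: "exec W (Seq c d) s k s'"
inductive_cases exec_IfLessE: "exec W (IfLess x y c d) s k s'"
inductive_cases exec_WhileLessE: "exec W (WhileLess x y c) s k s'"

text \<open>Executions are deterministic, so the existence of a halting execution with some property
  describes the behaviour of the program.\<close>

lemma exec_deterministic:
  "exec W c s k s' \<Longrightarrow> exec W c s l s'' \<Longrightarrow> k = l \<and> s' = s''"
proof (induction arbitrary: l s'' rule: exec.induct)
  case (Seq c s k s' d l s'')
  from Seq.prems show ?case by (rule exec_SeqE) (use Seq.IH in blast)
next
  case (IfTrue s x y c k s' d)
  from IfTrue.prems show ?case by (rule exec_IfLessE) (use IfTrue in blast)+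
next
  case (IfFalse s x y d k s' c)
  from IfFalse.prems show ?case by (rule exec_IfLessE) (use IfFalse in blast)+
next
  case (WhileFalse s x y c)
  from WhileFalse.prems show ?case by (rule exec_WhileLessE) (use WhileFalse in auto)
next
  case (WhileTrue s x y c k s' l s'')
  from WhileTrue.prems show ?case by (rule exec_WhileLessE) (use WhileTrue in blast)+
qed (auto elim: exec_SkipE exec_ConstE exec_CopyE exec_OpE exec_LoadE exec_StoreE)

section \<open>Input and output conventions\<close>

text \<open>Registers 0, 1, 2 hold the number of vertices, the number of edges and \<open>t\<close>; array 0 holds the
  sorted list of vertices, and arrays 1 and 2 hold the endpoints of the listed edges. All other
  cells are 0. The answer is Yes iff register 0 is nonzero at the end.\<close>

definition list_cells :: "nat list \<Rightarrow> nat \<Rightarrow> nat" where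
  "list_cells xs i = (if i < length xs then xs ! i else 0)"

definition input_state :: "nat list \<Rightarrow> (nat \<times> nat) list \<Rightarrow> nat \<Rightarrow> ram_state" where
  "input_state vs es t =
     \<lparr> reg = (\<lambda>_. 0)(0 := length vs, 1 := length es, 2 := t),
       arr = (\<lambda>_ _. 0)(0 := list_cells vs,
                        1 := list_cells (map fst es),
                        2 := list_cells (map snd es)) \<rparr>"

definition says_yes :: "ram_state \<Rightarrow> bool" where
  "says_yes s \<longleftrightarrow> reg s 0 \<noteq> 0"

text \<open>The largest word when words have \<open>d * log\<^sub>2 (N + 2)\<close> bits, where \<open>N\<close> bounds the numbers
  (including vertex names) that occur in the input.\<close>

definition max_word :: "nat \<Rightarrow> nat list \<Rightarrow> (nat \<times> nat) list \<Rightarrow> nat \<Rightarrow> nat" where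
  "max_word d vs es t = (length vs + length es + t + Max (insert 0 (set vs)) + 2) ^ d"

end

theory Submission
  imports Defs
begin

text \<open>
  Refine the partition of the vertices with one part repeatedly: in every part \<open>X\<close>, split off as
  singletons the first vertex and all vertices with a neighbour outside \<open>X\<close>. This yields a tree of
  intervals, and each edge is separated in exactly one of them. For a part \<open>X\<close>, contract the edges
  separated in \<open>X\<close> along the blocks that start at vertices with a neighbour to the left of \<open>X\<close>, and those
  that stay inside a block along the blocks that start at vertices with a neighbour to the right of
  \<open>X\<close>. In both quotients every vertex sees a common interval outside \<open>X\<close>, so a clique minor of
  size \<open>t\<close> in one of them gives one of size \<open>t + 1\<close> in the graph. Conversely, if no quotient has a
  clique minor of size \<open>b\<close>, then the graph has none of size \<open>512 * b ^ 4\<close>.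

  Each edge is passed on to at most one quotient, so \<open>t - 2\<close> levels of this recursion keep at most
  \<open>m\<close> edges altogether, and a graph without edges has no clique minor of size 2. The answer is Yes iff
  an edge survives; otherwise the clique minors have size at most doubly exponential in \<open>t\<close>.
\<close>

text \<open>Vertices of a part may have their outside neighbours on either side, but one extra
  branch set has to reach every branch set of the smaller minor. Hence there are two quotients:
  everything before the part, or everything after it, serves as the extra branch set. What both
  quotients lose is small: the first block of each costs one branch set, and separated edges inside
  a common left and right block form a star, which has no clique minor of size 3. For the converse,
  rounding a minor along two kinds of blocks takes b to about \<open>4 * b ^ 2\<close>, and the tree
  squares once more. Since 512 is \<open>8 ^ 3\<close>, eight times the bound is at most the fourth
  power of \<open>8 * b\<close>, which iterates to \<open>2 ^ (4 ^ (t - 1))\<close> for t at least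
  2. For the running time, every part loses its first vertex in each round, so n rounds suffice per
  level. A quotient with an edge is named by one of its edges, so the whole family fits into m
  blocks of n vertices. A round is then a constant number of passes over at most
  \<open>m * n\<close> cells, and a level takes \<open>O(m * n ^ 2)\<close> steps.\<close>

section \<open>Clique minors as monotone labellings\<close>

text \<open>Fibres of a monotone map are intervals and cover all vertices, so no partition has to be
  carried along. Labels from t on are unconstrained and absorb leftover vertices. For t below 2 the
  condition is vacuous.\<close>

definition clique_minor :: "(nat \<times> nat) set \<Rightarrow> nat \<Rightarrow> bool" where
  "clique_minor E t \<longleftrightarrow>
     (\<exists>\<phi> :: nat \<Rightarrow> nat. mono \<phi> \<and>
        (\<forall>i j. i < j \<longrightarrow> j < t \<longrightarrow> (\<exists>u v. (u, v) \<in> E \<and> \<phi> u = i \<and> \<phi> v = j)))"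

lemma clique_minorI:
  assumes "mono \<phi>"
    and "\<And>i j. i < j \<Longrightarrow> j < t \<Longrightarrow> \<exists>u v. (u, v) \<in> E \<and> \<phi> u = i \<and> \<phi> v = j"
  shows "clique_minor E t"
  using assms unfolding clique_minor_def by blast

lemma clique_minorE:
  assumes "clique_minor E t"
  obtains \<phi> where "mono \<phi>"
    and "\<And>i j. i < j \<Longrightarrow> j < t \<Longrightarrow> \<exists>u v. (u, v) \<in> E \<and> \<phi> u = i \<and> \<phi> v = j"
  using assms unfolding clique_minor_def by blast

text \<open>All labels from t on can be merged into t. Boundedness gives maxima of sets of labels
  and lets a labelling be continued by a constant to the right.\<close>

lemma clique_minor_boundedE:
  assumes "clique_minor E t"
  obtains \<phi> where "mono \<phi>" "\<And>w. \<phi> w \<le> t"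
    and "\<And>i j. i < j \<Longrightarrow> j < t \<Longrightarrow> \<exists>u v. (u, v) \<in> E \<and> \<phi> u = i \<and> \<phi> v = j"
proof -
  obtain \<phi> where \<phi>: "mono \<phi>"
    and ed: "\<And>i j. i < j \<Longrightarrow> j < t \<Longrightarrow> \<exists>u v. (u, v) \<in> E \<and> \<phi> u = i \<and> \<phi> v = j"
    using assms by (rule clique_minorE) blast
  show thesis
  proof (rule that[of "\<lambda>w. min (\<phi> w) t"])
    show "mono (\<lambda>w. min (\<phi> w) t)"
      using \<phi> by (intro monoI min.mono) (auto dest: monoD)
    fix i j assume ij: "i < j" "j < t"
    with ed[OF this] show "\<exists>u v. (u, v) \<in> E \<and> min (\<phi> u) t = i \<and> min (\<phi> v) t = j"
      by fastforce
  qed simp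
qed

lemma clique_minor_antimono:
  "clique_minor E t \<Longrightarrow> s \<le> t \<Longrightarrow> clique_minor E s"
  unfolding clique_minor_def by (meson order_less_le_trans)

lemma clique_minor_subset:
  "clique_minor E t \<Longrightarrow> E \<subseteq> F \<Longrightarrow> clique_minor F t"
  unfolding clique_minor_def by (meson subsetD)

lemma mono_lessD: "mono \<phi> \<Longrightarrow> \<phi> u < \<phi> v \<Longrightarrow> u < v" for \<phi> :: "nat \<Rightarrow> nat"
  using monoD[of \<phi> v u] by linarith

lemma mono_less_leD: "mono \<phi> \<Longrightarrow> \<phi> u < \<phi> v \<Longrightarrow> u \<le> v" for \<phi> :: "nat \<Rightarrow> nat"
  by (simp add: less_imp_le mono_lessD)

text \<open>In a clique minor of size 3 the edges for the label pairs 0, 1 and 1, 2 have first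
  endpoints in different branch sets, hence different first endpoints.\<close>

lemma not_clique_minor_star:
  assumes "\<And>u v. (u, v) \<in> E \<Longrightarrow> u = c"
  shows "\<not> clique_minor E 3"
proof
  assume "clique_minor E 3"
  then obtain \<phi> :: "nat \<Rightarrow> nat" where
    *: "\<And>i j. i < j \<Longrightarrow> j < 3 \<Longrightarrow> \<exists>u v. (u, v) \<in> E \<and> \<phi> u = i \<and> \<phi> v = j"
    by (rule clique_minorE) blast
  obtain u v u' v' where "(u, v) \<in> E" "\<phi> u = 0" "(u', v') \<in> E" "\<phi> u' = 1"
    using *[of 0 1] *[of 1 2] by auto
  then show False using assms[of u v] assms[of u' v'] by simp
qed

text \<open>If no block of \<open>\<pi>\<close> meets branch sets whose labels differ by more than \<open>p\<close>, then the branch sets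
  with labels divisible by \<open>p + 1\<close> can be rounded to disjoint unions of blocks.\<close>

lemma clique_minor_partition:
  assumes K: "clique_minor E ((p + 1) * q)" and \<pi>: "mono \<pi>"
  shows "clique_minor {(\<pi> u, \<pi> v) | u v. (u, v) \<in> E \<and> \<pi> u \<noteq> \<pi> v} q \<or>
    (\<exists>c. clique_minor {(u, v) \<in> E. \<pi> u = c \<and> \<pi> v = c} p)"
proof -
  let ?N = "(p + 1) * q"
  obtain \<phi> where \<phi>: "mono \<phi>" and bd: "\<And>w. \<phi> w \<le> ?N"
    and ed: "\<And>i j. i < j \<Longrightarrow> j < ?N \<Longrightarrow> \<exists>u v. (u, v) \<in> E \<and> \<phi> u = i \<and> \<phi> v = j"
    using K by (rule clique_minor_boundedE) blast
  show ?thesis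
  proof (cases "\<exists>x y. \<pi> x = \<pi> y \<and> \<phi> x + p + 1 \<le> \<phi> y")
    case True
    then obtain x y where xy: "\<pi> x = \<pi> y" "\<phi> x + p + 1 \<le> \<phi> y" by blast
    \<comment> \<open>Monotonicity traps every vertex with an intermediate label between x and y,
      hence in their block. The gap leaves at least p intermediate labels.\<close>
    have inside: "\<pi> w = \<pi> x" if "\<phi> x < \<phi> w" "\<phi> w < \<phi> y" for w
    proof -
      have "x \<le> w" "w \<le> y" using that by (auto intro: mono_less_leD[OF \<phi>])
      then have "\<pi> x \<le> \<pi> w" "\<pi> w \<le> \<pi> y" using \<pi> by (auto dest: monoD)
      with xy show ?thesis by simp
    qed
    have "clique_minor {(u, v) \<in> E. \<pi> u = \<pi> x \<and> \<pi> v = \<pi> x} p"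
    proof (rule clique_minorI[of "\<lambda>w. \<phi> w - (\<phi> x + 1)"])
      show "mono (\<lambda>w. \<phi> w - (\<phi> x + 1))"
        using \<phi> by (intro monoI diff_le_mono) (auto dest: monoD)
      fix i j assume ij: "i < j" "j < p"
      have "\<phi> x + 1 + j < ?N" using ij xy bd[of y] by linarith
      then obtain u v where uv: "(u, v) \<in> E" "\<phi> u = \<phi> x + 1 + i" "\<phi> v = \<phi> x + 1 + j"
        using ed[of "\<phi> x + 1 + i" "\<phi> x + 1 + j"] ij by auto
      then have "\<pi> u = \<pi> x" "\<pi> v = \<pi> x" using ij xy by (simp_all add: inside)
      with uv show "\<exists>u v. (u, v) \<in> {(u, v) \<in> E. \<pi> u = \<pi> x \<and> \<pi> v = \<pi> x} \<and>
          \<phi> u - (\<phi> x + 1) = i \<and> \<phi> v - (\<phi> x + 1) = j"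
        by (intro exI[of _ u] exI[of _ v]) simp
    qed
    then show ?thesis by blast
  next
    case False
    \<comment> \<open>A block receives the largest label that occurs up to its end, rounded down to
      a multiple of \<open>p + 1\<close>. The inserted 0 keeps the set nonempty.\<close>
    let ?A = "\<lambda>c. insert 0 {\<phi> w | w. \<pi> w \<le> c}"
    define \<psi> where "\<psi> c = Max (?A c) div (p + 1)" for c
    have fin: "finite (?A c)" for c
      by (rule finite_subset[of _ "{..?N}"]) (use bd in auto)
    have "mono \<psi>"
    proof (rule monoI)
      fix c c' :: nat assume "c \<le> c'"
      then have "?A c \<subseteq> ?A c'" by (auto intro: order_trans)
      then have "Max (?A c) \<le> Max (?A c')" by (intro Max_mono fin) blast+
      then show "\<psi> c \<le> \<psi> c'" unfolding \<psi>_def by (rule div_le_mono)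
    qed
    \<comment> \<open>A vertex up to the end of the block of w with a label beyond
      \<open>(p + 1) * i + p\<close> would lie to the right of w in the same block, with a label gap
      that this case excludes. So rounding down returns exactly i.\<close>
    have rnd: "\<psi> (\<pi> w) = i" if w: "\<phi> w = (p + 1) * i" for w i
    proof -
      have le: "\<phi> w' \<le> (p + 1) * i + p" if "\<pi> w' \<le> \<pi> w" for w'
      proof (rule ccontr)
        assume as: "\<not> \<phi> w' \<le> (p + 1) * i + p"
        have "w < w'" using as w by (intro mono_lessD[OF \<phi>, of w w']) linarith
        then have "\<pi> w = \<pi> w'" using that \<pi> by (meson antisym less_imp_le monoD)
        moreover have "\<phi> w + p + 1 \<le> \<phi> w'" using as w by linarith
        ultimately show False using False by blast
      qed
      have "Max (?A (\<pi> w)) \<le> (p + 1) * i + p"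
        using le by (subst Max_le_iff[OF fin]) auto
      moreover have "(p + 1) * i \<le> Max (?A (\<pi> w))"
        unfolding w[symmetric] by (intro Max_ge[OF fin]) blast
      ultimately show ?thesis
        unfolding \<psi>_def by (intro div_nat_eqI) (auto simp: algebra_simps)
    qed
    have "clique_minor {(\<pi> u, \<pi> v) | u v. (u, v) \<in> E \<and> \<pi> u \<noteq> \<pi> v} q"
    proof (rule clique_minorI[OF \<open>mono \<psi>\<close>])
      fix i j assume ij: "i < j" "j < q"
      have "(p + 1) * i < (p + 1) * j" "(p + 1) * j < (p + 1) * q"
        using ij by (auto intro!: mult_strict_left_mono simp del: mult_Suc)
      then obtain u v where uv: "(u, v) \<in> E" "\<phi> u = (p + 1) * i" "\<phi> v = (p + 1) * j"
        using ed by blast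
      moreover from this rnd[of u i] rnd[of v j] ij have "\<pi> u \<noteq> \<pi> v" by auto
      ultimately show "\<exists>a b. (a, b) \<in> {(\<pi> u, \<pi> v) | u v. (u, v) \<in> E \<and> \<pi> u \<noteq> \<pi> v} \<and> \<psi> a = i \<and> \<psi> b = j"
        using rnd[of u i] rnd[of v j] ij by (intro exI[of _ "\<pi> u"] exI[of _ "\<pi> v"]) auto
    qed
    then show ?thesis by blast
  qed
qed

text \<open>A partition of the vertices into intervals is given by the set \<open>S\<close> of first elements of
  its parts (always containing 0); \<open>last_in S w\<close> names the part of \<open>w\<close>.\<close>

definition last_in :: "nat set \<Rightarrow> nat \<Rightarrow> nat" where
  "last_in A w = Max (A \<inter> {..w})"

lemma last_in_mem: "0 \<in> A \<Longrightarrow> last_in A w \<in> A"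
  and last_in_le: "0 \<in> A \<Longrightarrow> last_in A w \<le> w"
proof -
  assume "0 \<in> A"
  then have "last_in A w \<in> A \<inter> {..w}"
    unfolding last_in_def by (intro Max_in) auto
  then show "last_in A w \<in> A" "last_in A w \<le> w" by auto
qed

lemma last_in_ge: "a \<in> A \<Longrightarrow> a \<le> w \<Longrightarrow> a \<le> last_in A w"
  unfolding last_in_def by (intro Max_ge) auto

lemma last_in_eqI:
  assumes "a \<in> A" "a \<le> w" "\<And>b. b \<in> A \<Longrightarrow> b \<le> w \<Longrightarrow> b \<le> a"
  shows "last_in A w = a"
  unfolding last_in_def using assms by (intro Max_eqI) auto

lemma last_in_self [simp]: "a \<in> A \<Longrightarrow> last_in A a = a"
  by (rule last_in_eqI) auto

lemma last_in_Suc: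
  assumes "0 \<in> A"
  shows "last_in A (Suc w) = (if Suc w \<in> A then Suc w else last_in A w)"
proof (cases "Suc w \<in> A")
  case False
  then show ?thesis
    using last_in_mem[OF assms] last_in_le[OF assms, of w]
    by (auto intro!: last_in_eqI simp: le_Suc_eq last_in_ge)
qed simp

lemma mono_last_in:
  assumes "0 \<in> A"
  shows "mono (last_in A)"
proof (rule monoI)
  fix v w :: nat assume "v \<le> w"
  then show "last_in A v \<le> last_in A w"
    using last_in_mem[OF assms, of v] last_in_le[OF assms, of v] by (intro last_in_ge) auto
qed

lemma last_in_eq_iff:
  assumes "0 \<in> A" "u \<le> v"
  shows "last_in A u = last_in A v \<longleftrightarrow> (\<forall>a\<in>A. a \<le> v \<longrightarrow> a \<le> u)"
proof
  assume "last_in A u = last_in A v"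
  then show "\<forall>a\<in>A. a \<le> v \<longrightarrow> a \<le> u"
    using last_in_ge[of _ A v] last_in_le[OF assms(1), of u] by (metis order_trans)
next
  assume *: "\<forall>a\<in>A. a \<le> v \<longrightarrow> a \<le> u"
  show "last_in A u = last_in A v"
  proof (rule sym, rule last_in_eqI)
    show "last_in A u \<le> v" using last_in_le[OF assms(1), of u] assms(2) by simp
  qed (use assms * last_in_ge last_in_mem in auto)
qed

lemma last_in_neq_mono:
  assumes "0 \<in> A" "A \<subseteq> B" "u \<le> v" "last_in A u \<noteq> last_in A v"
  shows "last_in B u \<noteq> last_in B v"
  using assms last_in_eq_iff[of A u v] last_in_eq_iff[of B u v] by blast

lemma last_in_between:
  assumes "0 \<in> A" "last_in A u = last_in A v" "u \<le> w" "w \<le> v"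
  shows "last_in A w = last_in A u"
  using assms mono_last_in[OF assms(1)] by (metis antisym monoD)

section \<open>Refinement of an interval partition and the edges it separates\<close>

definition left_seen :: "(nat \<times> nat) set \<Rightarrow> nat set \<Rightarrow> nat set" where
  "left_seen E S = {v. \<exists>u. (u, v) \<in> E \<and> last_in S u \<noteq> last_in S v}"

definition right_seen :: "(nat \<times> nat) set \<Rightarrow> nat set \<Rightarrow> nat set" where
  "right_seen E S = {u. \<exists>v. (u, v) \<in> E \<and> last_in S u \<noteq> last_in S v}"

definition singled :: "(nat \<times> nat) set \<Rightarrow> nat set \<Rightarrow> nat set" where
  "singled E S = S \<union> left_seen E S \<union> right_seen E S"

text \<open>The successor of a singled vertex starts a part as well, so the singled vertex becomes a
  part of its own.\<close>

definition refine :: "(nat \<times> nat) set \<Rightarrow> nat set \<Rightarrow> nat set" where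
  "refine E S = singled E S \<union> Suc ` singled E S"

definition separated :: "(nat \<times> nat) set \<Rightarrow> nat set \<Rightarrow> nat \<Rightarrow> (nat \<times> nat) set" where
  "separated E S f = {(u, v) \<in> E. last_in S u = f \<and> last_in S v = f \<and>
     last_in (refine E S) u \<noteq> last_in (refine E S) v}"

lemma subset_refine: "S \<subseteq> refine E S"
  by (auto simp: refine_def singled_def)

text \<open>One of s and \<open>Suc s\<close> is a start after u and not after v: s itself if u is
  smaller than s, and \<open>Suc s\<close> if u equals s.\<close>

lemma singled_alone:
  assumes "0 \<in> S" "s \<in> singled E S" "u \<le> s" "s \<le> v" "u \<noteq> v"
  shows "last_in (refine E S) u \<noteq> last_in (refine E S) v"
proof -
  have mem: "s \<in> refine E S" "Suc s \<in> refine E S" and "0 \<in> refine E S"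
    using assms by (auto simp: refine_def singled_def)
  moreover have "u \<le> v" using assms by simp
  ultimately have *: "last_in (refine E S) u = last_in (refine E S) v \<longleftrightarrow>
      (\<forall>a\<in>refine E S. a \<le> v \<longrightarrow> a \<le> u)"
    by (intro last_in_eq_iff)
  show ?thesis
  proof
    assume "last_in (refine E S) u = last_in (refine E S) v"
    then have all: "\<And>a. a \<in> refine E S \<Longrightarrow> a \<le> v \<Longrightarrow> a \<le> u" using * by blast
    have "u = s" using all[OF mem(1)] assms by simp
    then show False using all[OF mem(2)] assms by simp
  qed
qed

lemma separated_subset: "separated E S f \<subseteq> E"
  by (auto simp: separated_def)

text \<open>Take the deepest part \<open>X\<close> of the refinement that meets both extreme branch sets. Each child of
  \<open>X\<close> misses one of them, so every branch set inside a child is seen from outside and contains a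
  vertex that is split off next. Hence the edges between such branch sets are separated in the child,
  and all others are separated in \<open>X\<close>.\<close>

lemma clique_minor_tree:
  fixes S :: "nat \<Rightarrow> nat set"
  assumes zero: "0 \<in> S 0" and S: "\<And>d. S (Suc d) = refine E (S d)" and last: "S n = UNIV"
    and local: "\<And>u v. (u, v) \<in> E \<Longrightarrow> last_in (S 0) u = last_in (S 0) v"
    and le: "\<And>u v. (u, v) \<in> E \<Longrightarrow> u \<le> v"
    and no: "\<And>d f. \<not> clique_minor (separated E (S d) f) b"
  shows "\<not> clique_minor E ((2 * b + 1) * b + 2)"
proof
  assume "clique_minor E ((2 * b + 1) * b + 2)"
  \<comment> \<open>Between the extreme labels 0 and \<open>N + 1\<close> there are N labels, which
    form b groups of \<open>2 * b + 1\<close>.\<close>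
  moreover define N where "N = (2 * b + 1) * b"
  ultimately obtain \<phi> :: "nat \<Rightarrow> nat" where \<phi>: "mono \<phi>"
    and ed: "\<And>i j. i < j \<Longrightarrow> j < N + 2 \<Longrightarrow> \<exists>u v. (u, v) \<in> E \<and> \<phi> u = i \<and> \<phi> v = j"
    by (auto elim!: clique_minorE)
  have zeros: "0 \<in> S d" for d
    by (induction d) (auto simp: zero S intro: subsetD[OF subset_refine])
  define wide where "wide d \<longleftrightarrow>
    (\<exists>x y. last_in (S d) x = last_in (S d) y \<and> \<phi> x = 0 \<and> \<phi> y = N + 1)" for d
  have "wide 0"
    using ed[of 0 "N + 1"] local unfolding wide_def by fastforce
  moreover have "\<not> wide n"
    by (auto simp: wide_def last)
  ultimately obtain d where d: "wide d" "\<not> wide (Suc d)"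
    using nat_induct[of wide n] by blast
  obtain x y where xy: "last_in (S d) x = last_in (S d) y" "\<phi> x = 0" "\<phi> y = N + 1"
    using d(1) unfolding wide_def by blast
  define f where "f = last_in (S d) x"
  have inX: "last_in (S d) w = f" if "0 < \<phi> w" "\<phi> w < N + 1" for w
    unfolding f_def using that xy \<phi>
    by (intro last_in_between[OF zeros xy(1)]) (auto intro!: mono_less_leD[OF \<phi>])
  show False
  proof (cases "\<exists>a c. last_in (S (Suc d)) a = last_in (S (Suc d)) c \<and>
      \<phi> a + 2 * b + 1 \<le> \<phi> c \<and> \<phi> c \<le> N + 1")
    case False
    \<comment> \<open>Labels spaced \<open>2 * b + 1\<close> apart never meet in one child, so the
      edges between them are separated here. Starting at 1 avoids the extreme label 0, whose branch
      set may reach outside the part.\<close>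
    have "clique_minor (separated E (S d) f) b"
    proof (rule clique_minorI[of "\<lambda>w. (\<phi> w - 1) div (2 * b + 1)"])
      show "mono (\<lambda>w. (\<phi> w - 1) div (2 * b + 1))"
        using \<phi> by (intro monoI div_le_mono diff_le_mono) (auto dest: monoD)
      fix i j assume ij: "i < j" "j < b"
      have *: "(2 * b + 1) * i + (2 * b + 1) \<le> (2 * b + 1) * j" "(2 * b + 1) * j < N"
        using ij mult_le_mono2[of "Suc i" j "2 * b + 1"] mult_less_mono2[of j b "2 * b + 1"]
        by (auto simp: N_def simp del: mult_Suc)
      then obtain u v where uv: "(u, v) \<in> E" "\<phi> u = (2 * b + 1) * i + 1" "\<phi> v = (2 * b + 1) * j + 1"
        using ed[of "(2 * b + 1) * i + 1" "(2 * b + 1) * j + 1"] by fastforce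
      have "\<phi> u + 2 * b + 1 \<le> \<phi> v" "\<phi> v \<le> N + 1" using uv * by linarith+
      then have "last_in (S (Suc d)) u \<noteq> last_in (S (Suc d)) v"
        using False by blast
      moreover have "last_in (S d) u = f" "last_in (S d) v = f"
        by (rule inX; use uv * in linarith)+
      ultimately have "(u, v) \<in> separated E (S d) f"
        using uv S by (auto simp: separated_def)
      moreover have "(\<phi> u - 1) div (2 * b + 1) = i" "(\<phi> v - 1) div (2 * b + 1) = j"
        unfolding uv add_diff_cancel_right' by (rule nonzero_mult_div_cancel_left; simp)+
      ultimately show "\<exists>u v. (u, v) \<in> separated E (S d) f \<and>
          (\<phi> u - 1) div (2 * b + 1) = i \<and> (\<phi> v - 1) div (2 * b + 1) = j"
        by blast
    qed
    with no show False by blast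
  next
    case True
    then obtain a c where ac: "last_in (S (Suc d)) a = last_in (S (Suc d)) c"
      "\<phi> a + 2 * b + 1 \<le> \<phi> c" "\<phi> c \<le> N + 1" by blast
    define f' where "f' = last_in (S (Suc d)) a"
    have inY: "last_in (S (Suc d)) w = f'" if "\<phi> a < \<phi> w" "\<phi> w < \<phi> c" for w
      unfolding f'_def using that ac \<phi>
      by (intro last_in_between[OF zeros ac(1)]) (auto intro!: mono_less_leD[OF \<phi>])
    have seer: "\<exists>w. \<phi> w = i \<and> w \<in> singled E (S (Suc d))" if i: "\<phi> a < i" "i < \<phi> c" for i
    proof -
      obtain u v where uv: "(u, v) \<in> E" "\<phi> u = 0" "\<phi> v = i" using ed[of 0 i] i ac by auto
      obtain u' v' where uv': "(u', v') \<in> E" "\<phi> u' = i" "\<phi> v' = N + 1"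
        using ed[of i "N + 1"] i ac by auto
      have "\<not> (last_in (S (Suc d)) u = f' \<and> last_in (S (Suc d)) v' = f')"
        using d(2) uv uv' unfolding wide_def by metis
      then show ?thesis
      proof (elim disjE[OF iffD1[OF de_Morgan_conj]])
        assume "last_in (S (Suc d)) u \<noteq> f'"
        then have "v \<in> left_seen E (S (Suc d))"
          using uv inY[of v] i by (auto simp: left_seen_def)
        with uv show ?thesis by (auto simp: singled_def)
      next
        assume "last_in (S (Suc d)) v' \<noteq> f'"
        then have "u' \<in> right_seen E (S (Suc d))"
          using uv' inY[of u'] i by (auto simp: right_seen_def)
        with uv' show ?thesis by (auto simp: singled_def)
      qed
    qed
    have "clique_minor (separated E (S (Suc d)) f') b"
    proof (rule clique_minorI[of "\<lambda>w. (\<phi> w - (\<phi> a + 1)) div 2"])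
      show "mono (\<lambda>w. (\<phi> w - (\<phi> a + 1)) div 2)"
        using \<phi> by (intro monoI div_le_mono diff_le_mono) (auto dest: monoD)
      fix i j assume ij: "i < j" "j < b"
      \<comment> \<open>The \<open>2 * b\<close> intermediate labels are used in pairs. The edge
        leaves the first label of pair i and enters the second label of pair j; the vertex that is
        split off has the second label of pair i and so lies strictly between its ends.\<close>
      obtain u v where uv: "(u, v) \<in> E" "\<phi> u = \<phi> a + 1 + 2 * i" "\<phi> v = \<phi> a + 2 + 2 * j"
        using ed[of "\<phi> a + 1 + 2 * i" "\<phi> a + 2 + 2 * j"] ij ac by auto
      obtain w where w: "\<phi> w = \<phi> a + 2 + 2 * i" "w \<in> singled E (S (Suc d))"
        using seer[of "\<phi> a + 2 + 2 * i"] ij ac by auto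
      have "u < w" "w < v" using uv w ij by (auto intro: mono_lessD[OF \<phi>, of u w] mono_lessD[OF \<phi>, of w v])
      then have "last_in (S (Suc (Suc d))) u \<noteq> last_in (S (Suc (Suc d))) v"
        unfolding S[of "Suc d"] using w zeros by (intro singled_alone[of _ w]) auto
      moreover have "last_in (S (Suc d)) u = f'" "last_in (S (Suc d)) v = f'"
        by (rule inY; use uv ij ac in linarith)+
      ultimately have "(u, v) \<in> separated E (S (Suc d)) f'"
        using uv S[of "Suc d"] by (auto simp: separated_def)
      with uv show "\<exists>u v. (u, v) \<in> separated E (S (Suc d)) f' \<and>
          (\<phi> u - (\<phi> a + 1)) div 2 = i \<and> (\<phi> v - (\<phi> a + 1)) div 2 = j"
        by (intro exI[of _ u] exI[of _ v]) simp
    qed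
    with no show False by blast
  qed
qed

section \<open>The two quotients of a part\<close>

definition left_block :: "(nat \<times> nat) set \<Rightarrow> nat set \<Rightarrow> nat \<Rightarrow> nat" where
  "left_block E S = last_in (S \<union> left_seen E S)"

definition right_block :: "(nat \<times> nat) set \<Rightarrow> nat set \<Rightarrow> nat \<Rightarrow> nat" where
  "right_block E S = last_in (S \<union> right_seen E S)"

text \<open>The first block starts at f, which need not have a neighbour before the part, so edges
  leaving it are dropped. Every other block starts at a vertex with such a neighbour.\<close>

definition left_quotient :: "(nat \<times> nat) set \<Rightarrow> nat set \<Rightarrow> nat \<Rightarrow> (nat \<times> nat) set" where
  "left_quotient E S f = {(left_block E S u, left_block E S v) | u v. (u, v) \<in> separated E S f \<and>
     left_block E S u \<noteq> f \<and> left_block E S u \<noteq> left_block E S v}"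

text \<open>Only edges rejected by the left quotient are taken, including those that leave its first
  block. Thus no edge is used by both quotients.\<close>

definition right_quotient :: "(nat \<times> nat) set \<Rightarrow> nat set \<Rightarrow> nat \<Rightarrow> (nat \<times> nat) set" where
  "right_quotient E S f = {(right_block E S u, right_block E S v) | u v. (u, v) \<in> separated E S f \<and>
     \<not> (left_block E S u \<noteq> f \<and> left_block E S u \<noteq> left_block E S v) \<and>
     right_block E S u \<noteq> f \<and> right_block E S u \<noteq> right_block E S v}"

lemma last_in_Un_ge: "0 \<in> S \<Longrightarrow> last_in S w \<le> last_in (S \<union> T) w"
  by (intro last_in_ge) (auto intro: last_in_mem last_in_le)

text \<open>Some edge starts in branch set 0, at f or later, so f has label 0 by monotonicity.
  Giving up branch set 0 therefore gives up all edges that start at f.\<close>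

lemma clique_minor_drop_least:
  assumes "clique_minor D (Suc b)" and f: "\<And>u v. (u, v) \<in> D \<Longrightarrow> f \<le> u"
  shows "clique_minor {(u, v) \<in> D. u \<noteq> f} b"
proof -
  obtain \<phi> :: "nat \<Rightarrow> nat" where \<phi>: "mono \<phi>"
    and ed: "\<And>i j. i < j \<Longrightarrow> j < Suc b \<Longrightarrow> \<exists>u v. (u, v) \<in> D \<and> \<phi> u = i \<and> \<phi> v = j"
    using assms(1) by (rule clique_minorE) blast
  show ?thesis
  proof (rule clique_minorI[of "\<lambda>w. \<phi> w - 1"])
    show "mono (\<lambda>w. \<phi> w - 1)"
      using \<phi> by (intro monoI diff_le_mono) (auto dest: monoD)
    fix i j assume ij: "i < j" "j < b"
    obtain u v where uv: "(u, v) \<in> D" "\<phi> u = Suc i" "\<phi> v = Suc j"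
      using ed[of "Suc i" "Suc j"] ij by auto
    obtain x y where "(x, y) \<in> D" "\<phi> x = 0" using ed[of 0 1] ij by fastforce
    then have "\<phi> f = 0" using f[of x y] \<phi> by (metis le_zero_eq monoD)
    with uv show "\<exists>u v. (u, v) \<in> {(u, v) \<in> D. u \<noteq> f} \<and> \<phi> u - 1 = i \<and> \<phi> v - 1 = j"
      by (intro exI[of _ u] exI[of _ v]) auto
  qed
qed

text \<open>Round along the left blocks and then, inside one left block, along the right blocks.
  Each rounding asks for \<open>b + 1\<close> instead of b, because the first block is dropped
  afterwards. Inside a common left and right block only a star remains.\<close>

lemma clique_minor_separated:
  assumes zero: "0 \<in> S" and le: "\<And>u v. (u, v) \<in> E \<Longrightarrow> u \<le> v"
    and L: "\<not> clique_minor (left_quotient E S f) b"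
    and R: "\<not> clique_minor (right_quotient E S f) b"
  shows "\<not> clique_minor (separated E S f) ((4 * (b + 1) + 1) * (b + 1))"
proof
  let ?l = "left_block E S" and ?r = "right_block E S" and ?D = "separated E S f"
  have zeros: "0 \<in> S \<union> left_seen E S" "0 \<in> S \<union> right_seen E S" using zero by auto
  have mono: "mono ?l" "mono ?r"
    unfolding left_block_def right_block_def by (intro mono_last_in zeros)+
  have ge: "f \<le> ?l u" "f \<le> ?r u" if "(u, v) \<in> ?D" for u v
    using that last_in_Un_ge[OF zero, of u]
    by (auto simp: left_block_def right_block_def separated_def)
  have star: "u = u'"
    if D: "(u, v) \<in> ?D" "(u', v') \<in> ?D" and l: "?l u = ?l v" "?l u' = ?l v'" "?l u = ?l u'"
      and r: "?r u = ?r v" "?r u' = ?r v'" "?r u = ?r u'" for u v u' v'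
  proof -
    \<comment> \<open>No singled vertex lies after u up to v, since it would start a new part, left
      block or right block. So only \<open>Suc u\<close> can separate u from v, which forces u to be
      singled.\<close>
    have special: "u \<in> singled E S" if D: "(u, v) \<in> ?D" and l: "?l u = ?l v" and r: "?r u = ?r v" for u v
    proof (rule ccontr)
      assume u: "u \<notin> singled E S"
      from D have le: "u \<le> v" and S: "last_in S u = last_in S v"
        and n: "last_in (refine E S) u \<noteq> last_in (refine E S) v"
        using assms(2) by (auto simp: separated_def)
      have "\<forall>a\<in>singled E S. a \<le> v \<longrightarrow> a \<le> u"
        using l r last_in_eq_iff[OF zeros(1) le] last_in_eq_iff[OF zeros(2) le]
        by (auto simp: left_block_def right_block_def singled_def)
      then have "\<forall>a\<in>refine E S. a \<le> v \<longrightarrow> a \<le> u"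
        using u unfolding refine_def
        by (auto simp: not_less_eq_eq) (metis Suc_leD Suc_leI le_neq_implies_less)
      then have "last_in (refine E S) u = last_in (refine E S) v"
        using zero le by (subst last_in_eq_iff) (auto intro: subsetD[OF subset_refine])
      with n show False by contradiction
    qed
    \<comment> \<open>A singled vertex starts a part, a left block or a right block, so two of them
      cannot share all three.\<close>
    have *: "u' \<le> u" if "u \<le> u'" "u' \<in> singled E S" "?l u = ?l u'" "?r u = ?r u'"
      "last_in S u = last_in S u'" for u u'
      using that last_in_eq_iff[OF zeros(1) that(1)] last_in_eq_iff[OF zeros(2) that(1)]
      by (auto simp: left_block_def right_block_def singled_def)
    have "u \<in> singled E S" "u' \<in> singled E S" "last_in S u = last_in S u'"
      using special that by (auto simp: separated_def)
    then show ?thesis using * l r by (metis le_antisym nat_le_linear)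
  qed
  assume "clique_minor ?D ((4 * (b + 1) + 1) * (b + 1))"
  from clique_minor_partition[OF this mono(1)]
  show False
  proof (elim disjE exE)
    assume "clique_minor {(?l u, ?l v) | u v. (u, v) \<in> ?D \<and> ?l u \<noteq> ?l v} (b + 1)"
    then have "clique_minor {(u', v') \<in> {(?l u, ?l v) | u v. (u, v) \<in> ?D \<and> ?l u \<noteq> ?l v}. u' \<noteq> f} b"
      using ge by (intro clique_minor_drop_least) auto
    then have "clique_minor (left_quotient E S f) b"
      by (rule clique_minor_subset) (auto simp: left_quotient_def)
    with L show False by contradiction
  next
    fix c
    let ?C = "{(u, v) \<in> ?D. ?l u = c \<and> ?l v = c}"
    assume "clique_minor ?C (4 * (b + 1))"
    \<comment> \<open>The 3 is the size excluded by the star inside a common block.\<close>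
    then have "clique_minor ?C ((3 + 1) * (b + 1))" by simp
    from clique_minor_partition[OF this mono(2)]
    show False
    proof (elim disjE exE)
      assume "clique_minor {(?r u, ?r v) | u v. (u, v) \<in> ?C \<and> ?r u \<noteq> ?r v} (b + 1)"
      then have "clique_minor {(u', v') \<in> {(?r u, ?r v) | u v. (u, v) \<in> ?C \<and> ?r u \<noteq> ?r v}. u' \<noteq> f} b"
        using ge by (intro clique_minor_drop_least) auto
      then have "clique_minor (right_quotient E S f) b"
        proof (rule clique_minor_subset, intro subsetI)
        fix p assume "p \<in> {(u', v') \<in> {(?r u, ?r v) | u v. (u, v) \<in> ?C \<and> ?r u \<noteq> ?r v}. u' \<noteq> f}"
        then obtain u v where "p = (?r u, ?r v)" "(u, v) \<in> ?D" "?r u \<noteq> ?r v" "?r u \<noteq> f" "?l u = ?l v"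
          by auto
        then show "p \<in> right_quotient E S f"
          unfolding right_quotient_def by blast
      qed
      with R show False by contradiction
    next
      fix c'
      let ?B = "{(u, v) \<in> ?C. ?r u = c' \<and> ?r v = c'}"
      assume B: "clique_minor ?B 3"
      then obtain a w where aw: "(a, w) \<in> ?B"
        unfolding clique_minor_def by (metis less_numeral_extra(1) one_less_numeral_iff semiring_norm(77))
      have "\<not> clique_minor ?B 3"
      proof (rule not_clique_minor_star)
        fix u v assume "(u, v) \<in> ?B"
        with aw show "u = a" by (intro star[of u v a w]) auto
      qed
      with B show False by contradiction
    qed
  qed
qed

text \<open>The vertices before f form the new branch set 0. A block other than the first starts at
  a vertex with a neighbour in another part; edges point to the right, so this neighbour lies before
  f.\<close>

lemma clique_minor_left_quotient:
  assumes K: "clique_minor (left_quotient E S f) t" and t: "2 \<le> t" and zero: "0 \<in> S"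
    and le: "\<And>u v. (u, v) \<in> E \<Longrightarrow> u \<le> v"
  shows "clique_minor E (Suc t)"
proof -
  let ?l = "left_block E S"
  have zeros: "0 \<in> S \<union> left_seen E S" using zero by auto
  have monol: "mono ?l" unfolding left_block_def by (intro mono_last_in zeros)
  obtain \<phi> :: "nat \<Rightarrow> nat" where \<phi>: "mono \<phi>" and bd: "\<And>w. \<phi> w \<le> t"
    and ed: "\<And>i j. i < j \<Longrightarrow> j < t \<Longrightarrow> \<exists>u v. (u, v) \<in> left_quotient E S f \<and> \<phi> u = i \<and> \<phi> v = j"
    using K by (rule clique_minor_boundedE) blast
  have fS: "f \<in> S"
    using ed[of 0 1] t last_in_mem[OF zero] by (auto simp: left_quotient_def separated_def)
  define \<Phi> where "\<Phi> w = (if w < f then 0 else \<phi> (?l w) + 1)" for w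
  have seen: "w \<in> left_seen E S" "f \<le> w" "last_in S w = f" "?l w = w"
    if "w = ?l w'" "w \<noteq> f" "last_in S w' = f" for w w'
  proof -
    have "w \<in> S \<union> left_seen E S" "w \<le> w'" "f \<le> w"
      using that last_in_mem[OF zeros] last_in_le[OF zeros] last_in_Un_ge[OF zero, of w']
      by (auto simp: left_block_def)
    moreover have "last_in S w = f"
      using that fS calculation last_in_between[OF zero, of f w' w] by simp
    ultimately show "w \<in> left_seen E S" "f \<le> w" "last_in S w = f" "?l w = w"
      using that by (auto simp: left_block_def)
  qed
  have outer: "\<exists>x. (x, w) \<in> E \<and> \<Phi> x = 0 \<and> \<Phi> w = \<phi> w + 1"
    if "w = ?l w'" "w \<noteq> f" "last_in S w' = f" for w w'
  proof -
    from seen(1)[OF that] obtain x where x: "(x, w) \<in> E" "last_in S x \<noteq> last_in S w"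
      by (auto simp: left_seen_def)
    have "x < f"
    proof (rule ccontr)
      assume "\<not> x < f"
      then have "last_in S x = last_in S f"
        using le[OF x(1)] seen[OF that] fS by (intro last_in_between[OF zero, of f w]) auto
      with x seen[OF that] fS show False by simp
    qed
    with x seen[OF that] show ?thesis by (intro exI[of _ x]) (auto simp: \<Phi>_def)
  qed
  show ?thesis
  proof (rule clique_minorI[of \<Phi>])
    show "mono \<Phi>"
      using \<phi> monol by (intro monoI) (auto simp: \<Phi>_def dest: monoD)
    fix i j assume ij: "i < j" "j < Suc t"
    show "\<exists>u v. (u, v) \<in> E \<and> \<Phi> u = i \<and> \<Phi> v = j"
    proof (cases i)
      case 0
      \<comment> \<open>As t is at least 2, every label is an end of some required edge of the
        quotient. The branch set of that label then contains a block start other than f, which is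
        adjacent to branch set 0.\<close>
      obtain i' j' where ij': "i' < j'" "j' < t" "j = Suc i' \<or> j = Suc j'"
        using ij t 0 that[of "j - 1" j] that[of 0 "t - 1"] by (cases "j = t") auto
      then obtain a b where ab: "(a, b) \<in> left_quotient E S f" "\<phi> a = i'" "\<phi> b = j'"
        using ed by blast
      then obtain u v where uv: "a = ?l u" "b = ?l v" "(u, v) \<in> separated E S f" "a \<noteq> f" "a \<noteq> b"
        by (auto simp: left_quotient_def)
      then have "last_in S u = f" "last_in S v = f" "u \<le> v" using le by (auto simp: separated_def)
      moreover have "a \<le> b" "f \<le> a" using monol uv \<open>u \<le> v\<close> seen(2)[OF uv(1,4)] calculation by (auto dest: monoD)
      ultimately show ?thesis
        using outer[OF uv(1)] outer[OF uv(2)] uv ab ij' 0 by auto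
    next
      case (Suc i')
      then obtain j' where j': "j = Suc j'" using ij by (cases j) auto
      obtain a b where ab: "(a, b) \<in> left_quotient E S f" "\<phi> a = i'" "\<phi> b = j'"
        using ed[of i' j'] ij Suc j' by auto
      then obtain u v where uv: "a = ?l u" "b = ?l v" "(u, v) \<in> separated E S f"
        by (auto simp: left_quotient_def)
      then have "f \<le> u" "f \<le> v" "(u, v) \<in> E"
        using last_in_le[OF zero, of u] last_in_le[OF zero, of v] by (auto simp: separated_def)
      then show ?thesis
        using ab uv Suc j' by (intro exI[of _ u] exI[of _ v]) (auto simp: \<Phi>_def)
    qed
  qed
qed

text \<open>Mirror image of the left quotient: the new branch set consists of the vertices after the
  part and comes last.\<close>

lemma clique_minor_right_quotient:
  assumes K: "clique_minor (right_quotient E S f) t" and t: "2 \<le> t" and zero: "0 \<in> S"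
    and le: "\<And>u v. (u, v) \<in> E \<Longrightarrow> u \<le> v"
  shows "clique_minor E (Suc t)"
proof -
  let ?r = "right_block E S" and ?c = "last_in S"
  have zeros: "0 \<in> S \<union> right_seen E S" using zero by auto
  have mono: "mono ?r" "mono ?c" unfolding right_block_def by (intro mono_last_in zeros zero)+
  obtain \<phi> :: "nat \<Rightarrow> nat" where \<phi>: "mono \<phi>"
    and ed: "\<And>i j. i < j \<Longrightarrow> j < t \<Longrightarrow> \<exists>u v. (u, v) \<in> right_quotient E S f \<and> \<phi> u = i \<and> \<phi> v = j"
    using K by (rule clique_minorE) blast
  have fS: "f \<in> S"
    using ed[of 0 1] t last_in_mem[OF zero] by (auto simp: right_quotient_def separated_def)
  \<comment> \<open>Truncation at \<open>t - 1\<close> keeps the labels inside the part below the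
    label t of the new branch set. Vertices before the part can join branch set 0.\<close>
  define \<Phi> where
    "\<Phi> w = (if ?c w < f then 0 else if ?c w = f then min (\<phi> (?r w)) (t - 1) else t)" for w
  have seen: "w \<in> right_seen E S" "?c w = f" "?r w = w"
    if "w = ?r w'" "w \<noteq> f" "?c w' = f" for w w'
  proof -
    have "w \<in> S \<union> right_seen E S" "w \<le> w'" "f \<le> w"
      using that last_in_mem[OF zeros] last_in_le[OF zeros] last_in_Un_ge[OF zero, of w']
      by (auto simp: right_block_def)
    moreover have "?c w = f"
      using that fS calculation last_in_between[OF zero, of f w' w] by simp
    ultimately show "w \<in> right_seen E S" "?c w = f" "?r w = w"
      using that by (auto simp: right_block_def)
  qed
  have outer: "\<exists>x. (w, x) \<in> E \<and> \<Phi> x = t \<and> \<Phi> w = \<phi> w"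
    if "w = ?r w'" "w \<noteq> f" "?c w' = f" "\<phi> w < t" for w w'
  proof -
    from seen(1)[OF that(1-3)] obtain x where x: "(w, x) \<in> E" "?c w \<noteq> ?c x"
      by (auto simp: right_seen_def)
    have "f < ?c x"
      using x monoD[OF mono(2) le[OF x(1)]] seen(2)[OF that(1-3)] by simp
    with x seen[OF that(1-3)] that(4) show ?thesis by (intro exI[of _ x]) (auto simp: \<Phi>_def)
  qed
  show ?thesis
  proof (rule clique_minorI[of \<Phi>])
    show "mono \<Phi>"
    proof (rule monoI)
      fix v w :: nat assume "v \<le> w"
      then have "?c v \<le> ?c w" "\<phi> (?r v) \<le> \<phi> (?r w)" using mono \<phi> by (auto intro: monoD)
      then show "\<Phi> v \<le> \<Phi> w" by (auto simp: \<Phi>_def)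
    qed
    fix i j assume ij: "i < j" "j < Suc t"
    show "\<exists>u v. (u, v) \<in> E \<and> \<Phi> u = i \<and> \<Phi> v = j"
    proof (cases "j = t")
      case True
      obtain i' j' where ij': "i' < j'" "j' < t" "i = i' \<or> i = j'"
        using ij t True that[of i "t - 1"] that[of 0 i] by (cases "i = 0") auto
      then obtain a b where ab: "(a, b) \<in> right_quotient E S f" "\<phi> a = i'" "\<phi> b = j'"
        using ed by blast
      then obtain u v where uv: "a = ?r u" "b = ?r v" "(u, v) \<in> separated E S f" "a \<noteq> f" "a \<noteq> b"
        by (auto simp: right_quotient_def)
      then have c: "?c u = f" "?c v = f" "u \<le> v" using le by (auto simp: separated_def)
      have "a \<le> b" "f \<le> a"
        using mono uv c last_in_Un_ge[OF zero, of u] by (auto dest: monoD simp: right_block_def)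
      then show ?thesis
        using outer[OF uv(1,4) c(1)] outer[OF uv(2) _ c(2)] uv(5) ab ij' True by auto
    next
      case False
      obtain a b where ab: "(a, b) \<in> right_quotient E S f" "\<phi> a = i" "\<phi> b = j"
        using ed[of i j] ij False by auto
      then obtain u v where uv: "a = ?r u" "b = ?r v" "(u, v) \<in> separated E S f"
        by (auto simp: right_quotient_def)
      then show ?thesis
        using ab ij False by (intro exI[of _ u] exI[of _ v]) (auto simp: \<Phi>_def separated_def)
    qed
  qed
qed

text \<open>The two quotients of a part starting at \<open>f\<close> get the numbers \<open>2 * f\<close> and \<open>2 * f + 1\<close>. Since \<open>f\<close> is
  split off when its part is refined, these numbers determine the part.\<close>

definition quotient_edge ::
  "(nat \<times> nat) set \<Rightarrow> nat set \<Rightarrow> nat \<Rightarrow> nat \<Rightarrow> nat \<Rightarrow> nat \<Rightarrow> nat \<Rightarrow> bool" where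
  "quotient_edge E S u v g a b \<longleftrightarrow> (\<exists>f. (u, v) \<in> separated E S f \<and>
     (if left_block E S u \<noteq> f \<and> left_block E S u \<noteq> left_block E S v
      then g = 2 * f \<and> a = left_block E S u - f \<and> b = left_block E S v - f
      else right_block E S u \<noteq> f \<and> right_block E S u \<noteq> right_block E S v \<and>
        g = 2 * f + 1 \<and> a = right_block E S u - f \<and> b = right_block E S v - f))"

text \<open>Quotient edges are recorded by offsets from the start \<open>g div 2\<close> of the
  part, so that a quotient later fits into a block of n vertices. Adding the start recovers the
  quotient itself.\<close>

definition group_graph :: "(nat \<times> nat) set \<Rightarrow> nat set \<Rightarrow> nat \<Rightarrow> (nat \<times> nat) set" where
  "group_graph E S g = {(g div 2 + a, g div 2 + b) | a b u v. quotient_edge E S u v g a b}"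

lemma block_ge:
  assumes "0 \<in> S" "(u, v) \<in> separated E S f"
  shows "f \<le> left_block E S u" "f \<le> left_block E S v" "f \<le> right_block E S u" "f \<le> right_block E S v"
  using assms last_in_Un_ge[OF assms(1), of u] last_in_Un_ge[OF assms(1), of v]
  by (auto simp: left_block_def right_block_def separated_def)

lemma block_le:
  assumes "0 \<in> S"
  shows "left_block E S u \<le> u" "right_block E S u \<le> u"
  using assms by (auto simp: left_block_def right_block_def intro: last_in_le)

lemma quotient_edgeE:
  assumes "quotient_edge E S u v g a b" "0 \<in> S"
  obtains f where "(u, v) \<in> separated E S f" "g = 2 * f" "f + a = left_block E S u"
      "f + b = left_block E S v" "left_block E S u \<noteq> f" "left_block E S u \<noteq> left_block E S v"
  | f where "(u, v) \<in> separated E S f" "g = 2 * f + 1" "f + a = right_block E S u"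
      "f + b = right_block E S v" "\<not> (left_block E S u \<noteq> f \<and> left_block E S u \<noteq> left_block E S v)"
      "right_block E S u \<noteq> f" "right_block E S u \<noteq> right_block E S v"
proof -
  obtain f where f: "(u, v) \<in> separated E S f"
    "if left_block E S u \<noteq> f \<and> left_block E S u \<noteq> left_block E S v
      then g = 2 * f \<and> a = left_block E S u - f \<and> b = left_block E S v - f
      else right_block E S u \<noteq> f \<and> right_block E S u \<noteq> right_block E S v \<and>
        g = 2 * f + 1 \<and> a = right_block E S u - f \<and> b = right_block E S v - f"
    using assms(1) unfolding quotient_edge_def by blast
  note ge = block_ge[OF assms(2) f(1)]
  show thesis
  proof (cases "left_block E S u \<noteq> f \<and> left_block E S u \<noteq> left_block E S v")
    case True
    then show ?thesis using f ge by (intro that(1)[of f]) simp_all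
  next
    case False
    then show ?thesis using f ge unfolding if_not_P[OF False] by (intro that(2)[of f]) simp_all
  qed
qed

lemma group_graph_even:
  assumes "0 \<in> S"
  shows "group_graph E S (2 * f) = left_quotient E S f"
proof (intro subset_antisym subsetI)
  fix p assume "p \<in> group_graph E S (2 * f)"
  then obtain a b u v where p: "p = (f + a, f + b)" and q: "quotient_edge E S u v (2 * f) a b"
    by (auto simp: group_graph_def)
  show "p \<in> left_quotient E S f"
  proof (rule quotient_edgeE[OF q assms])
    fix f' assume "2 * f = 2 * f' + 1"
    then have False by presburger
    then show ?thesis ..
  qed (use p in \<open>auto simp: left_quotient_def\<close>)
next
  fix p assume "p \<in> left_quotient E S f"
  then obtain u v where p: "p = (left_block E S u, left_block E S v)" and s: "(u, v) \<in> separated E S f"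
    and ne: "left_block E S u \<noteq> f" "left_block E S u \<noteq> left_block E S v"
    by (auto simp: left_quotient_def)
  then have "quotient_edge E S u v (2 * f) (left_block E S u - f) (left_block E S v - f)"
    unfolding quotient_edge_def by (intro exI[of _ f]) simp
  moreover have "p = (2 * f div 2 + (left_block E S u - f), 2 * f div 2 + (left_block E S v - f))"
    using p block_ge[OF assms s] by simp
  ultimately show "p \<in> group_graph E S (2 * f)" unfolding group_graph_def by blast
qed

lemma group_graph_odd:
  assumes "0 \<in> S"
  shows "group_graph E S (2 * f + 1) = right_quotient E S f"
proof (intro subset_antisym subsetI)
  fix p assume "p \<in> group_graph E S (2 * f + 1)"
  then obtain a b u v where p: "p = (f + a, f + b)" and q: "quotient_edge E S u v (2 * f + 1) a b"
    by (auto simp: group_graph_def)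
  show "p \<in> right_quotient E S f"
  proof (rule quotient_edgeE[OF q assms])
    fix f' assume "2 * f + 1 = 2 * f'"
    then have False by presburger
    then show ?thesis ..
  next
    fix f' assume "2 * f + 1 = 2 * f' + 1" "(u, v) \<in> separated E S f'" "f' + a = right_block E S u"
      "f' + b = right_block E S v" "\<not> (left_block E S u \<noteq> f' \<and> left_block E S u \<noteq> left_block E S v)"
      "right_block E S u \<noteq> f'" "right_block E S u \<noteq> right_block E S v"
    then show ?thesis unfolding right_quotient_def p by fastforce
  qed
next
  fix p assume "p \<in> right_quotient E S f"
  then obtain u v where p: "p = (right_block E S u, right_block E S v)" and s: "(u, v) \<in> separated E S f"
    and ne: "\<not> (left_block E S u \<noteq> f \<and> left_block E S u \<noteq> left_block E S v)"
      "right_block E S u \<noteq> f" "right_block E S u \<noteq> right_block E S v"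
    unfolding right_quotient_def by blast
  then have "quotient_edge E S u v (2 * f + 1) (right_block E S u - f) (right_block E S v - f)"
    unfolding quotient_edge_def by (intro exI[of _ f]) simp
  moreover have "p = ((2 * f + 1) div 2 + (right_block E S u - f), (2 * f + 1) div 2 + (right_block E S v - f))"
    using p block_ge[OF assms s] by simp
  ultimately show "p \<in> group_graph E S (2 * f + 1)" unfolding group_graph_def by blast
qed

lemma clique_minor_group_graph:
  assumes "clique_minor (group_graph E S g) t" "2 \<le> t" "0 \<in> S"
    and "\<And>u v. (u, v) \<in> E \<Longrightarrow> u \<le> v"
  shows "clique_minor E (Suc t)"
proof (cases "even g")
  case True
  then show ?thesis
    using assms group_graph_even[of S E "g div 2"] by (auto intro: clique_minor_left_quotient)
next
  case False
  then show ?thesis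
    using assms group_graph_odd[of S E "g div 2"] by (auto intro: clique_minor_right_quotient)
qed

text \<open>The inequality \<open>g div 2 < u\<close> is strict because edges from the first block
  are discarded. It is the reason why g determines the round.\<close>

lemma quotient_edgeD:
  assumes "quotient_edge E S u v g a b" "0 \<in> S"
  shows "(u, v) \<in> separated E S (g div 2)" "g div 2 < u" "g div 2 + a \<le> u" "g div 2 + b \<le> v"
  using assms block_le[OF assms(2), of E u] block_le[OF assms(2), of E v] block_ge[OF assms(2), of u v E "g div 2"]
  by (auto elim!: quotient_edgeE)

lemma quotient_edge_unique:
  assumes "quotient_edge E S u v g a b" "quotient_edge E S u v g' a' b'"
  shows "g = g' \<and> a = a' \<and> b = b'"
proof -
  have *: "f = last_in S u" if "(u, v) \<in> separated E S f" for f
    using that by (simp add: separated_def)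
  then show ?thesis
    using assms unfolding quotient_edge_def by (auto dest!: * split: if_splits)
qed

lemma quotient_edge_le:
  assumes "quotient_edge E S u v g a b" "0 \<in> S" "u \<le> v"
  shows "a \<le> b"
proof -
  have "0 \<in> S \<union> left_seen E S" "0 \<in> S \<union> right_seen E S" using assms by auto
  then have "left_block E S u \<le> left_block E S v" "right_block E S u \<le> right_block E S v"
    using assms(3) mono_last_in unfolding left_block_def right_block_def by (auto intro: monoD)
  then show ?thesis using assms(1,2) by (auto elim!: quotient_edgeE)
qed

section \<open>One level of the recursion\<close>

text \<open>A loop never contributes to a clique minor, so loops stand for deleted edges.\<close>

definition edges :: "nat \<Rightarrow> (nat \<Rightarrow> nat) \<Rightarrow> (nat \<Rightarrow> nat) \<Rightarrow> (nat \<times> nat) set" where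
  "edges m U V = {(U e, V e) | e. e < m}"

text \<open>The vertices are grouped into blocks of length \<open>n\<close>, one for each graph of the current family.\<close>

definition starts :: "nat \<Rightarrow> (nat \<times> nat) set \<Rightarrow> nat \<Rightarrow> nat set" where
  "starts n E d = (refine E ^^ d) {w. n dvd w}"

lemma starts_0: "starts n E 0 = {w. n dvd w}"
  and starts_Suc: "starts n E (Suc d) = refine E (starts n E d)"
  by (simp_all add: starts_def)

lemma mono_starts: "d \<le> d' \<Longrightarrow> starts n E d \<subseteq> starts n E d'"
proof (induction d' rule: dec_induct)
  case (step d')
  then show ?case using subset_refine[of "starts n E d'" E] by (simp add: starts_Suc)
qed simp

lemma zero_in_starts: "0 \<in> starts n E d"
  using mono_starts[of 0 d n E] by (auto simp: starts_0)

text \<open>Each round splits off at least the first vertex of every part, so after d rounds all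
  vertices with offset at most d in their block are starts.\<close>

lemma starts_UNIV:
  assumes "0 < n" "n \<le> d"
  shows "starts n E d = UNIV"
proof -
  have "w \<in> starts n E d" if "w mod n \<le> d" for w d
    using that
  proof (induction d arbitrary: w)
    case 0
    then show ?case by (auto simp: starts_0)
  next
    case (Suc d)
    show ?case
    proof (cases "w mod n \<le> d")
      case True
      then show ?thesis by (intro subsetD[OF mono_starts[of d "Suc d"] Suc.IH]) simp_all
    next
      case False
      with Suc.prems obtain w' where "w = Suc w'" "w' mod n = d"
        by (cases w) (auto simp: mod_Suc split: if_splits)
      with Suc.IH[of w'] show ?thesis by (auto simp: starts_Suc refine_def singled_def)
    qed
  qed
  moreover have "w mod n \<le> d" for w using assms mod_less_divisor[of n w] by linarith
  ultimately show ?thesis by blast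
qed

lemma last_in_multiples: "last_in {w. n dvd w} w = w div n * n"
proof (rule last_in_eqI)
  fix b assume "b \<in> {w. n dvd w}" "b \<le> w"
  then have "b div n * n = b" "b div n \<le> w div n" by (auto simp: div_le_mono)
  then show "b \<le> w div n * n" using mult_le_mono1[of "b div n" "w div n" n] by simp
qed auto

lemma last_in_starts_ge: "w div n * n \<le> last_in (starts n E d) w"
  using mono_starts[of 0 d n E] by (intro last_in_ge) (auto simp: starts_0)

text \<open>After the earlier round the start \<open>g div 2\<close> is alone in its part, whereas a
  quotient edge with number g needs a later vertex in that part.\<close>

lemma quotient_edge_round_unique:
  assumes "quotient_edge E (starts n E d) u v g a b" "quotient_edge E (starts n E d') u' v' g a' b'"
  shows "d = d'"
proof -
  have *: "\<not> d < d'"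
    if q: "quotient_edge E (starts n E d) u v g a b" "quotient_edge E (starts n E d') u' v' g a' b'"
    for d d' u v u' v' a a' b b'
  proof
    assume "d < d'"
    have "g div 2 \<in> starts n E d"
      using quotient_edgeD(1)[OF q(1) zero_in_starts] last_in_mem[OF zero_in_starts, of n E d u]
      by (auto simp: separated_def)
    then have "Suc (g div 2) \<in> starts n E (Suc d)"
      by (auto simp: starts_Suc refine_def singled_def)
    then have "Suc (g div 2) \<in> starts n E d'"
      using mono_starts[of "Suc d" d' n E] \<open>d < d'\<close> by auto
    then have "Suc (g div 2) \<le> last_in (starts n E d') u'"
      using quotient_edgeD(2)[OF q(2) zero_in_starts] by (intro last_in_ge) auto
    with quotient_edgeD(1)[OF q(2) zero_in_starts] show False by (auto simp: separated_def)
  qed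
  from *[OF assms] *[OF assms(2,1)] show ?thesis by simp
qed

text \<open>Partitions only become finer, so the ends of an edge never share a part again once they
  have been separated.\<close>

lemma separated_round_unique:
  assumes "(u, v) \<in> separated E (starts n E d) f" "(u, v) \<in> separated E (starts n E d') f'" "u \<le> v"
  shows "d = d'"
proof -
  have *: "\<not> d < d'"
    if q: "(u, v) \<in> separated E (starts n E d) f" "(u, v) \<in> separated E (starts n E d') f'"
    for d d' f f'
  proof
    assume "d < d'"
    moreover have "last_in (starts n E (Suc d)) u \<noteq> last_in (starts n E (Suc d)) v"
      using q(1) by (simp add: separated_def starts_Suc)
    ultimately have "last_in (starts n E d') u \<noteq> last_in (starts n E d') v"
      using last_in_neq_mono[OF zero_in_starts mono_starts[of "Suc d" d'] assms(3)] by simp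
    with q(2) show False by (auto simp: separated_def)
  qed
  from *[OF assms(1,2)] *[OF assms(2,1)] show ?thesis by simp
qed

definition well_formed :: "nat \<Rightarrow> nat \<Rightarrow> (nat \<Rightarrow> nat) \<Rightarrow> (nat \<Rightarrow> nat) \<Rightarrow> bool" where
  "well_formed n m U V \<longleftrightarrow> (\<forall>e<m. U e \<le> V e \<and> U e div n = V e div n \<and> V e < m * n)"

text \<open>An edge taken by no quotient keeps the default 0. This is also the number of the left
  quotient of the part at 0, but equal offsets turn the edge into a loop, so it adds nothing
  there.\<close>

definition collected ::
  "nat \<Rightarrow> nat \<Rightarrow> (nat \<Rightarrow> nat) \<Rightarrow> (nat \<Rightarrow> nat) \<Rightarrow> nat \<Rightarrow> (nat \<Rightarrow> nat) \<Rightarrow> (nat \<Rightarrow> nat) \<Rightarrow> (nat \<Rightarrow> nat) \<Rightarrow> bool" where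
  "collected n m U V D G A B \<longleftrightarrow> (\<forall>e<m.
     (\<exists>d<D. quotient_edge (edges m U V) (starts n (edges m U V) d) (U e) (V e) (G e) (A e) (B e)) \<or>
     (\<forall>d<D. \<forall>g a b. \<not> quotient_edge (edges m U V) (starts n (edges m U V) d) (U e) (V e) g a b) \<and>
       G e = 0 \<and> A e = 0 \<and> B e = 0)"

text \<open>\<open>G e\<close> is the quotient graph to which \<open>e\<close> is passed on, and \<open>I\<close> picks one edge of each quotient
  graph, whose number then serves as the number of its block.\<close>

locale level =
  fixes n m :: nat and U V G A B I U' V' :: "nat \<Rightarrow> nat"
  assumes n: "0 < n" and wf: "well_formed n m U V" and col: "collected n m U V n G A B"
    and I: "\<And>e. e < m \<Longrightarrow> I (G e) < m \<and> G (I (G e)) = G e"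
    and U': "\<And>e. e < m \<Longrightarrow> U' e = I (G e) * n + A e"
    and V': "\<And>e. e < m \<Longrightarrow> V' e = I (G e) * n + B e"
begin

abbreviation "E \<equiv> edges m U V"
abbreviation "E' \<equiv> edges m U' V'"
abbreviation "S \<equiv> starts n E"

lemma E_le: "(u, v) \<in> E \<Longrightarrow> u \<le> v"
  using wf by (auto simp: edges_def well_formed_def)

lemma edge_cases:
  assumes "e < m"
  obtains d where "d < n" "quotient_edge E (S d) (U e) (V e) (G e) (A e) (B e)"
  | "\<And>d g a b. d < n \<Longrightarrow> \<not> quotient_edge E (S d) (U e) (V e) g a b" "A e = 0" "B e = 0"
  using col assms unfolding collected_def by metis

text \<open>A part starts no earlier than its block of length n, so an offset within the part is
  below n.\<close>

lemma AB:
  assumes e: "e < m"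
  shows "A e \<le> B e \<and> B e < n"
proof (rule edge_cases[OF e])
  fix d assume q: "quotient_edge E (S d) (U e) (V e) (G e) (A e) (B e)"
  have "G e div 2 = last_in (S d) (V e)" "G e div 2 + B e \<le> V e"
    using quotient_edgeD[OF q zero_in_starts] by (auto simp: separated_def)
  moreover have "V e div n * n \<le> last_in (S d) (V e)" by (rule last_in_starts_ge)
  moreover have "V e < V e div n * n + n" using n by (metis add.commute dividend_less_div_times)
  ultimately show "A e \<le> B e \<and> B e < n"
    using quotient_edge_le[OF q zero_in_starts] wf e by (auto simp: well_formed_def)
qed (use n in auto)

lemma div': "e < m \<Longrightarrow> U' e div n = I (G e) \<and> V' e div n = I (G e)"
  using AB[of e] U'[of e] V'[of e] by (auto intro!: div_nat_eqI simp: algebra_simps)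

lemma well_formed': "well_formed n m U' V'"
proof -
  have "V' e < m * n" if "e < m" for e
  proof -
    have "V' e < Suc (I (G e)) * n" using AB[OF that] V'[OF that] by simp
    also have "\<dots> \<le> m * n" using I[OF that] by (intro mult_le_mono1) simp
    finally show ?thesis .
  qed
  then show ?thesis using AB U' V' div' by (auto simp: well_formed_def)
qed

text \<open>A clique minor lives in a single block: the edge between the labels 0 and
  \<open>t - 1\<close> lies in one block, and every other required edge has an end with a label
  strictly between, which is trapped there. One block means one quotient number, and that means one
  round.\<close>

lemma clique_minor_up:
  assumes K: "clique_minor E' t" and t: "2 \<le> t"
  shows "clique_minor E (Suc t)"
proof -
  obtain \<phi> :: "nat \<Rightarrow> nat" where \<phi>: "mono \<phi>"
    and ed: "\<And>i j. i < j \<Longrightarrow> j < t \<Longrightarrow> \<exists>u v. (u, v) \<in> E' \<and> \<phi> u = i \<and> \<phi> v = j"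
    using K by (rule clique_minorE) blast
  have ed: "\<exists>e<m. \<phi> (U' e) = i \<and> \<phi> (V' e) = j" if "i < j" "j < t" for i j
    using ed[OF that] by (auto simp: edges_def)
  obtain e0 where e0: "e0 < m" "\<phi> (U' e0) = 0" "\<phi> (V' e0) = t - 1"
    using ed[of 0 "t - 1"] t by auto
  have in_block: "w div n = I (G e0)" if "0 < \<phi> w" "\<phi> w < t - 1" for w
  proof -
    have "U' e0 \<le> w" "w \<le> V' e0" using that e0 by (auto intro!: mono_less_leD[OF \<phi>])
    then show ?thesis using div'[OF e0(1)] div_le_mono by (metis le_antisym)
  qed
  have same: "\<exists>e<m. \<phi> (U' e) = i \<and> \<phi> (V' e) = j \<and> G e = G e0" if ij: "i < j" "j < t" for i j
  proof (cases "i = 0 \<and> j = t - 1")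
    case False
    obtain e where e: "e < m" "\<phi> (U' e) = i" "\<phi> (V' e) = j" using ed[OF ij] by blast
    have "I (G e) = I (G e0)"
      using in_block[of "U' e"] in_block[of "V' e"] div'[OF e(1)] e ij False by (cases "i = 0") auto
    then have "G e = G e0" using I[OF e(1)] I[OF e0(1)] by metis
    with e show ?thesis by blast
  qed (use e0 in blast)
  \<comment> \<open>Ends with different labels are different vertices, so the edge does not carry
    the default entry.\<close>
  have alive: "\<exists>d<n. quotient_edge E (S d) (U e) (V e) (G e) (A e) (B e)"
    if "e < m" "\<phi> (U' e) < \<phi> (V' e)" for e
    by (rule edge_cases[OF that(1)]) (use that U'[of e] V'[of e] in auto)
  obtain d where d: "quotient_edge E (S d) (U e0) (V e0) (G e0) (A e0) (B e0)"
    using alive[OF e0(1)] e0 t by auto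
  have "clique_minor (group_graph E (S d) (G e0)) t"
  proof (rule clique_minorI[of "\<lambda>w. \<phi> (I (G e0) * n + (w - G e0 div 2))"])
    show "mono (\<lambda>w. \<phi> (I (G e0) * n + (w - G e0 div 2)))"
      by (intro monoI monoD[OF \<phi>] add_left_mono diff_le_mono)
    fix i j assume ij: "i < j" "j < t"
    obtain e where e: "e < m" "\<phi> (U' e) = i" "\<phi> (V' e) = j" "G e = G e0" using same[OF ij] by blast
    then obtain d' where d': "quotient_edge E (S d') (U e) (V e) (G e0) (A e) (B e)"
      using alive[of e] ij by auto
    then have "quotient_edge E (S d) (U e) (V e) (G e0) (A e) (B e)"
      using quotient_edge_round_unique[OF d d'] by simp
    then have "(G e0 div 2 + A e, G e0 div 2 + B e) \<in> group_graph E (S d) (G e0)"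
      unfolding group_graph_def by blast
    then show "\<exists>u v. (u, v) \<in> group_graph E (S d) (G e0) \<and>
        \<phi> (I (G e0) * n + (u - G e0 div 2)) = i \<and> \<phi> (I (G e0) * n + (v - G e0 div 2)) = j"
      using e U'[OF e(1)] V'[OF e(1)]
      by (intro exI[of _ "G e0 div 2 + A e"] exI[of _ "G e0 div 2 + B e"]) simp
  qed
  then show ?thesis
    using t E_le zero_in_starts by (intro clique_minor_group_graph) auto
qed

text \<open>The labelling of the quotient is moved to its block and continued by 0 before it and by
  b after it.\<close>

lemma group_graph_down:
  assumes K: "clique_minor (group_graph E (S d) g) b" and b: "2 \<le> b" and d: "d < n"
  shows "clique_minor E' b"
proof -
  obtain \<phi> :: "nat \<Rightarrow> nat" where \<phi>: "mono \<phi>" "\<And>w. \<phi> w \<le> b"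
    and ed: "\<And>i j. i < j \<Longrightarrow> j < b \<Longrightarrow> \<exists>u v. (u, v) \<in> group_graph E (S d) g \<and> \<phi> u = i \<and> \<phi> v = j"
    using K by (rule clique_minor_boundedE) blast
  have ed: "\<exists>e<m. G e = g \<and> \<phi> (g div 2 + A e) = i \<and> \<phi> (g div 2 + B e) = j" if ij: "i < j" "j < b" for i j
  proof -
    obtain u v x y where q: "quotient_edge E (S d) u v g x y" "\<phi> (g div 2 + x) = i" "\<phi> (g div 2 + y) = j"
      using ed[OF ij] by (auto simp: group_graph_def)
    have sep: "(u, v) \<in> separated E (S d) (g div 2)"
      by (rule quotient_edgeD[OF q(1) zero_in_starts])
    then obtain e where e: "e < m" "u = U e" "v = V e"
      using separated_subset by (fastforce simp: edges_def)
    show ?thesis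
    proof (rule edge_cases[OF e(1)])
      fix d' assume q': "quotient_edge E (S d') (U e) (V e) (G e) (A e) (B e)"
      \<comment> \<open>An edge is separated in one round only, so the entry recorded for it is its
        quotient edge in round d.\<close>
      have "d = d'"
        using sep quotient_edgeD(1)[OF q' zero_in_starts] wf e
        by (intro separated_round_unique[of u v]) (auto simp: well_formed_def)
      then show ?thesis using quotient_edge_unique[OF q(1)] q' q e by blast
    qed (use q d e in blast)
  qed
  obtain e0 where e0: "e0 < m" "G e0 = g" using ed[of 0 1] b by auto
  let ?\<phi> = "\<lambda>w. if w < I g * n then 0 else if w < I g * n + n then \<phi> (g div 2 + (w - I g * n)) else b"
  show ?thesis
  proof (rule clique_minorI[of ?\<phi>])
    show "mono ?\<phi>"
      using \<phi>(2) by (intro monoI) (auto intro!: monoD[OF \<phi>(1)])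
    fix i j assume ij: "i < j" "j < b"
    obtain e where e: "e < m" "G e = g" "\<phi> (g div 2 + A e) = i" "\<phi> (g div 2 + B e) = j"
      using ed[OF ij] by blast
    then have "(U' e, V' e) \<in> E'" by (auto simp: edges_def)
    moreover have "?\<phi> (U' e) = i" "?\<phi> (V' e) = j"
      using e AB[OF e(1)] U'[OF e(1)] V'[OF e(1)] by auto
    ultimately show "\<exists>u v. (u, v) \<in> E' \<and> ?\<phi> u = i \<and> ?\<phi> v = j" by blast
  qed
qed

text \<open>From depth n on all parts are singletons and the quotients are empty. So the hypothesis
  excludes a minor of size b in the quotients of every depth, and the losses of
  \<open>clique_minor_separated\<close> and \<open>clique_minor_tree\<close> compose.\<close>

lemma clique_minor_down:
  assumes no: "\<not> clique_minor E' b"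
  defines "c \<equiv> (4 * (b + 1) + 1) * (b + 1)"
  shows "\<not> clique_minor E ((2 * c + 1) * c + 2)"
proof -
  \<comment> \<open>For smaller b a clique minor exists vacuously.\<close>
  have b: "2 \<le> b"
  proof (rule ccontr)
    assume "\<not> 2 \<le> b"
    then have "clique_minor E' b" by (intro clique_minorI[of id]) (auto simp: mono_def)
    with no show False by contradiction
  qed
  have "\<not> clique_minor (group_graph E (S d) g) b" for d g
  proof (cases "d < n")
    case False
    have "S d = UNIV" using starts_UNIV[OF n, of d E] False by simp
    then have "group_graph E (S d) g = {}"
      using quotient_edgeD(1)[of E "S d" _ _ g] by (fastforce simp: group_graph_def separated_def)
    moreover have "(0::nat) < 1" "1 < b" using b by auto
    ultimately show ?thesis unfolding clique_minor_def by blast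
  qed (use group_graph_down[OF _ b] no in blast)
  then have "\<not> clique_minor (left_quotient E (S d) f) b" "\<not> clique_minor (right_quotient E (S d) f) b" for d f
    using group_graph_even[OF zero_in_starts[of n E d], of E f] group_graph_odd[OF zero_in_starts[of n E d], of E f] by metis+
  then have sep: "\<not> clique_minor (separated E (S d) f) c" for d f
    unfolding c_def using E_le zero_in_starts by (intro clique_minor_separated) auto
  show ?thesis
  proof (rule clique_minor_tree[where S = S])
    show "S n = UNIV" using starts_UNIV n by blast
    show "last_in (S 0) u = last_in (S 0) v" if "(u, v) \<in> E" for u v
      using that wf unfolding starts_0 last_in_multiples by (auto simp: edges_def well_formed_def)
  qed (use zero_in_starts starts_Suc E_le sep in auto)
qed

end

section \<open>Clique minors of presented graphs\<close>

definition positions ::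
  "'a list \<Rightarrow> ('a \<times> 'a) list \<Rightarrow> (nat \<Rightarrow> nat) \<Rightarrow> (nat \<Rightarrow> nat) \<Rightarrow> bool" where
  "positions vs es U V \<longleftrightarrow> (\<forall>e<length es. U e \<le> V e \<and> V e < length vs \<and>
     {vs ! U e, vs ! V e} = {fst (es ! e), snd (es ! e)})"

locale presented_graph =
  fixes V :: "'a set" and E :: "'a set set" and r :: "'a rel" and vs es
    and U W :: "nat \<Rightarrow> nat"
  assumes graph: "ordered_graph V E r" and pres: "presents vs es V E r"
    and pos: "positions vs es U W"
begin

lemma set_vs: "set vs = V" and dist: "distinct vs"
  using pres by (auto simp: presents_def)

lemma index_le_iff:
  assumes "i < length vs" "j < length vs"
  shows "(vs ! i, vs ! j) \<in> r \<longleftrightarrow> i \<le> j"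
proof
  have lin: "refl_on V r" "antisym r"
    using graph by (auto simp: ordered_graph_def linear_order_on_def partial_order_on_def preorder_on_def)
  have lt: "(vs ! a, vs ! b) \<in> r" if "a < b" "b < length vs" for a b
    using pres that by (auto simp: presents_def sorted_wrt_iff_nth_less)
  show "i \<le> j" if "(vs ! i, vs ! j) \<in> r"
  proof (rule ccontr)
    assume "\<not> i \<le> j"
    then have "vs ! i = vs ! j"
      using lt[of j i] assms that lin(2) by (auto dest: antisymD)
    with \<open>\<not> i \<le> j\<close> show False using dist assms by (auto simp: nth_eq_iff_index_eq)
  qed
  show "(vs ! i, vs ! j) \<in> r" if "i \<le> j"
    using that lt[of i j] assms set_vs lin(1) by (cases "i = j") (auto dest: refl_onD)
qed

lemma clique_interval_minor_if_clique_minor: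
  assumes K: "clique_minor (edges (length es) U W) t" and t: "2 \<le> t"
  shows "has_clique_interval_minor V E r t"
proof -
  obtain \<phi> :: "nat \<Rightarrow> nat" where \<phi>: "mono \<phi>"
    and ed: "\<And>i j. i < j \<Longrightarrow> j < t \<Longrightarrow> \<exists>u v. (u, v) \<in> edges (length es) U W \<and> \<phi> u = i \<and> \<phi> v = j"
    using K by (rule clique_minorE) blast
  \<comment> \<open>Labels from t on join the last part, so that the t parts cover all
    vertices.\<close>
  define part where "part k = {vs ! i | i. i < length vs \<and> min (\<phi> i) (t - 1) = k}" for k
  have ed: "\<exists>u\<in>part i. \<exists>v\<in>part j. {u, v} \<in> E" if ij: "i < j" "j < t" for i j
  proof -
    obtain e where e: "e < length es" "\<phi> (U e) = i" "\<phi> (W e) = j"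
      using ed[OF ij] by (auto simp: edges_def)
    have p: "U e < length vs" "W e < length vs" "{vs ! U e, vs ! W e} = {fst (es ! e), snd (es ! e)}"
      using pos e(1) unfolding positions_def by (meson le_less_trans)+
    have "{fst (es ! e), snd (es ! e)} \<in> E"
      using pres e(1) nth_mem[of e es] by (force simp: presents_def)
    with p(3) have "{vs ! U e, vs ! W e} \<in> E" by simp
    moreover have "vs ! U e \<in> part i" "vs ! W e \<in> part j"
      using p(1,2) e ij unfolding part_def by force+
    ultimately show ?thesis by blast
  qed
  have ne: "part k \<noteq> {}" if "k < t" for k
  proof -
    have "k < t - 1 \<or> 0 < k" "t - 1 < t" using that t by linarith+
    then show ?thesis using ed[of k "t - 1"] ed[of 0 k] that by blast
  qed
  have disj: "part i \<inter> part j = {}" if "i \<noteq> j" for i j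
    using that dist by (auto simp: part_def nth_eq_iff_index_eq)
  have inj: "inj_on part {..<t}"
  proof (rule inj_onI)
    fix i j assume "i \<in> {..<t}" "j \<in> {..<t}" "part i = part j"
    then show "i = j" using ne[of i] disj[of i j] by auto
  qed
  have un: "\<Union> (part ` {..<t}) = V"
  proof
    show "V \<subseteq> \<Union> (part ` {..<t})"
    proof
      fix x assume "x \<in> V"
      then obtain i where i: "i < length vs" "x = vs ! i" using set_vs by (auto simp: in_set_conv_nth)
      then have "x \<in> part (min (\<phi> i) (t - 1))" by (auto simp: part_def)
      moreover have "min (\<phi> i) (t - 1) < t" using t by auto
      ultimately show "x \<in> \<Union> (part ` {..<t})" by blast
    qed
  qed (use set_vs in \<open>auto simp: part_def\<close>)
  show ?thesis
    unfolding has_clique_interval_minor_def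
  proof (intro exI[of _ "part ` {..<t}"] conjI ballI impI)
    show "partition_on V (part ` {..<t})"
    proof (rule partition_onI)
      show "{} \<notin> part ` {..<t}" using ne by force
      show "disjnt p q" if pq: "p \<in> part ` {..<t}" "q \<in> part ` {..<t}" "p \<noteq> q" for p q
      proof -
        obtain i j where "p = part i" "q = part j" using pq by blast
        then show ?thesis using pq(3) disj[of i j] by (auto simp: disjnt_def)
      qed
    qed (rule un)
    show "card (part ` {..<t}) = t" using card_image[OF inj] by simp
    show "\<exists>u\<in>I. \<exists>v\<in>J. {u, v} \<in> E" if IJ: "I \<in> part ` {..<t}" "J \<in> part ` {..<t}" "I \<noteq> J" for I J
    proof -
      obtain i j where ij: "I = part i" "J = part j" "i < t" "j < t" "i \<noteq> j" using IJ by auto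
      then consider "i < j" | "j < i" by linarith
      then show ?thesis
      proof cases
        case 1
        then show ?thesis using ed[of i j] ij by blast
      next
        case 2
        then show ?thesis using ed[of j i] ij by (metis insert_commute)
      qed
    qed
    fix I assume "I \<in> part ` {..<t}"
    then obtain k where k: "I = part k" by blast
    show "interval_of V r I"
      unfolding interval_of_def
    proof (intro conjI ballI impI)
      show "I \<subseteq> V" using set_vs by (auto simp: k part_def)
      fix x z y assume xzy: "x \<in> I" "z \<in> I" "y \<in> V" "(x, y) \<in> r \<and> (y, z) \<in> r"
      obtain a where a: "x = vs ! a" "a < length vs" "min (\<phi> a) (t - 1) = k" using xzy(1) by (auto simp: k part_def)
      obtain c where c: "z = vs ! c" "c < length vs" "min (\<phi> c) (t - 1) = k" using xzy(2) by (auto simp: k part_def)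
      obtain b where b: "y = vs ! b" "b < length vs" using xzy(3) set_vs by (auto simp: in_set_conv_nth)
      have "a \<le> b" "b \<le> c" using xzy(4) a b c index_le_iff by auto
      then have "\<phi> a \<le> \<phi> b" "\<phi> b \<le> \<phi> c" by (auto intro: monoD[OF \<phi>])
      then have "min (\<phi> b) (t - 1) = k" using a(3) c(3) by linarith
      then show "y \<in> I" using b by (auto simp: k part_def)
    qed
  qed simp
qed

text \<open>A position is labelled by the number of parts whose last position comes before
  it.\<close>

lemma clique_minor_if_clique_interval_minor:
  assumes "has_clique_interval_minor V E r t"
  shows "clique_minor (edges (length es) U W) t"
proof -
  obtain P where P: "partition_on V P" "finite P" "card P = t"
    and "\<forall>I\<in>P. interval_of V r I"
    and "\<forall>I\<in>P. \<forall>J\<in>P. I \<noteq> J \<longrightarrow> (\<exists>u\<in>I. \<exists>v\<in>J. {u, v} \<in> E)"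
    using assms unfolding has_clique_interval_minor_def by (elim exE conjE)
  then have int: "\<And>I. I \<in> P \<Longrightarrow> interval_of V r I"
    and adj: "\<And>I J. I \<in> P \<Longrightarrow> J \<in> P \<Longrightarrow> I \<noteq> J \<Longrightarrow> \<exists>u\<in>I. \<exists>v\<in>J. {u, v} \<in> E"
    by simp_all
  define idx where "idx I = {i. i < length vs \<and> vs ! i \<in> I}" for I
  define top where "top I = Max (idx I)" for I
  have sub: "I \<subseteq> V" if "I \<in> P" for I using P(1) that by (auto simp: partition_on_def)
  have fin: "finite (idx I)" for I by (auto simp: idx_def)
  have top: "top I \<in> idx I" if I: "I \<in> P" for I
  proof -
    have "I \<noteq> {}" using I P(1) by (auto simp: partition_on_def)
    then obtain x where "x \<in> I" "x \<in> V" using sub[OF I] by blast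
    then have "idx I \<noteq> {}" using set_vs by (auto simp: idx_def in_set_conv_nth)
    then show ?thesis unfolding top_def by (intro Max_in fin)
  qed
  have disj: "I = J" if "I \<in> P" "J \<in> P" "i \<in> idx I" "i \<in> idx J" for I J i
    using P(1) that by (auto simp: partition_on_def disjoint_def idx_def)
  have inj: "inj_on top P"
    by (intro inj_onI) (metis disj top)
  define K where "K = top ` P"
  have K: "finite K" "card K = t" using P inj by (auto simp: K_def card_image)
  define \<phi> where "\<phi> w = card {k \<in> K. k < w}" for w
  have \<phi>: "mono \<phi>"
    unfolding \<phi>_def using K by (intro monoI card_mono) auto
  have less: "\<phi> k < \<phi> k'" if "k \<in> K" "k < k'" for k k'
    unfolding \<phi>_def using that K by (intro psubset_card_mono) auto
  have "inj_on \<phi> K"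
    by (rule inj_onI) (metis less nat_neq_iff)
  moreover have "\<phi> k < t" if "k \<in> K" for k
    unfolding \<phi>_def K(2)[symmetric] using that K by (intro psubset_card_mono) auto
  ultimately have surj: "\<phi> ` K = {..<t}"
    using K by (intro card_subset_eq) (auto simp: card_image)
  have const: "\<phi> w = \<phi> (top I)" if I: "I \<in> P" "w \<in> idx I" for I w
  proof -
    \<comment> \<open>Otherwise the last vertex of another part lies between two vertices of the
      interval I, hence in I, so the two parts coincide.\<close>
    have "k < w" if k: "k \<in> K" "k < top I" for k
    proof (rule ccontr)
      assume "\<not> k < w"
      obtain J where J: "J \<in> P" "k = top J" using k(1) by (auto simp: K_def)
      have kJ: "k < length vs" "vs ! k \<in> J" "w < length vs" "vs ! w \<in> I" "top I < length vs" "vs ! top I \<in> I"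
        using top[OF J(1)] top[OF I(1)] I(2) J(2) by (auto simp: idx_def)
      then have "vs ! k \<in> I"
        using int[OF I(1)] index_le_iff[of w k] index_le_iff[of k "top I"] \<open>\<not> k < w\<close> k(2) set_vs
        unfolding interval_of_def by (metis less_imp_le not_less nth_mem)
      then have "I = J" using disj[OF I(1) J(1), of k] kJ by (auto simp: idx_def)
      with J k(2) show False by simp
    qed
    moreover have "w \<le> top I" unfolding top_def using I(2) fin by (intro Max_ge)
    ultimately have "{k \<in> K. k < w} = {k \<in> K. k < top I}" by auto
    then show ?thesis by (simp add: \<phi>_def)
  qed
  show ?thesis
  proof (rule clique_minorI[OF \<phi>])
    fix i j assume ij: "i < j" "j < t"
    have "i \<in> \<phi> ` K" "j \<in> \<phi> ` K" unfolding surj using ij by auto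
    then obtain I J where IJ: "I \<in> P" "J \<in> P" "i = \<phi> (top I)" "j = \<phi> (top J)"
      by (auto simp: K_def)
    then obtain u v where uv: "u \<in> I" "v \<in> J" "{u, v} \<in> E" using adj[of I J] ij by auto
    have "{u, v} \<in> (\<lambda>(u, v). {u, v}) ` set es" using uv(3) pres by (simp add: presents_def)
    then obtain p where p: "p \<in> set es" "{u, v} = (\<lambda>(u, v). {u, v}) p" by (rule imageE)
    then obtain e where e: "e < length es" "{fst (es ! e), snd (es ! e)} = {u, v}"
      by (auto simp: in_set_conv_nth case_prod_unfold)
    have p: "U e \<le> W e" "U e < length vs" "W e < length vs" "{vs ! U e, vs ! W e} = {u, v}"
      using pos e le_less_trans unfolding positions_def by blast+
    show "\<exists>u v. (u, v) \<in> edges (length es) U W \<and> \<phi> u = i \<and> \<phi> v = j"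
    proof (cases "vs ! U e = u \<and> vs ! W e = v")
      case True
      then have "\<phi> (U e) = i" "\<phi> (W e) = j"
        using const[OF IJ(1), of "U e"] const[OF IJ(2), of "W e"] p uv IJ by (auto simp: idx_def)
      then show ?thesis using e(1) by (auto simp: edges_def)
    next
      case False
      then have "vs ! U e = v" "vs ! W e = u" using p(4) by (auto simp: doubleton_eq_iff)
      then have "\<phi> (U e) = j" "\<phi> (W e) = i"
        using const[OF IJ(2), of "U e"] const[OF IJ(1), of "W e"] p uv IJ by (auto simp: idx_def)
      then show ?thesis using monoD[OF \<phi> p(1)] ij by simp
    qed
  qed
qed

end

lemma has_clique_interval_minor_1: "finite V \<Longrightarrow> V \<noteq> {} \<Longrightarrow> has_clique_interval_minor V E r 1"
  unfolding has_clique_interval_minor_def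
  by (intro exI[of _ "{V}"]) (auto simp: partition_on_def interval_of_def)

section \<open>Reasoning about RAM programs\<close>

text \<open>Total correctness with a time bound. As an overflow has no transition, it also certifies
  that all results fit into a word.\<close>

definition runs :: "nat \<Rightarrow> ram_prog \<Rightarrow> nat \<Rightarrow> (ram_state \<Rightarrow> bool) \<Rightarrow> ram_state \<Rightarrow> bool" where
  "runs W c T Q s \<longleftrightarrow> (\<exists>k s'. exec W c s k s' \<and> k \<le> T \<and> Q s')"

lemma runsI: "exec W c s k s' \<Longrightarrow> k \<le> T \<Longrightarrow> Q s' \<Longrightarrow> runs W c T Q s"
  unfolding runs_def by blast

lemma runs_weaken:
  "runs W c T Q s \<Longrightarrow> T \<le> T' \<Longrightarrow> (\<And>s'. Q s' \<Longrightarrow> Q' s') \<Longrightarrow> runs W c T' Q' s"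
  unfolding runs_def by (meson order_trans)

lemma runs_Seq:
  assumes "runs W c T R s" "\<And>s'. R s' \<Longrightarrow> runs W d T' Q s'"
  shows "runs W (Seq c d) (T + T') Q s"
  using assms unfolding runs_def by (meson exec.Seq add_mono)

lemma runs_IfLess:
  assumes "reg s x < reg s y \<Longrightarrow> runs W c T Q s" "\<not> reg s x < reg s y \<Longrightarrow> runs W d T Q s"
  shows "runs W (IfLess x y c d) (Suc T) Q s"
proof (cases "reg s x < reg s y")
  case True
  then show ?thesis using assms(1) exec.IfTrue unfolding runs_def by (meson Suc_le_mono)
next
  case False
  then show ?thesis using assms(2) exec.IfFalse unfolding runs_def by (meson Suc_le_mono)
qed

text \<open>Weakest preconditions and time bounds for code without loops (on which
  \<open>wp\<close> is \<^const>\<open>False\<close>).\<close>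

primrec wp :: "nat \<Rightarrow> ram_prog \<Rightarrow> (ram_state \<Rightarrow> bool) \<Rightarrow> ram_state \<Rightarrow> bool" where
  "wp W Skip Q s = Q s"
| "wp W (Const x a) Q s = (a \<le> W \<and> Q (s\<lparr>reg := (reg s)(x := a)\<rparr>))"
| "wp W (Copy x y) Q s = Q (s\<lparr>reg := (reg s)(x := reg s y)\<rparr>)"
| "wp W (Op f x y z) Q s = (apply_op f (reg s y) (reg s z) \<le> W \<and>
     Q (s\<lparr>reg := (reg s)(x := apply_op f (reg s y) (reg s z))\<rparr>))"
| "wp W (Load x A y) Q s = Q (s\<lparr>reg := (reg s)(x := arr s A (reg s y))\<rparr>)"
| "wp W (Store A y z) Q s = Q (s\<lparr>arr := (arr s)(A := (arr s A)(reg s y := reg s z))\<rparr>)"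
| "wp W (Seq c d) Q s = wp W c (wp W d Q) s"
| "wp W (IfLess x y c d) Q s = (if reg s x < reg s y then wp W c Q s else wp W d Q s)"
| "wp W (WhileLess x y c) Q s = False"

primrec cost :: "ram_prog \<Rightarrow> nat" where
  "cost Skip = 1"
| "cost (Const x a) = 1"
| "cost (Copy x y) = 1"
| "cost (Op f x y z) = 1"
| "cost (Load x A y) = 1"
| "cost (Store A y z) = 1"
| "cost (Seq c d) = cost c + cost d"
| "cost (IfLess x y c d) = Suc (max (cost c) (cost d))"
| "cost (WhileLess x y c) = 0"

lemma runs_wp: "wp W c Q s \<Longrightarrow> runs W c (cost c) Q s"
proof (induction c arbitrary: Q s)
  case (Seq c d)
  have "runs W c (cost c) (wp W d Q) s" using Seq.prems by (intro Seq.IH) simp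
  then have "runs W (Seq c d) (cost c + cost d) Q s" by (rule runs_Seq) (rule Seq.IH)
  then show ?case by simp
next
  case (IfLess x y c d)
  have "runs W (IfLess x y c d) (Suc (max (cost c) (cost d))) Q s"
  proof (rule runs_IfLess)
    assume "reg s x < reg s y"
    then show "runs W c (max (cost c) (cost d)) Q s"
      using IfLess.prems by (intro runs_weaken[OF IfLess.IH(1)[of Q s]]) auto
  next
    assume "\<not> reg s x < reg s y"
    then show "runs W d (max (cost c) (cost d)) Q s"
      using IfLess.prems by (intro runs_weaken[OF IfLess.IH(2)[of Q s]]) auto
  qed
  then show ?case by simp
next
  case Skip then show ?case by (auto intro!: runsI[OF exec.Skip])
next
  case (Const x a) then show ?case by (auto intro!: runsI[OF exec.Const])
next
  case (Copy x y) then show ?case by (auto intro!: runsI[OF exec.Copy])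
next
  case (Op f x y z) then show ?case by (auto intro!: runsI[OF exec.Op])
next
  case (Load x A y) then show ?case by (auto intro!: runsI[OF exec.Load])
next
  case (Store A y z) then show ?case by (auto intro!: runsI[OF exec.Store])
qed simp

primrec wregs :: "ram_prog \<Rightarrow> nat set" where
  "wregs Skip = {}"
| "wregs (Const x a) = {x}"
| "wregs (Copy x y) = {x}"
| "wregs (Op f x y z) = {x}"
| "wregs (Load x A y) = {x}"
| "wregs (Store A y z) = {}"
| "wregs (Seq c d) = wregs c \<union> wregs d"
| "wregs (IfLess x y c d) = wregs c \<union> wregs d"
| "wregs (WhileLess x y c) = wregs c"

primrec warrs :: "ram_prog \<Rightarrow> nat set" where
  "warrs Skip = {}"
| "warrs (Const x a) = {}"
| "warrs (Copy x y) = {}"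
| "warrs (Op f x y z) = {}"
| "warrs (Load x A y) = {}"
| "warrs (Store A y z) = {A}"
| "warrs (Seq c d) = warrs c \<union> warrs d"
| "warrs (IfLess x y c d) = warrs c \<union> warrs d"
| "warrs (WhileLess x y c) = warrs c"

text \<open>What may change is read off the syntax, so loop invariants need to mention only cells
  that are written.\<close>

definition frame :: "ram_prog \<Rightarrow> ram_state \<Rightarrow> ram_state \<Rightarrow> bool" where
  "frame c s s' \<longleftrightarrow>
     (\<forall>x. x \<notin> wregs c \<longrightarrow> reg s' x = reg s x) \<and> (\<forall>A. A \<notin> warrs c \<longrightarrow> arr s' A = arr s A)"

lemma exec_frame: "exec W c s k s' \<Longrightarrow> frame c s s'"
  by (induction rule: exec.induct) (auto simp: frame_def)

lemma runs_frame: "runs W c T Q s \<Longrightarrow> runs W c T (\<lambda>s'. Q s' \<and> frame c s s') s"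
  unfolding runs_def using exec_frame by blast

text \<open>Register 3 holds the constant 1.\<close>

definition For :: "nat \<Rightarrow> nat \<Rightarrow> ram_prog \<Rightarrow> ram_prog" where
  "For x y c = Seq (Const x 0) (WhileLess x y (Seq c (Op Add x x 3)))"

lemma wregs_For [simp]: "wregs (For x y c) = insert x (wregs c)"
  and warrs_For [simp]: "warrs (For x y c) = warrs c"
  by (auto simp: For_def)

text \<open>Each iteration adds two steps, the increment and the test; the final 2 pays for the
  initialisation and the last test. The counter cannot overflow since N fits into a word.\<close>

lemma runs_For:
  assumes lim: "reg s y = N" "N \<le> W" and one: "reg s 3 = 1"
    and fresh: "{x, y, 3} \<inter> wregs c = {}" "x \<noteq> y" "x \<noteq> 3"
    and init: "\<And>s'. reg s' = (reg s)(x := 0) \<Longrightarrow> arr s' = arr s \<Longrightarrow> I 0 s'"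
    and step: "\<And>i s'. i < N \<Longrightarrow> I i s' \<Longrightarrow> reg s' x = i \<Longrightarrow> frame (For x y c) s s' \<Longrightarrow>
      runs W c T (\<lambda>s''. \<forall>s'''. reg s''' = (reg s'')(x := Suc i) \<longrightarrow> arr s''' = arr s'' \<longrightarrow> I (Suc i) s''') s'"
  shows "runs W (For x y c) (N * (T + 2) + 2) (\<lambda>s'. I N s' \<and> frame (For x y c) s s') s"
proof -
  let ?F = "frame (For x y c) s" and ?body = "Seq c (Op Add x x 3)"
  have loop: "runs W (WhileLess x y ?body) ((N - i) * (T + 2) + 1) (I N) s'"
    if "i \<le> N" "I i s'" "reg s' x = i" "?F s'" for i s'
    using that
  proof (induction "N - i" arbitrary: i s')
    case 0
    then have "exec W (WhileLess x y ?body) s' 1 s'"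
      using lim fresh by (intro exec.WhileFalse) (auto simp: frame_def)
    with 0 show ?case by (auto simp: runs_def)
  next
    case (Suc l)
    have i: "i < N" using Suc.hyps(2) by simp
    obtain k s2 where k: "exec W c s' k s2" "k \<le> T"
      and s2: "\<And>s'''. reg s''' = (reg s2)(x := Suc i) \<Longrightarrow> arr s''' = arr s2 \<Longrightarrow> I (Suc i) s'''"
      using step[OF i Suc.prems(2-4)] unfolding runs_def by blast
    have fr: "frame c s' s2" by (rule exec_frame[OF k(1)])
    then have r2: "reg s2 x = i" "reg s2 3 = 1" "reg s' y = N"
      using Suc.prems fresh one lim by (auto simp: frame_def)
    let ?s3 = "s2\<lparr>reg := (reg s2)(x := Suc i)\<rparr>"
    have body: "exec W ?body s' (k + 1) ?s3"
      using r2 i lim by (intro exec.Seq[OF k(1)] exec.Op) auto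
    have "?F ?s3" using Suc.prems(4) fr by (auto simp: frame_def)
    then have "runs W (WhileLess x y ?body) ((N - Suc i) * (T + 2) + 1) (I N) ?s3"
      using Suc.hyps i by (intro Suc.hyps(1) s2) auto
    then obtain k' s4 where s4: "exec W (WhileLess x y ?body) ?s3 k' s4"
      "k' \<le> (N - Suc i) * (T + 2) + 1" "I N s4" unfolding runs_def by blast
    have "exec W (WhileLess x y ?body) s' (Suc ((k + 1) + k')) s4"
      using Suc.prems(3) i r2(3) by (intro exec.WhileTrue[OF _ body s4(1)]) simp
    moreover have "Suc ((k + 1) + k') \<le> (N - i) * (T + 2) + 1"
    proof -
      have "N - i = Suc (N - Suc i)" using i by simp
      then show ?thesis using k(2) s4(2) by simp
    qed
    ultimately show ?case using s4(3) unfolding runs_def by blast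
  qed
  let ?s0 = "s\<lparr>reg := (reg s)(x := 0)\<rparr>"
  have "runs W (Const x 0) 1 (\<lambda>s'. s' = ?s0) s"
    by (auto intro!: runsI[OF exec.Const])
  moreover have "runs W (WhileLess x y ?body) (N * (T + 2) + 1) (I N) ?s0"
    using loop[of 0 ?s0] init[of ?s0] by (auto simp: frame_def)
  ultimately have "runs W (For x y c) (1 + (N * (T + 2) + 1)) (I N) s"
    unfolding For_def using runs_Seq[of W "Const x 0" 1 "\<lambda>s'. s' = ?s0" s] by blast
  then show ?thesis by (rule runs_weaken[OF runs_frame]) auto
qed

section \<open>The program\<close>

text \<open>Arrays 1 and 2 hold the current edges and array 4 the current partition. Arrays 5 and 6 flag the
  vertices seen from the left and from the right; arrays 7, 8 and 9 hold the left blocks, the right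
  blocks and the refined partition. Arrays 10, 11 and 12 collect the quotient edges with the numbers
  of their quotients.\<close>

abbreviation Then :: "ram_prog \<Rightarrow> ram_prog \<Rightarrow> ram_prog" (infixr ";;" 60) where
  "c ;; d \<equiv> Seq c d"

text \<open>The bound on W leaves room for the quotient numbers, which are at most
  \<open>2 * f + 1\<close> with f below \<open>m * n\<close>.\<close>

definition env :: "nat \<Rightarrow> nat \<Rightarrow> nat \<Rightarrow> ram_state \<Rightarrow> bool" where
  "env W n m s \<longleftrightarrow> reg s 0 = n \<and> reg s 1 = m \<and> reg s 3 = 1 \<and> reg s 4 = m * n \<and> reg s 5 = 0 \<and>
     0 < n \<and> 0 < m \<and> 2 * (m * n) + 2 \<le> W"

lemma envD:
  assumes "env W n m s"
  shows "m \<le> m * n" "n \<le> m * n" "1 \<le> m * n" "m \<le> W" "n \<le> W" "m * n \<le> W" "1 \<le> W"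
proof -
  have "0 < n" "0 < m" and W: "2 * (m * n) + 2 \<le> W" using assms by (auto simp: env_def)
  then show *: "m \<le> m * n" "n \<le> m * n" "1 \<le> m * n" by auto
  show "m \<le> W" "n \<le> W" "m * n \<le> W" "1 \<le> W" using * W by linarith+
qed

lemma env_frame: "frame c s s' \<Longrightarrow> {0, 1, 3, 4, 5} \<inter> wregs c = {} \<Longrightarrow> env W n m s \<Longrightarrow> env W n m s'"
  by (auto simp: env_def frame_def)

section \<open>One round of refinement\<close>

definition clear_flags :: ram_prog where
  "clear_flags = For 6 4 (Store 5 6 5 ;; Store 6 6 5)"

lemma runs_clear_flags:
  assumes env: "env W n m s"
  shows "runs W clear_flags (4 * (m * n) + 2)
    (\<lambda>s'. (\<forall>w<m * n. arr s' 5 w = 0 \<and> arr s' 6 w = 0) \<and> frame clear_flags s s') s"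
  unfolding clear_flags_def
proof (rule runs_weaken[OF runs_For[where N = "m * n" and T = 2 and
      I = "\<lambda>i s'. \<forall>w<i. arr s' 5 w = 0 \<and> arr s' 6 w = 0"]])
  fix i s' assume "\<forall>w<i. arr s' 5 w = 0 \<and> arr s' 6 w = 0" "reg s' 6 = i"
    "frame (For 6 4 (Store 5 6 5 ;; Store 6 6 5)) s s'"
  then show "runs W (Store 5 6 5 ;; Store 6 6 5) 2
      (\<lambda>s''. \<forall>s'''. reg s''' = (reg s'')(6 := Suc i) \<longrightarrow> arr s''' = arr s'' \<longrightarrow>
         (\<forall>w<Suc i. arr s''' 5 w = 0 \<and> arr s''' 6 w = 0)) s'"
    using env by (intro runs_weaken[OF runs_wp]) (auto simp: frame_def env_def less_Suc_eq)
qed (use env envD[OF env] in \<open>auto simp: env_def\<close>)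

definition mark_seen :: ram_prog where
  "mark_seen = For 6 1 (Load 9 1 6 ;; Load 10 2 6 ;; Load 11 4 9 ;; Load 12 4 10 ;;
     IfLess 11 12 (Store 6 9 3 ;; Store 5 10 3) Skip)"

lemma runs_mark_seen:
  assumes env: "env W n m s" and flags: "\<forall>w<m * n. arr s 5 w = 0 \<and> arr s 6 w = 0"
  shows "runs W mark_seen (9 * m + 2)
    (\<lambda>s'. (\<forall>w<m * n.
        (0 < arr s' 5 w \<longleftrightarrow> (\<exists>e<m. arr s 2 e = w \<and> arr s 4 (arr s 1 e) < arr s 4 (arr s 2 e))) \<and>
        (0 < arr s' 6 w \<longleftrightarrow> (\<exists>e<m. arr s 1 e = w \<and> arr s 4 (arr s 1 e) < arr s 4 (arr s 2 e)))) \<and>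
      frame mark_seen s s') s"
  unfolding mark_seen_def
proof (rule runs_weaken[OF runs_For[where N = m and T = 7 and
      I = "\<lambda>i s'. \<forall>w<m * n.
        (0 < arr s' 5 w \<longleftrightarrow> (\<exists>e<i. arr s 2 e = w \<and> arr s 4 (arr s 1 e) < arr s 4 (arr s 2 e))) \<and>
        (0 < arr s' 6 w \<longleftrightarrow> (\<exists>e<i. arr s 1 e = w \<and> arr s 4 (arr s 1 e) < arr s 4 (arr s 2 e)))"]])
  fix i s'
  let ?body = "Load 9 1 6 ;; Load 10 2 6 ;; Load 11 4 9 ;; Load 12 4 10 ;;
     IfLess 11 12 (Store 6 9 3 ;; Store 5 10 3) Skip"
  assume I: "\<forall>w<m * n.
        (0 < arr s' 5 w \<longleftrightarrow> (\<exists>e<i. arr s 2 e = w \<and> arr s 4 (arr s 1 e) < arr s 4 (arr s 2 e))) \<and>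
        (0 < arr s' 6 w \<longleftrightarrow> (\<exists>e<i. arr s 1 e = w \<and> arr s 4 (arr s 1 e) < arr s 4 (arr s 2 e)))"
    and i: "reg s' 6 = i" and fr: "frame (For 6 1 ?body) s s'"
  have "arr s' 1 = arr s 1" "arr s' 2 = arr s 2" "arr s' 4 = arr s 4" "reg s' 3 = 1"
    using fr env by (auto simp: frame_def env_def)
  with I i show "runs W ?body 7 (\<lambda>s''. \<forall>s'''. reg s''' = (reg s'')(6 := Suc i) \<longrightarrow> arr s''' = arr s'' \<longrightarrow>
      (\<forall>w<m * n.
        (0 < arr s''' 5 w \<longleftrightarrow> (\<exists>e<Suc i. arr s 2 e = w \<and> arr s 4 (arr s 1 e) < arr s 4 (arr s 2 e))) \<and>
        (0 < arr s''' 6 w \<longleftrightarrow> (\<exists>e<Suc i. arr s 1 e = w \<and> arr s 4 (arr s 1 e) < arr s 4 (arr s 2 e))))) s'"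
    by (intro runs_weaken[OF runs_wp]) (auto simp: less_Suc_eq)
qed (use env envD[OF env] flags in \<open>auto simp: env_def\<close>)

text \<open>A single pass from left to right suffices: registers 13, 14 and 15 carry the current
  starts of the left block, the right block and the refined part. Register 16 remembers whether the
  previous vertex was singled, which accounts for the successors in \<open>refine\<close>.\<close>

definition sweep_body :: ram_prog where
  "sweep_body =
     Load 9 4 6 ;; Load 10 5 6 ;; Load 11 6 6 ;;
     IfLess 9 6 Skip (Copy 13 6 ;; Copy 14 6 ;; Copy 15 6) ;;
     IfLess 5 10 (Copy 13 6) Skip ;;
     IfLess 5 11 (Copy 14 6) Skip ;;
     IfLess 5 16 (Copy 15 6) Skip ;;
     Const 16 0 ;;
     IfLess 13 6 Skip (Const 16 1 ;; Copy 15 6) ;;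
     IfLess 14 6 Skip (Const 16 1 ;; Copy 15 6) ;;
     Store 7 6 13 ;; Store 8 6 14 ;; Store 9 6 15"

definition sweep :: ram_prog where
  "sweep = For 6 4 sweep_body"

lemma last_in_step: "0 \<in> A \<Longrightarrow> last_in A w = (if w \<in> A then w else last_in A (w - 1))"
  by (cases w) (auto simp: last_in_Suc)

lemma runs_sweep:
  fixes S A B :: "nat set"
  assumes env: "env W n m s" and zero: "0 \<in> S"
    and cls: "\<forall>w<m * n. arr s 4 w = last_in S w"
    and flags: "\<forall>w<m * n. (0 < arr s 5 w \<longleftrightarrow> w \<in> A) \<and> (0 < arr s 6 w \<longleftrightarrow> w \<in> B)"
  defines "X \<equiv> S \<union> A \<union> B"
  shows "runs W sweep (25 * (m * n) + 2)
    (\<lambda>s'. (\<forall>w<m * n. arr s' 7 w = last_in (S \<union> A) w \<and> arr s' 8 w = last_in (S \<union> B) w \<and>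
        arr s' 9 w = last_in (X \<union> Suc ` X) w) \<and> frame sweep s s') s"
  unfolding sweep_def
\<comment> \<open>Nothing is assumed about the carried registers before vertex 0, where they may
  hold values of an earlier round. Vertex 0 is a start, so the first iteration resets them.\<close>
proof (rule runs_weaken[OF runs_For[where N = "m * n" and T = 23 and
      I = "\<lambda>i s'. (\<forall>w<i. arr s' 7 w = last_in (S \<union> A) w \<and> arr s' 8 w = last_in (S \<union> B) w \<and>
        arr s' 9 w = last_in (X \<union> Suc ` X) w) \<and>
        (0 < i \<longrightarrow> reg s' 13 = last_in (S \<union> A) (i - 1) \<and> reg s' 14 = last_in (S \<union> B) (i - 1) \<and>
          reg s' 15 = last_in (X \<union> Suc ` X) (i - 1) \<and> (0 < reg s' 16 \<longleftrightarrow> i - 1 \<in> X))"]])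
  fix i s'
  assume i: "i < m * n" "reg s' 6 = i" and fr: "frame (For 6 4 sweep_body) s s'"
    and I: "(\<forall>w<i. arr s' 7 w = last_in (S \<union> A) w \<and> arr s' 8 w = last_in (S \<union> B) w \<and>
        arr s' 9 w = last_in (X \<union> Suc ` X) w) \<and>
        (0 < i \<longrightarrow> reg s' 13 = last_in (S \<union> A) (i - 1) \<and> reg s' 14 = last_in (S \<union> B) (i - 1) \<and>
          reg s' 15 = last_in (X \<union> Suc ` X) (i - 1) \<and> (0 < reg s' 16 \<longleftrightarrow> i - 1 \<in> X))"
  have z: "0 \<in> S \<union> A" "0 \<in> S \<union> B" "0 \<in> X \<union> Suc ` X" using zero by (auto simp: X_def)
  have same: "arr s' 4 = arr s 4" "arr s' 5 = arr s 5" "arr s' 6 = arr s 6" "reg s' 5 = 0"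
    using fr env by (auto simp: frame_def env_def sweep_body_def)
  have c: "arr s 4 i < i \<longleftrightarrow> i \<notin> S"
    using cls i(1) last_in_mem[OF zero, of i] last_in_le[OF zero, of i] by (auto simp: le_less)
  have i0: "i \<notin> S \<Longrightarrow> 0 < i" using zero by (cases i) auto
  have l: "last_in (S \<union> A) i = (if i \<in> S \<or> i \<in> A then i else reg s' 13)"
    "last_in (S \<union> B) i = (if i \<in> S \<or> i \<in> B then i else reg s' 14)"
    using last_in_step[OF z(1), of i] last_in_step[OF z(2), of i] I i0 by auto
  have lt: "reg s' 13 < i" "reg s' 14 < i" if "i \<notin> S"
    using I i0[OF that] last_in_le[OF z(1), of "i - 1"] last_in_le[OF z(2), of "i - 1"] by auto
  have X: "i \<in> X \<union> Suc ` X \<longleftrightarrow> i \<in> X \<or> 0 < i \<and> i - 1 \<in> X"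
    by (cases i) (auto simp: image_iff)
  have r: "last_in (X \<union> Suc ` X) i = (if i \<in> X \<or> 0 < reg s' 16 then i else reg s' 15)"
    if "i \<notin> S"
    using last_in_step[OF z(3), of i] I i0[OF that] X by auto
  have r': "last_in (X \<union> Suc ` X) i = i" if "i \<in> X"
    using that by auto
  have fl: "0 < arr s 5 i \<longleftrightarrow> i \<in> A" "0 < arr s 6 i \<longleftrightarrow> i \<in> B"
    using flags i(1) by auto
  have W: "1 \<le> W" using envD[OF env] by simp
  have iX: "i \<in> X \<longleftrightarrow> i \<in> S \<or> i \<in> A \<or> i \<in> B" by (auto simp: X_def)
  show "runs W sweep_body 23 (\<lambda>s''. \<forall>s'''. reg s''' = (reg s'')(6 := Suc i) \<longrightarrow> arr s''' = arr s'' \<longrightarrow>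
      (\<forall>w<Suc i. arr s''' 7 w = last_in (S \<union> A) w \<and> arr s''' 8 w = last_in (S \<union> B) w \<and>
        arr s''' 9 w = last_in (X \<union> Suc ` X) w) \<and>
        (0 < Suc i \<longrightarrow> reg s''' 13 = last_in (S \<union> A) (Suc i - 1) \<and> reg s''' 14 = last_in (S \<union> B) (Suc i - 1) \<and>
          reg s''' 15 = last_in (X \<union> Suc ` X) (Suc i - 1) \<and> (0 < reg s''' 16 \<longleftrightarrow> Suc i - 1 \<in> X))) s'"
  proof (rule runs_weaken[OF runs_wp])
    show "cost sweep_body \<le> 23" by (simp add: sweep_body_def)
    have I': "\<forall>w<i. arr s' 7 w = last_in (S \<union> A) w \<and> arr s' 8 w = last_in (S \<union> B) w \<and>
        arr s' 9 w = last_in (X \<union> Suc ` X) w" using I by blast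
    show "wp W sweep_body (\<lambda>s''. \<forall>s'''. reg s''' = (reg s'')(6 := Suc i) \<longrightarrow> arr s''' = arr s'' \<longrightarrow>
      (\<forall>w<Suc i. arr s''' 7 w = last_in (S \<union> A) w \<and> arr s''' 8 w = last_in (S \<union> B) w \<and>
        arr s''' 9 w = last_in (X \<union> Suc ` X) w) \<and>
        (0 < Suc i \<longrightarrow> reg s''' 13 = last_in (S \<union> A) (Suc i - 1) \<and> reg s''' 14 = last_in (S \<union> B) (Suc i - 1) \<and>
          reg s''' 15 = last_in (X \<union> Suc ` X) (Suc i - 1) \<and> (0 < reg s''' 16 \<longleftrightarrow> Suc i - 1 \<in> X))) s'"
      unfolding sweep_body_def
      using I' W i same
      by (cases "i \<in> S"; cases "i \<in> A"; cases "i \<in> B"; cases "0 < reg s' 16")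
        (simp_all add: c fl l r r' iX lt less_Suc_eq all_conj_distrib imp_conjR)
  qed
qed (use env envD[OF env] in \<open>auto simp: env_def sweep_body_def\<close>)

definition collect_left :: ram_prog where
  "collect_left = Op Sub 13 13 11 ;; Op Sub 14 14 11 ;; Op Add 15 11 11 ;;
     Store 10 6 13 ;; Store 11 6 14 ;; Store 12 6 15"

definition collect_right :: ram_prog where
  "collect_right = IfLess 11 16 (IfLess 16 17
     (Op Sub 16 16 11 ;; Op Sub 17 17 11 ;; Op Add 15 11 11 ;; Op Add 15 15 3 ;;
      Store 10 6 16 ;; Store 11 6 17 ;; Store 12 6 15) Skip) Skip"

definition collect_body :: ram_prog where
  "collect_body = Load 9 1 6 ;; Load 10 2 6 ;; Load 11 4 9 ;; Load 12 4 10 ;;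
     IfLess 11 12 Skip (
       Load 13 9 9 ;; Load 14 9 10 ;;
       IfLess 13 14 (
         Load 13 7 9 ;; Load 14 7 10 ;; Load 16 8 9 ;; Load 17 8 10 ;;
         IfLess 11 13 (IfLess 13 14 collect_left collect_right) collect_right)
       Skip)"

lemmas collect_defs = collect_left_def collect_right_def collect_body_def

definition collect :: ram_prog where
  "collect = For 6 1 collect_body"

text \<open>The machine tests only strict inequality. The block maps are monotone and the blocks
  refine the parts, so distinct values here are ordered in a known direction.\<close>

lemma quotient_edge_iff:
  assumes "(u, v) \<in> E" "u \<le> v" "0 \<in> S"
  shows "quotient_edge E S u v g a b \<longleftrightarrow>
    \<not> last_in S u < last_in S v \<and> last_in (refine E S) u < last_in (refine E S) v \<and>
    (if last_in S u < left_block E S u \<and> left_block E S u < left_block E S v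
     then g = 2 * last_in S u \<and> a = left_block E S u - last_in S u \<and> b = left_block E S v - last_in S u
     else last_in S u < right_block E S u \<and> right_block E S u < right_block E S v \<and>
       g = 2 * last_in S u + 1 \<and> a = right_block E S u - last_in S u \<and> b = right_block E S v - last_in S u)"
proof -
  have z: "0 \<in> refine E S" "0 \<in> S \<union> left_seen E S" "0 \<in> S \<union> right_seen E S"
    using assms(3) by (auto intro: subsetD[OF subset_refine])
  have le: "last_in S u \<le> last_in S v" "last_in (refine E S) u \<le> last_in (refine E S) v"
    "left_block E S u \<le> left_block E S v" "right_block E S u \<le> right_block E S v"
    using assms(2) mono_last_in[OF assms(3)] mono_last_in[OF z(1)] mono_last_in[OF z(2)] mono_last_in[OF z(3)]
    unfolding left_block_def right_block_def by (auto intro: monoD)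
  have ge: "last_in S u \<le> left_block E S u" "last_in S u \<le> right_block E S u"
    using last_in_Un_ge[OF assms(3), of u] by (auto simp: left_block_def right_block_def)
  have neq: "left_block E S u \<noteq> last_in S u \<longleftrightarrow> last_in S u < left_block E S u"
    "right_block E S u \<noteq> last_in S u \<longleftrightarrow> last_in S u < right_block E S u"
    "left_block E S u \<noteq> left_block E S v \<longleftrightarrow> left_block E S u < left_block E S v"
    "right_block E S u \<noteq> right_block E S v \<longleftrightarrow> right_block E S u < right_block E S v"
    using le ge by linarith+
  have sep: "(u, v) \<in> separated E S f \<longleftrightarrow> f = last_in S u \<and> \<not> last_in S u < last_in S v \<and>
      last_in (refine E S) u < last_in (refine E S) v" for f
    using assms(1) le by (auto simp: separated_def)
  show ?thesis
    unfolding quotient_edge_def sep neq[symmetric] by blast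
qed

definition put :: "nat \<Rightarrow> nat \<Rightarrow> nat \<Rightarrow> nat \<Rightarrow> ram_state \<Rightarrow> ram_state \<Rightarrow> bool" where
  "put i g a b s s' \<longleftrightarrow> arr s' =
     (arr s)(10 := (arr s 10)(i := a), 11 := (arr s 11)(i := b), 12 := (arr s 12)(i := g))"

lemma wp_collect_left:
  assumes "reg s 6 = i" "reg s 11 = f" "reg s 13 = a" "reg s 14 = b"
    and "f + f + 1 \<le> W" "a \<le> W" "b \<le> W"
  shows "wp W collect_left (put i (2 * f) (a - f) (b - f) s) s"
proof -
  have "a - f \<le> W" "b - f \<le> W" using assms by linarith+
  then show ?thesis unfolding collect_left_def using assms by (simp add: put_def mult_2 fun_upd_twist)
qed

lemma wp_collect_right:
  assumes "reg s 6 = i" "reg s 11 = f" "reg s 16 = a" "reg s 17 = b" "reg s 3 = 1"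
    and "f + f + 1 \<le> W" "a \<le> W" "b \<le> W"
  shows "wp W collect_right
    (\<lambda>s'. if f < a \<and> a < b then put i (2 * f + 1) (a - f) (b - f) s s' else arr s' = arr s) s"
proof -
  have "a - f \<le> W" "b - f \<le> W" using assms by linarith+
  then show ?thesis unfolding collect_right_def using assms by (simp add: put_def mult_2 fun_upd_twist)
qed

lemma wp_mono: "wp W c Q s \<Longrightarrow> (\<And>s'. Q s' \<Longrightarrow> Q' s') \<Longrightarrow> wp W c Q' s"
proof (induction c arbitrary: Q Q' s)
  case (Seq c d)
  have "wp W c (wp W d Q') s"
    by (rule Seq.IH(1)[of "wp W d Q"]) (use Seq.prems Seq.IH(2) in auto)
  then show ?case by simp
next
  case (IfLess x y c d)
  show ?case
    using IfLess.prems(1) IfLess.IH(1)[OF _ IfLess.prems(2)] IfLess.IH(2)[OF _ IfLess.prems(2)]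
    by (cases "reg s x < reg s y") simp_all
qed simp_all

lemma wp_collect_body:
  assumes "reg s 6 = i" "reg s 3 = 1" "arr s 1 i = u" "arr s 2 i = v"
    and "arr s 4 u = f" "arr s 4 v = f'" "arr s 9 u = c" "arr s 9 v = c'"
    and "arr s 7 u = a" "arr s 7 v = a'" "arr s 8 u = b" "arr s 8 v = b'"
    and W: "f + f + 1 \<le> W" "a \<le> W" "a' \<le> W" "b \<le> W" "b' \<le> W"
  shows "wp W collect_body (\<lambda>s'.
    if \<not> f < f' \<and> c < c' \<and> f < a \<and> a < a' then put i (2 * f) (a - f) (a' - f) s s'
    else if \<not> f < f' \<and> c < c' \<and> f < b \<and> b < b' then put i (2 * f + 1) (b - f) (b' - f) s s'
    else arr s' = arr s) s"
proof -
  let ?s = "s\<lparr>reg := (reg s)(9 := u, 10 := v, 11 := f, 12 := f', 13 := a, 14 := a', 16 := b, 17 := b')\<rparr>"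
  let ?Q = "\<lambda>s'. if \<not> f < f' \<and> c < c' \<and> f < a \<and> a < a' then put i (2 * f) (a - f) (a' - f) s s'
    else if \<not> f < f' \<and> c < c' \<and> f < b \<and> b < b' then put i (2 * f + 1) (b - f) (b' - f) s s'
    else arr s' = arr s"
  have put: "put i g x y ?s s' \<longleftrightarrow> put i g x y s s'" for g x y s' by (simp add: put_def)
  have left: "wp W collect_left ?Q ?s" if "\<not> f < f'" "c < c'" "f < a" "a < a'"
    by (rule wp_mono[OF wp_collect_left[where i = i and f = f and a = a and b = a']])
      (use assms that in \<open>simp_all add: put\<close>)
  have right: "wp W collect_right ?Q ?s" if "\<not> f < f'" "c < c'" "\<not> (f < a \<and> a < a')"
    by (rule wp_mono[OF wp_collect_right[where i = i and f = f and a = b and b = b']])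
      (use assms that in \<open>auto simp: put split: if_splits\<close>)
  show ?thesis
  proof (cases "\<not> f < f' \<and> c < c'")
    case True
    from True show ?thesis
      unfolding collect_body_def using assms(1-12) left right
      by (cases "f < a"; cases "a < a'") (simp_all add: fun_upd_twist)
  next
    case False
    then show ?thesis
      unfolding collect_body_def using assms(1-12) by auto
  qed
qed

text \<open>An entry is overwritten only if this round yields a quotient edge for it; otherwise it
  keeps what an earlier round recorded.\<close>

lemma runs_collect:
  fixes S :: "nat set"
  assumes env: "env W n m s" and zero: "0 \<in> S"
    and wf: "well_formed n m (arr s 1) (arr s 2)"
    and E: "E = edges m (arr s 1) (arr s 2)"
    and vals: "\<forall>w<m * n. arr s 4 w = last_in S w \<and> arr s 7 w = left_block E S w \<and>
      arr s 8 w = right_block E S w \<and> arr s 9 w = last_in (refine E S) w"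
  shows "runs W collect (25 * m + 2)
    (\<lambda>s'. (\<forall>e<m. quotient_edge E S (arr s 1 e) (arr s 2 e) (arr s' 12 e) (arr s' 10 e) (arr s' 11 e) \<or>
        (\<forall>g a b. \<not> quotient_edge E S (arr s 1 e) (arr s 2 e) g a b) \<and>
        arr s' 12 e = arr s 12 e \<and> arr s' 10 e = arr s 10 e \<and> arr s' 11 e = arr s 11 e) \<and>
      frame collect s s') s"
  unfolding collect_def
proof (rule runs_weaken[OF runs_For[where N = m and T = 23 and
      I = "\<lambda>i s'. \<forall>e<m. if e < i then
        quotient_edge E S (arr s 1 e) (arr s 2 e) (arr s' 12 e) (arr s' 10 e) (arr s' 11 e) \<or>
        (\<forall>g a b. \<not> quotient_edge E S (arr s 1 e) (arr s 2 e) g a b) \<and>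
        arr s' 12 e = arr s 12 e \<and> arr s' 10 e = arr s 10 e \<and> arr s' 11 e = arr s 11 e
        else arr s' 12 e = arr s 12 e \<and> arr s' 10 e = arr s 10 e \<and> arr s' 11 e = arr s 11 e"]])
  fix i s'
  let ?q = "\<lambda>e. quotient_edge E S (arr s 1 e) (arr s 2 e)"
  let ?P = "\<lambda>i s'. \<forall>e<m. if e < i then
        quotient_edge E S (arr s 1 e) (arr s 2 e) (arr s' 12 e) (arr s' 10 e) (arr s' 11 e) \<or>
        (\<forall>g a b. \<not> quotient_edge E S (arr s 1 e) (arr s 2 e) g a b) \<and>
        arr s' 12 e = arr s 12 e \<and> arr s' 10 e = arr s 10 e \<and> arr s' 11 e = arr s 11 e
        else arr s' 12 e = arr s 12 e \<and> arr s' 10 e = arr s 10 e \<and> arr s' 11 e = arr s 11 e"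
  assume i: "i < m" "reg s' 6 = i" and fr: "frame (For 6 1 collect_body) s s'" and I: "?P i s'"
  define u v where uv: "u = arr s 1 i" "v = arr s 2 i"
  have mem: "(u, v) \<in> E" "u \<le> v" "u < m * n" "v < m * n"
    using wf i(1) by (auto simp: E edges_def uv well_formed_def intro: le_less_trans)
  define f where "f = last_in S u"
  note iff = quotient_edge_iff[OF mem(1,2) zero, folded f_def]
  have same: "arr s' 1 = arr s 1" "arr s' 2 = arr s 2" "arr s' 4 = arr s 4" "arr s' 7 = arr s 7"
    "arr s' 8 = arr s 8" "arr s' 9 = arr s 9" "reg s' 3 = 1"
    using fr env by (auto simp: frame_def env_def collect_defs)
  have val: "arr s 4 u = f" "arr s 4 v = last_in S v" "arr s 7 u = left_block E S u"
    "arr s 7 v = left_block E S v" "arr s 8 u = right_block E S u" "arr s 8 v = right_block E S v"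
    "arr s 9 u = last_in (refine E S) u" "arr s 9 v = last_in (refine E S) v"
    using vals mem by (auto simp: f_def)
  have W: "f + f + 1 \<le> W" "left_block E S u \<le> W" "left_block E S v \<le> W"
    "right_block E S u \<le> W" "right_block E S v \<le> W"
  proof -
    have "f \<le> u" unfolding f_def by (rule last_in_le[OF zero])
    then show "f + f + 1 \<le> W" using mem(3) env by (auto simp: env_def)
    show "left_block E S u \<le> W" "left_block E S v \<le> W" "right_block E S u \<le> W" "right_block E S v \<le> W"
      using block_le[OF zero, of E u] block_le[OF zero, of E v] mem(3,4) envD(6)[OF env] by linarith+
  qed
  have old: "arr s' 12 i = arr s 12 i" "arr s' 10 i = arr s 10 i" "arr s' 11 i = arr s 11 i"
    using I i(1) by auto
  show "runs W collect_body 23 (\<lambda>s''. \<forall>s''' :: ram_state. reg s''' = (reg s'')(6 := Suc i) \<longrightarrow> arr s''' = arr s'' \<longrightarrow>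
      ?P (Suc i) s''') s'"
  proof (rule runs_weaken[OF runs_wp])
    show "cost collect_body \<le> 23" by (simp add: collect_defs)
    show "wp W collect_body (\<lambda>s''.
      if \<not> f < last_in S v \<and> last_in (refine E S) u < last_in (refine E S) v \<and>
        f < left_block E S u \<and> left_block E S u < left_block E S v
      then put i (2 * f) (left_block E S u - f) (left_block E S v - f) s' s''
      else if \<not> f < last_in S v \<and> last_in (refine E S) u < last_in (refine E S) v \<and>
        f < right_block E S u \<and> right_block E S u < right_block E S v
      then put i (2 * f + 1) (right_block E S u - f) (right_block E S v - f) s' s''
      else arr s'' = arr s') s'"
      using i(2) same val W by (intro wp_collect_body) (simp_all add: uv)
  next
    fix s'' assume post: "if \<not> f < last_in S v \<and> last_in (refine E S) u < last_in (refine E S) v \<and>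
        f < left_block E S u \<and> left_block E S u < left_block E S v
      then put i (2 * f) (left_block E S u - f) (left_block E S v - f) s' s''
      else if \<not> f < last_in S v \<and> last_in (refine E S) u < last_in (refine E S) v \<and>
        f < right_block E S u \<and> right_block E S u < right_block E S v
      then put i (2 * f + 1) (right_block E S u - f) (right_block E S v - f) s' s''
      else arr s'' = arr s'"
    then have others: "arr s'' A e = arr s' A e" if "e \<noteq> i" for A e
      using that by (auto simp: put_def split: if_splits)
    have at_i: "?q i (arr s'' 12 i) (arr s'' 10 i) (arr s'' 11 i) \<or>
        (\<forall>g a b. \<not> ?q i g a b) \<and>
        arr s'' 12 i = arr s 12 i \<and> arr s'' 10 i = arr s 10 i \<and> arr s'' 11 i = arr s 11 i"
    proof (cases "\<not> f < last_in S v \<and> last_in (refine E S) u < last_in (refine E S) v \<and>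
        f < left_block E S u \<and> left_block E S u < left_block E S v")
      case True
      then show ?thesis using post unfolding uv[symmetric] iff by (simp add: put_def)
    next
      case left: False
      show ?thesis
      proof (cases "\<not> f < last_in S v \<and> last_in (refine E S) u < last_in (refine E S) v \<and>
        f < right_block E S u \<and> right_block E S u < right_block E S v")
        case True
        then show ?thesis using post left unfolding uv[symmetric] iff by (auto simp: put_def)
      next
        case False
        then have "\<not> ?q i g a b" for g a b using left unfolding uv[symmetric] iff by auto
        moreover have "arr s'' = arr s'" using post left False by simp
        ultimately show ?thesis using old by simp
      qed
    qed
    show "\<forall>s''' :: ram_state. reg s''' = (reg s'')(6 := Suc i) \<longrightarrow> arr s''' = arr s'' \<longrightarrow> ?P (Suc i) s'''"
    proof (intro allI impI)
      fix s3 :: ram_state and e assume s3: "arr s3 = arr s''" and e: "e < m"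
      show "if e < Suc i then
        quotient_edge E S (arr s 1 e) (arr s 2 e) (arr s3 12 e) (arr s3 10 e) (arr s3 11 e) \<or>
        (\<forall>g a b. \<not> quotient_edge E S (arr s 1 e) (arr s 2 e) g a b) \<and>
        arr s3 12 e = arr s 12 e \<and> arr s3 10 e = arr s 10 e \<and> arr s3 11 e = arr s 11 e
        else arr s3 12 e = arr s 12 e \<and> arr s3 10 e = arr s 10 e \<and> arr s3 11 e = arr s 11 e"
      proof (cases "e = i")
        case True
        then show ?thesis using at_i unfolding s3 by simp
      next
        case False
        then show ?thesis using I[rule_format, OF e] others unfolding s3 by (cases "e < i") (simp_all add: less_Suc_eq)
      qed
    qed
  qed
qed (use env envD[OF env] in \<open>auto simp: env_def collect_defs\<close>)

definition next_classes :: ram_prog where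
  "next_classes = For 6 4 (Load 9 9 6 ;; Store 4 6 9)"

lemma runs_next_classes:
  assumes env: "env W n m s"
  shows "runs W next_classes (4 * (m * n) + 2)
    (\<lambda>s'. (\<forall>w<m * n. arr s' 4 w = arr s 9 w) \<and> frame next_classes s s') s"
  unfolding next_classes_def
proof (rule runs_weaken[OF runs_For[where N = "m * n" and T = 2 and
      I = "\<lambda>i s'. \<forall>w<i. arr s' 4 w = arr s 9 w"]])
  fix i s' assume "\<forall>w<i. arr s' 4 w = arr s 9 w" "reg s' 6 = i"
    "frame (For 6 4 (Load 9 9 6 ;; Store 4 6 9)) s s'"
  then show "runs W (Load 9 9 6 ;; Store 4 6 9) 2
      (\<lambda>s''. \<forall>s'''. reg s''' = (reg s'')(6 := Suc i) \<longrightarrow> arr s''' = arr s'' \<longrightarrow>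
         (\<forall>w<Suc i. arr s''' 4 w = arr s 9 w)) s'"
    by (intro runs_weaken[OF runs_wp]) (auto simp: frame_def less_Suc_eq)
qed (use env envD[OF env] in \<open>auto simp: env_def\<close>)

definition refine_round :: ram_prog where
  "refine_round = clear_flags ;; mark_seen ;; sweep ;; collect ;; next_classes"

lemmas round_defs = clear_flags_def mark_seen_def sweep_def sweep_body_def collect_def
  collect_defs next_classes_def refine_round_def

lemma collected_Suc:
  assumes "collected n m U V d G A B"
    and "\<forall>e<m. quotient_edge (edges m U V) (starts n (edges m U V) d) (U e) (V e) (G' e) (A' e) (B' e) \<or>
        (\<forall>g a b. \<not> quotient_edge (edges m U V) (starts n (edges m U V) d) (U e) (V e) g a b) \<and>
        G' e = G e \<and> A' e = A e \<and> B' e = B e"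
  shows "collected n m U V (Suc d) G' A' B'"
  unfolding collected_def
proof (intro allI impI)
  fix e assume e: "e < m"
  let ?q = "\<lambda>d. quotient_edge (edges m U V) (starts n (edges m U V) d) (U e) (V e)"
  from assms(2) e consider "?q d (G' e) (A' e) (B' e)"
    | "\<forall>g a b. \<not> ?q d g a b" "G' e = G e" "A' e = A e" "B' e = B e" by blast
  then show "(\<exists>d'<Suc d. ?q d' (G' e) (A' e) (B' e)) \<or>
     (\<forall>d'<Suc d. \<forall>g a b. \<not> ?q d' g a b) \<and> G' e = 0 \<and> A' e = 0 \<and> B' e = 0"
  proof cases
    case 1
    then show ?thesis by blast
  next
    case 2
    from assms(1) e have "(\<exists>d'<d. ?q d' (G e) (A e) (B e)) \<or>
     (\<forall>d'<d. \<forall>g a b. \<not> ?q d' g a b) \<and> G e = 0 \<and> A e = 0 \<and> B e = 0"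
      unfolding collected_def by blast
    then show ?thesis using 2 by (auto simp: less_Suc_eq)
  qed
qed

lemma runs_refine_round:
  assumes env: "env W n m s" and wf: "well_formed n m (arr s 1) (arr s 2)"
    and E: "E = edges m (arr s 1) (arr s 2)"
    and cls: "\<forall>w<m * n. arr s 4 w = last_in (starts n E d) w"
    and col: "collected n m (arr s 1) (arr s 2) d (arr s 12) (arr s 10) (arr s 11)"
  shows "runs W refine_round (77 * (m * n))
    (\<lambda>s'. (\<forall>w<m * n. arr s' 4 w = last_in (starts n E (Suc d)) w) \<and>
       collected n m (arr s 1) (arr s 2) (Suc d) (arr s' 12) (arr s' 10) (arr s' 11)) s"
proof -
  define S where "S = starts n E d"
  have zero: "0 \<in> S" unfolding S_def by (rule zero_in_starts)
  have bounds: "arr s 1 e < m * n" "arr s 2 e < m * n" "arr s 1 e \<le> arr s 2 e" if "e < m" for e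
    using wf that by (auto simp: well_formed_def intro: le_less_trans)
  have less_iff: "arr s 4 (arr s 1 e) < arr s 4 (arr s 2 e) \<longleftrightarrow>
      last_in S (arr s 1 e) \<noteq> last_in S (arr s 2 e)" if "e < m" for e
    using bounds[OF that] cls monoD[OF mono_last_in[OF zero] bounds(3)[OF that]] by (auto simp: S_def)
  let ?R1 = "\<lambda>s1. (\<forall>w<m * n. arr s1 5 w = 0 \<and> arr s1 6 w = 0) \<and> frame clear_flags s s1"
  let ?R2 = "\<lambda>s2. (\<forall>w<m * n. (0 < arr s2 5 w \<longleftrightarrow> w \<in> left_seen E S) \<and>
      (0 < arr s2 6 w \<longleftrightarrow> w \<in> right_seen E S)) \<and> frame (clear_flags ;; mark_seen) s s2"
  let ?R3 = "\<lambda>s3. (\<forall>w<m * n. arr s3 7 w = left_block E S w \<and> arr s3 8 w = right_block E S w \<and>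
      arr s3 9 w = last_in (refine E S) w) \<and> frame (clear_flags ;; mark_seen ;; sweep) s s3"
  let ?R4 = "\<lambda>s4. (\<forall>w<m * n. arr s4 9 w = last_in (refine E S) w) \<and>
      collected n m (arr s 1) (arr s 2) (Suc d) (arr s4 12) (arr s4 10) (arr s4 11) \<and>
      frame (clear_flags ;; mark_seen ;; sweep ;; collect) s s4"
  have 1: "runs W clear_flags (4 * (m * n) + 2) ?R1 s" by (rule runs_clear_flags[OF env])
  have 2: "runs W mark_seen (9 * m + 2) ?R2 s1" if R: "?R1 s1" for s1
  proof -
    have same: "arr s1 1 = arr s 1" "arr s1 2 = arr s 2" "arr s1 4 = arr s 4"
      using R by (auto simp: frame_def round_defs)
    have env1: "env W n m s1" using R env by (auto intro: env_frame simp: round_defs)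
    have seen: "(\<exists>e<m. arr s 2 e = w \<and> arr s 4 (arr s 1 e) < arr s 4 (arr s 2 e)) \<longleftrightarrow> w \<in> left_seen E S"
      "(\<exists>e<m. arr s 1 e = w \<and> arr s 4 (arr s 1 e) < arr s 4 (arr s 2 e)) \<longleftrightarrow> w \<in> right_seen E S" for w
      using less_iff by (auto simp: E edges_def left_seen_def right_seen_def)
    show ?thesis
      by (rule runs_weaken[OF runs_mark_seen[OF env1 conjunct1[OF R], unfolded same seen]])
        (use R in \<open>auto simp: frame_def\<close>)
  qed
  have 3: "runs W sweep (25 * (m * n) + 2) ?R3 s2" if R: "?R2 s2" for s2
  proof -
    have same: "arr s2 4 = arr s 4" using R by (auto simp: frame_def round_defs)
    have "env W n m s2" using R env by (auto intro: env_frame simp: round_defs)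
    then have "runs W sweep (25 * (m * n) + 2)
      (\<lambda>s'. (\<forall>w<m * n. arr s' 7 w = last_in (S \<union> left_seen E S) w \<and>
        arr s' 8 w = last_in (S \<union> right_seen E S) w \<and>
        arr s' 9 w = last_in (S \<union> left_seen E S \<union> right_seen E S \<union>
          Suc ` (S \<union> left_seen E S \<union> right_seen E S)) w) \<and> frame sweep s2 s') s2"
      using R cls by (intro runs_sweep zero) (auto simp: same S_def)
    then show ?thesis
      by (rule runs_weaken)
        (use R in \<open>auto simp: left_block_def right_block_def refine_def singled_def frame_def\<close>)
  qed
  have 4: "runs W collect (25 * m + 2) ?R4 s3" if R: "?R3 s3" for s3
  proof -
    have same: "arr s3 1 = arr s 1" "arr s3 2 = arr s 2" "arr s3 4 = arr s 4" "arr s3 10 = arr s 10"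
      "arr s3 11 = arr s 11" "arr s3 12 = arr s 12"
      using R by (auto simp: frame_def round_defs)
    have env3: "env W n m s3" using R env by (auto intro: env_frame simp: round_defs)
    have vals: "\<forall>w<m * n. arr s3 4 w = last_in S w \<and> arr s3 7 w = left_block E S w \<and>
      arr s3 8 w = right_block E S w \<and> arr s3 9 w = last_in (refine E S) w"
      using R cls by (auto simp: same S_def)
    have wf3: "well_formed n m (arr s3 1) (arr s3 2)" and E3: "E = edges m (arr s3 1) (arr s3 2)"
      unfolding same using wf E by simp_all
    show ?thesis
    proof (rule runs_weaken[OF runs_collect[OF env3 zero wf3 E3 vals]])
      fix s4
      assume "(\<forall>e<m. quotient_edge E S (arr s3 1 e) (arr s3 2 e) (arr s4 12 e) (arr s4 10 e) (arr s4 11 e) \<or>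
        (\<forall>g a b. \<not> quotient_edge E S (arr s3 1 e) (arr s3 2 e) g a b) \<and>
        arr s4 12 e = arr s3 12 e \<and> arr s4 10 e = arr s3 10 e \<and> arr s4 11 e = arr s3 11 e) \<and>
        frame collect s3 s4"
      then have q: "\<forall>e<m. quotient_edge E S (arr s 1 e) (arr s 2 e) (arr s4 12 e) (arr s4 10 e) (arr s4 11 e) \<or>
        (\<forall>g a b. \<not> quotient_edge E S (arr s 1 e) (arr s 2 e) g a b) \<and>
        arr s4 12 e = arr s 12 e \<and> arr s4 10 e = arr s 10 e \<and> arr s4 11 e = arr s 11 e"
        and fr: "frame collect s3 s4" unfolding same by simp_all
      have "collected n m (arr s 1) (arr s 2) (Suc d) (arr s4 12) (arr s4 10) (arr s4 11)"
        using collected_Suc[OF col] q unfolding S_def E by blast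
      moreover have "arr s4 9 = arr s3 9" using fr by (auto simp: frame_def round_defs)
      moreover have "frame (clear_flags ;; mark_seen ;; sweep ;; collect) s s4"
        using R fr by (auto simp: frame_def)
      ultimately show "?R4 s4" using R by simp
    qed simp
  qed
  have 5: "runs W next_classes (4 * (m * n) + 2)
      (\<lambda>s'. (\<forall>w<m * n. arr s' 4 w = last_in (starts n E (Suc d)) w) \<and>
       collected n m (arr s 1) (arr s 2) (Suc d) (arr s' 12) (arr s' 10) (arr s' 11)) s4" if R: "?R4 s4" for s4
  proof -
    have env4: "env W n m s4" using R env by (auto intro: env_frame simp: round_defs)
    show ?thesis
      by (rule runs_weaken[OF runs_next_classes[OF env4]])
        (use R in \<open>auto simp: frame_def next_classes_def starts_Suc S_def\<close>)
  qed
  have "runs W refine_round ((4 * (m * n) + 2) + ((9 * m + 2) + ((25 * (m * n) + 2) + ((25 * m + 2) + (4 * (m * n) + 2)))))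
      (\<lambda>s'. (\<forall>w<m * n. arr s' 4 w = last_in (starts n E (Suc d)) w) \<and>
       collected n m (arr s 1) (arr s 2) (Suc d) (arr s' 12) (arr s' 10) (arr s' 11)) s"
    unfolding refine_round_def
    by (rule runs_Seq[OF 1 runs_Seq[OF 2 runs_Seq[OF 3 runs_Seq[OF 4 5]]]])
  then show ?thesis
    \<comment> \<open>The total is \<open>33 * (m * n) + 34 * m + 10\<close>, and 77 is the sum of
      the coefficients.\<close>
    by (rule runs_weaken) (use envD[OF env] in linarith)
qed

section \<open>One level: initialisation, n rounds and relabelling of the edges\<close>

definition init_classes :: ram_prog where
  "init_classes = For 6 4 (Op Div 9 6 0 ;; Op Mul 9 9 0 ;; Store 4 6 9)"

lemma runs_init_classes:
  assumes env: "env W n m s"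
  shows "runs W init_classes (5 * (m * n) + 2)
    (\<lambda>s'. (\<forall>w<m * n. arr s' 4 w = w div n * n) \<and> frame init_classes s s') s"
  unfolding init_classes_def
proof (rule runs_weaken[OF runs_For[where N = "m * n" and T = 3 and
      I = "\<lambda>i s'. \<forall>w<i. arr s' 4 w = w div n * n"]])
  fix i s' assume "\<forall>w<i. arr s' 4 w = w div n * n" and i: "reg s' 6 = i" "i < m * n"
    and "frame (For 6 4 (Op Div 9 6 0 ;; Op Mul 9 9 0 ;; Store 4 6 9)) s s'"
  moreover have "i div n \<le> W" "i div n * n \<le> W"
    using i(2) envD(6)[OF env] div_le_dividend[of i n] div_times_less_eq_dividend[of i n] by linarith+
  ultimately show "runs W (Op Div 9 6 0 ;; Op Mul 9 9 0 ;; Store 4 6 9) 3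
      (\<lambda>s''. \<forall>s'''. reg s''' = (reg s'')(6 := Suc i) \<longrightarrow> arr s''' = arr s'' \<longrightarrow>
         (\<forall>w<Suc i. arr s''' 4 w = w div n * n)) s'"
    using env by (intro runs_weaken[OF runs_wp]) (auto simp: frame_def env_def less_Suc_eq)
qed (use env envD[OF env] in \<open>auto simp: env_def\<close>)

definition init_groups :: ram_prog where
  "init_groups = For 6 1 (Store 10 6 5 ;; Store 11 6 5 ;; Store 12 6 5)"

lemma runs_init_groups:
  assumes env: "env W n m s"
  shows "runs W init_groups (5 * m + 2)
    (\<lambda>s'. (\<forall>e<m. arr s' 10 e = 0 \<and> arr s' 11 e = 0 \<and> arr s' 12 e = 0) \<and> frame init_groups s s') s"
  unfolding init_groups_def
proof (rule runs_weaken[OF runs_For[where N = m and T = 3 and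
      I = "\<lambda>i s'. \<forall>e<i. arr s' 10 e = 0 \<and> arr s' 11 e = 0 \<and> arr s' 12 e = 0"]])
  fix i s' assume "\<forall>e<i. arr s' 10 e = 0 \<and> arr s' 11 e = 0 \<and> arr s' 12 e = 0" "reg s' 6 = i"
    "frame (For 6 1 (Store 10 6 5 ;; Store 11 6 5 ;; Store 12 6 5)) s s'"
  then show "runs W (Store 10 6 5 ;; Store 11 6 5 ;; Store 12 6 5) 3
      (\<lambda>s''. \<forall>s'''. reg s''' = (reg s'')(6 := Suc i) \<longrightarrow> arr s''' = arr s'' \<longrightarrow>
         (\<forall>e<Suc i. arr s''' 10 e = 0 \<and> arr s''' 11 e = 0 \<and> arr s''' 12 e = 0)) s'"
    using env by (intro runs_weaken[OF runs_wp]) (auto simp: frame_def env_def less_Suc_eq)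
qed (use env envD[OF env] in \<open>auto simp: env_def\<close>)

definition rounds :: ram_prog where
  "rounds = For 7 0 refine_round"

lemma runs_rounds:
  assumes env: "env W n m s" and wf: "well_formed n m (arr s 1) (arr s 2)"
    and cls: "\<forall>w<m * n. arr s 4 w = w div n * n"
    and groups: "\<forall>e<m. arr s 10 e = 0 \<and> arr s 11 e = 0 \<and> arr s 12 e = 0"
  shows "runs W rounds (n * (77 * (m * n) + 2) + 2)
    (\<lambda>s'. collected n m (arr s 1) (arr s 2) n (arr s' 12) (arr s' 10) (arr s' 11) \<and> frame rounds s s') s"
  unfolding rounds_def
proof (rule runs_weaken[OF runs_For[where N = n and T = "77 * (m * n)" and
      I = "\<lambda>d s'. (\<forall>w<m * n. arr s' 4 w = last_in (starts n (edges m (arr s 1) (arr s 2)) d) w) \<and>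
        collected n m (arr s 1) (arr s 2) d (arr s' 12) (arr s' 10) (arr s' 11)"]])
  let ?E = "edges m (arr s 1) (arr s 2)"
  let ?I = "\<lambda>d s'. (\<forall>w<m * n. arr s' 4 w = last_in (starts n ?E d) w) \<and>
        collected n m (arr s 1) (arr s 2) d (arr s' 12) (arr s' 10) (arr s' 11)"
  show "?I 0 s'" if "arr s' = arr s" for s'
    using cls groups unfolding that collected_def starts_0 last_in_multiples by simp
  fix d s' assume I: "?I d s'" and fr: "frame (For 7 0 refine_round) s s'"
  have same: "arr s' 1 = arr s 1" "arr s' 2 = arr s 2"
    using fr by (auto simp: frame_def round_defs)
  have env': "env W n m s'" using fr env by (auto intro: env_frame simp: round_defs)
  have "runs W refine_round (77 * (m * n)) (?I (Suc d)) s'"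
    using runs_refine_round[OF env' _ refl, of d] I wf unfolding same by blast
  then show "runs W refine_round (77 * (m * n))
      (\<lambda>s''. \<forall>s'''. reg s''' = (reg s'')(7 := Suc d) \<longrightarrow> arr s''' = arr s'' \<longrightarrow> ?I (Suc d) s''') s'"
    by (rule runs_weaken) simp_all
qed (use env envD[OF env] in \<open>auto simp: env_def round_defs\<close>)

text \<open>Among edges with the same quotient number the last one overwrites the others and becomes
  the representative. Only numbers that occur are looked up later, so the table needs no
  clearing.\<close>

definition identify :: ram_prog where
  "identify = For 6 1 (Load 9 12 6 ;; Store 13 9 6)"

lemma runs_identify:
  assumes env: "env W n m s"
  shows "runs W identify (4 * m + 2)
    (\<lambda>s'. (\<forall>e<m. arr s' 13 (arr s 12 e) < m \<and> arr s 12 (arr s' 13 (arr s 12 e)) = arr s 12 e) \<and>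
      frame identify s s') s"
  unfolding identify_def
proof (rule runs_weaken[OF runs_For[where N = m and T = 2 and
      I = "\<lambda>i s'. \<forall>e<i. arr s' 13 (arr s 12 e) < i \<and> arr s 12 (arr s' 13 (arr s 12 e)) = arr s 12 e"]])
  fix i s'
  assume I: "\<forall>e<i. arr s' 13 (arr s 12 e) < i \<and> arr s 12 (arr s' 13 (arr s 12 e)) = arr s 12 e"
    and i: "reg s' 6 = i" and fr: "frame (For 6 1 (Load 9 12 6 ;; Store 13 9 6)) s s'"
  have "arr s' 12 = arr s 12" using fr by (auto simp: frame_def)
  with I i show "runs W (Load 9 12 6 ;; Store 13 9 6) 2
      (\<lambda>s''. \<forall>s'''. reg s''' = (reg s'')(6 := Suc i) \<longrightarrow> arr s''' = arr s'' \<longrightarrow>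
         (\<forall>e<Suc i. arr s''' 13 (arr s 12 e) < Suc i \<and>
           arr s 12 (arr s''' 13 (arr s 12 e)) = arr s 12 e)) s'"
    by (intro runs_weaken[OF runs_wp]) (auto simp: less_Suc_eq)
qed (use env envD[OF env] in \<open>auto simp: env_def\<close>)

definition relabel_body :: ram_prog where
  "relabel_body = Load 9 12 6 ;; Load 9 13 9 ;; Op Mul 9 9 0 ;;
     Load 10 10 6 ;; Op Add 10 9 10 ;; Store 1 6 10 ;;
     Load 10 11 6 ;; Op Add 10 9 10 ;; Store 2 6 10"

definition relabel :: ram_prog where
  "relabel = For 6 1 relabel_body"

lemma runs_relabel:
  assumes env: "env W n m s"
    and fits: "\<forall>e<m. arr s 13 (arr s 12 e) < m \<and> arr s 10 e < n \<and> arr s 11 e < n"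
  shows "runs W relabel (11 * m + 2)
    (\<lambda>s'. \<forall>e<m. arr s' 1 e = arr s 13 (arr s 12 e) * n + arr s 10 e \<and>
      arr s' 2 e = arr s 13 (arr s 12 e) * n + arr s 11 e) s"
  unfolding relabel_def
proof (rule runs_weaken[OF runs_For[where N = m and T = 9 and
      I = "\<lambda>i s'. \<forall>e<i. arr s' 1 e = arr s 13 (arr s 12 e) * n + arr s 10 e \<and>
        arr s' 2 e = arr s 13 (arr s 12 e) * n + arr s 11 e"]])
  fix i s'
  assume I: "\<forall>e<i. arr s' 1 e = arr s 13 (arr s 12 e) * n + arr s 10 e \<and>
        arr s' 2 e = arr s 13 (arr s 12 e) * n + arr s 11 e"
    and i: "reg s' 6 = i" "i < m" and fr: "frame (For 6 1 relabel_body) s s'"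
  have same: "arr s' 10 = arr s 10" "arr s' 11 = arr s 11" "arr s' 12 = arr s 12" "arr s' 13 = arr s 13"
    "reg s' 0 = n"
    using fr env by (auto simp: frame_def relabel_body_def env_def)
  have "Suc (arr s 13 (arr s 12 i)) * n \<le> m * n"
    using fits i(2) by (intro mult_le_mono1) (simp add: Suc_le_eq)
  then have "arr s 13 (arr s 12 i) * n + arr s 10 i \<le> W" "arr s 13 (arr s 12 i) * n + arr s 11 i \<le> W"
    "arr s 13 (arr s 12 i) * n \<le> W"
    using fits i(2) envD(6)[OF env] by auto
  then show "runs W relabel_body 9
      (\<lambda>s''. \<forall>s'''. reg s''' = (reg s'')(6 := Suc i) \<longrightarrow> arr s''' = arr s'' \<longrightarrow>
         (\<forall>e<Suc i. arr s''' 1 e = arr s 13 (arr s 12 e) * n + arr s 10 e \<and>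
           arr s''' 2 e = arr s 13 (arr s 12 e) * n + arr s 11 e)) s'"
    using I i(1) same
    by (intro runs_weaken[OF runs_wp]) (simp_all add: relabel_body_def less_Suc_eq)
qed (use env envD[OF env] in \<open>auto simp: env_def relabel_body_def\<close>)

definition level_step :: ram_prog where
  "level_step = init_classes ;; init_groups ;; rounds ;; identify ;; relabel"

lemmas level_defs = init_classes_def init_groups_def rounds_def identify_def relabel_def
  relabel_body_def level_step_def round_defs

lemma runs_level_step:
  assumes env: "env W n m s" and wf: "well_formed n m (arr s 1) (arr s 2)"
  shows "runs W level_step (114 * (n * (m * n)))
    (\<lambda>s'. \<exists>G A B I. level n m (arr s 1) (arr s 2) G A B I (arr s' 1) (arr s' 2)) s"
proof -
  let ?R1 = "\<lambda>s1. (\<forall>w<m * n. arr s1 4 w = w div n * n) \<and> frame init_classes s s1"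
  let ?R2 = "\<lambda>s2. (\<forall>w<m * n. arr s2 4 w = w div n * n) \<and>
    (\<forall>e<m. arr s2 10 e = 0 \<and> arr s2 11 e = 0 \<and> arr s2 12 e = 0) \<and>
    frame (init_classes ;; init_groups) s s2"
  let ?R3 = "\<lambda>s3. collected n m (arr s 1) (arr s 2) n (arr s3 12) (arr s3 10) (arr s3 11) \<and>
    frame (init_classes ;; init_groups ;; rounds) s s3"
  let ?R4 = "\<lambda>s4. collected n m (arr s 1) (arr s 2) n (arr s4 12) (arr s4 10) (arr s4 11) \<and>
    (\<forall>e<m. arr s4 13 (arr s4 12 e) < m \<and> arr s4 12 (arr s4 13 (arr s4 12 e)) = arr s4 12 e) \<and>
    frame (init_classes ;; init_groups ;; rounds ;; identify) s s4"
  let ?Q = "\<lambda>s'. \<exists>G A B I. level n m (arr s 1) (arr s 2) G A B I (arr s' 1) (arr s' 2)"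
  have n: "0 < n" using env by (simp add: env_def)
  have 1: "runs W init_classes (5 * (m * n) + 2) ?R1 s" by (rule runs_init_classes[OF env])
  have 2: "runs W init_groups (5 * m + 2) ?R2 s1" if R: "?R1 s1" for s1
  proof -
    have env1: "env W n m s1" using R env by (auto intro: env_frame simp: level_defs)
    show ?thesis
      by (rule runs_weaken[OF runs_init_groups[OF env1]])
        (use R in \<open>auto simp: frame_def init_groups_def\<close>)
  qed
  have 3: "runs W rounds (n * (77 * (m * n) + 2) + 2) ?R3 s2" if R: "?R2 s2" for s2
  proof -
    have env2: "env W n m s2" using R env by (auto intro: env_frame simp: level_defs)
    have same: "arr s2 1 = arr s 1" "arr s2 2 = arr s 2" using R by (auto simp: frame_def level_defs)
    have wf2: "well_formed n m (arr s2 1) (arr s2 2)" unfolding same by (rule wf)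
    show ?thesis
      by (rule runs_weaken[OF runs_rounds[OF env2 wf2, unfolded same]])
        (use R in \<open>auto simp: frame_def\<close>)
  qed
  have 4: "runs W identify (4 * m + 2) ?R4 s3" if R: "?R3 s3" for s3
  proof -
    have env3: "env W n m s3" using R env by (auto intro: env_frame simp: level_defs)
    show ?thesis
    proof (rule runs_weaken[OF runs_identify[OF env3]])
      fix s4 assume *: "(\<forall>e<m. arr s4 13 (arr s3 12 e) < m \<and> arr s3 12 (arr s4 13 (arr s3 12 e)) = arr s3 12 e) \<and>
        frame identify s3 s4"
      then have same: "arr s4 12 = arr s3 12" "arr s4 10 = arr s3 10" "arr s4 11 = arr s3 11"
        by (auto simp: frame_def identify_def)
      have "frame (init_classes ;; init_groups ;; rounds ;; identify) s s4"
        using R * by (auto simp: frame_def)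
      then show "?R4 s4" using R * unfolding same by blast
    qed simp
  qed
  have 5: "runs W relabel (11 * m + 2) ?Q s4" if R: "?R4 s4" for s4
  proof -
    have env4: "env W n m s4" using R env by (auto intro: env_frame simp: level_defs)
    have lev: "level n m (arr s 1) (arr s 2) (arr s4 12) (arr s4 10) (arr s4 11) (arr s4 13) U' V'"
      if "\<forall>e<m. U' e = arr s4 13 (arr s4 12 e) * n + arr s4 10 e \<and>
        V' e = arr s4 13 (arr s4 12 e) * n + arr s4 11 e" for U' V'
      using that R n wf by unfold_locales auto
    \<comment> \<open>The bounds on the offsets come from \<open>level.AB\<close>, applied to the
      labels that \<open>relabel\<close> is about to compute.\<close>
    have "arr s4 10 e < n \<and> arr s4 11 e < n" if "e < m" for e
    proof -
      have "arr s4 10 e \<le> arr s4 11 e \<and> arr s4 11 e < n"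
        by (rule level.AB[OF lev[of "\<lambda>e. arr s4 13 (arr s4 12 e) * n + arr s4 10 e"
              "\<lambda>e. arr s4 13 (arr s4 12 e) * n + arr s4 11 e"] that]) simp
      then show ?thesis by simp
    qed
    then have fits: "\<forall>e<m. arr s4 13 (arr s4 12 e) < m \<and> arr s4 10 e < n \<and> arr s4 11 e < n"
      using R by blast
    show ?thesis
      by (rule runs_weaken[OF runs_relabel[OF env4 fits]]) (use lev in blast)+
  qed
  have "runs W level_step ((5 * (m * n) + 2) + ((5 * m + 2) + ((n * (77 * (m * n) + 2) + 2) +
      ((4 * m + 2) + (11 * m + 2))))) ?Q s"
    unfolding level_step_def
    by (rule runs_Seq[OF 1 runs_Seq[OF 2 runs_Seq[OF 3 runs_Seq[OF 4 5]]]])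
  then show ?thesis
  proof (rule runs_weaken)
    \<comment> \<open>The constant is 77 + 2 + 5 + 20 + 10: the rounds, their loop control, then the
      terms in \<open>m * n\<close>, in m and the constants.\<close>
    have "m * n \<le> n * (m * n)" using n by simp
    moreover have "n * (77 * (m * n) + 2) = 77 * (n * (m * n)) + 2 * n" by (simp add: algebra_simps)
    ultimately show "(5 * (m * n) + 2) + ((5 * m + 2) + ((n * (77 * (m * n) + 2) + 2) +
      ((4 * m + 2) + (11 * m + 2)))) \<le> 114 * (n * (m * n))"
      using envD[OF env] by linarith
  qed
qed

section \<open>The algorithm\<close>

text \<open>The inner value c is the loss of \<open>clique_minor_separated\<close>, the outer
  expression that of \<open>clique_minor_tree\<close>.\<close>

definition minor_bound :: "nat \<Rightarrow> nat" where
  "minor_bound b = (let c = (4 * (b + 1) + 1) * (b + 1) in (2 * c + 1) * c + 2)"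

text \<open>With 512 equal to \<open>8 ^ 3\<close>, the bound reads
  \<open>8 * minor_bound b \<le> (8 * b) ^ 4\<close>, which is the form that iterates.\<close>

lemma minor_bound_le:
  assumes b: "2 \<le> b"
  shows "minor_bound b \<le> 512 * b ^ 4"
proof -
  define x c where "x = b * b" and "c = (4 * (b + 1) + 1) * (b + 1)"
  have x: "2 * b \<le> x" "4 \<le> x" using b mult_le_mono[OF b b] by (auto simp: x_def)
  have "c = 4 * x + 9 * b + 5" by (simp add: c_def x_def algebra_simps)
  then have c: "c \<le> 10 * x" using x b by linarith
  have "c * c \<le> (10 * x) * (10 * x)" using c by (intro mult_le_mono)
  moreover have "4 * x \<le> x * x" using x(2) by simp
  moreover have "minor_bound b = 2 * (c * c) + c + 2"
    unfolding minor_bound_def Let_def c_def[symmetric] by (simp add: algebra_simps)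
  ultimately have "minor_bound b \<le> 512 * (x * x)" using c x by linarith
  also have "x * x = b ^ 4" by (simp add: x_def eval_nat_numeral)
  finally show ?thesis .
qed

lemma minor_bound_funpow: "2 \<le> (minor_bound ^^ k) 2 \<and> 8 * (minor_bound ^^ k) 2 \<le> 2 ^ (4 ^ (k + 1))"
proof (induction k)
  case (Suc k)
  let ?b = "(minor_bound ^^ k) 2"
  have "2 \<le> minor_bound ?b" by (simp add: minor_bound_def Let_def)
  moreover have "8 * minor_bound ?b \<le> 2 ^ (4 ^ (Suc k + 1))"
  proof -
    have "8 * minor_bound ?b \<le> 8 * (512 * ?b ^ 4)"
      using Suc minor_bound_le by (intro mult_le_mono2) blast
    also have "8 * (512 * ?b ^ 4) = (8 * ?b) ^ 4" by (simp add: power_mult_distrib)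
    also have "\<dots> \<le> (2 ^ (4 ^ (k + 1))) ^ 4" using Suc by (intro power_mono) auto
    also have "\<dots> = 2 ^ (4 ^ (Suc k + 1))" by (simp add: power_mult[symmetric] mult.commute)
    finally show ?thesis .
  qed
  ultimately show ?case by simp
qed simp

lemma minor_bound_iterated: "1 \<le> t \<Longrightarrow> (minor_bound ^^ (t - 2)) 2 \<le> 2 ^ (2 ^ (2 ^ t))"
proof -
  assume t: "1 \<le> t"
  have "2 * (t - 2 + 1) \<le> 2 ^ t"
  \<comment> \<open>Subtraction truncates: \<open>t - 2 + 1\<close> is \<open>t - 1\<close> for t at
    least 2, but 1 for t equal to 1.\<close>
  proof (cases "t = 1")
    case False
    obtain k where "t = Suc (Suc k)" using False t by (metis One_nat_def Suc_le_D not0_implies_Suc)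
    moreover have "k + 1 < 2 ^ (k + 1)" by (rule less_exp)
    ultimately show ?thesis by simp
  qed simp
  then have "(2::nat) ^ (2 * (t - 2 + 1)) \<le> 2 ^ (2 ^ t)" by (intro power_increasing) auto
  then have "(4::nat) ^ (t - 2 + 1) \<le> 2 ^ (2 ^ t)" by (simp only: power_mult) simp
  then have "(2::nat) ^ (4 ^ (t - 2 + 1)) \<le> 2 ^ (2 ^ (2 ^ t))" by (intro power_increasing) auto
  then show ?thesis using minor_bound_funpow[of "t - 2"] by linarith
qed

definition levels :: ram_prog where
  "levels = For 8 19 level_step"

lemma runs_levels:
  assumes env: "env W n m s" and wf: "well_formed n m (arr s 1) (arr s 2)"
    and N: "reg s 19 = N" "N \<le> W"
  shows "runs W levels (N * (114 * (n * (m * n)) + 2) + 2)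
    (\<lambda>s'. well_formed n m (arr s' 1) (arr s' 2) \<and>
      (\<forall>t\<ge>2. clique_minor (edges m (arr s' 1) (arr s' 2)) t \<longrightarrow>
        clique_minor (edges m (arr s 1) (arr s 2)) (t + N)) \<and>
      (\<forall>b. \<not> clique_minor (edges m (arr s' 1) (arr s' 2)) b \<longrightarrow>
        \<not> clique_minor (edges m (arr s 1) (arr s 2)) ((minor_bound ^^ N) b)) \<and>
      frame levels s s') s"
proof -
  let ?E = "edges m (arr s 1) (arr s 2)"
  define I where "I i s' \<longleftrightarrow> well_formed n m (arr s' 1) (arr s' 2) \<and>
      (\<forall>t\<ge>2. clique_minor (edges m (arr s' 1) (arr s' 2)) t \<longrightarrow> clique_minor ?E (t + i)) \<and>
      (\<forall>b. \<not> clique_minor (edges m (arr s' 1) (arr s' 2)) b \<longrightarrow>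
        \<not> clique_minor ?E ((minor_bound ^^ i) b))" for i and s' :: ram_state
  have "runs W levels (N * (114 * (n * (m * n)) + 2) + 2) (\<lambda>s'. I N s' \<and> frame levels s s') s"
    unfolding levels_def
  proof (rule runs_For[OF N])
    show "reg s 3 = 1" using env by (simp add: env_def)
    show "{8, 19, 3} \<inter> wregs level_step = {}" by (simp add: level_defs collect_defs)
    show "I 0 s'" if "arr s' = arr s" for s'
      unfolding I_def that using wf by simp
    fix i s' assume i: "i < N" and inv: "I i s'" and fr: "frame (For 8 19 level_step) s s'"
    have env': "env W n m s'" using fr env by (auto intro: env_frame simp: level_defs collect_defs)
    have wf': "well_formed n m (arr s' 1) (arr s' 2)" and up: "\<And>t. 2 \<le> t \<Longrightarrow> clique_minor (edges m (arr s' 1) (arr s' 2)) t \<Longrightarrow> clique_minor ?E (t + i)"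
      and down: "\<And>b. \<not> clique_minor (edges m (arr s' 1) (arr s' 2)) b \<Longrightarrow>
        \<not> clique_minor ?E ((minor_bound ^^ i) b)"
      using inv unfolding I_def by blast+
    show "runs W level_step (114 * (n * (m * n))) (\<lambda>s''. \<forall>s'''. reg s''' = (reg s'')(8 := Suc i) \<longrightarrow>
        arr s''' = arr s'' \<longrightarrow> I (Suc i) s''') s'"
    proof (rule runs_weaken[OF runs_level_step[OF env' wf']])
      fix s'' assume "\<exists>G A B I. level n m (arr s' 1) (arr s' 2) G A B I (arr s'' 1) (arr s'' 2)"
      then obtain G A B J where "level n m (arr s' 1) (arr s' 2) G A B J (arr s'' 1) (arr s'' 2)" by blast
      then interpret level n m "arr s' 1" "arr s' 2" G A B J "arr s'' 1" "arr s'' 2" .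
      have "clique_minor ?E (t + Suc i)" if "2 \<le> t" "clique_minor (edges m (arr s'' 1) (arr s'' 2)) t" for t
      proof -
        have "clique_minor ?E (Suc t + i)"
          using clique_minor_up[OF that(2,1)] that(1) by (intro up) simp_all
        then show ?thesis by simp
      qed
      moreover have "\<not> clique_minor ?E ((minor_bound ^^ Suc i) b)"
        if "\<not> clique_minor (edges m (arr s'' 1) (arr s'' 2)) b" for b
      proof -
        \<comment> \<open>The latest level acts on b first, so its bound is the innermost one of the
          iterate.\<close>
        have "\<not> clique_minor (edges m (arr s' 1) (arr s' 2)) (minor_bound b)"
          unfolding minor_bound_def Let_def by (rule clique_minor_down[OF that])
        from down[OF this] show ?thesis by (simp add: funpow_swap1)
      qed
      ultimately show "\<forall>s''' :: ram_state. reg s''' = (reg s'')(8 := Suc i) \<longrightarrow> arr s''' = arr s'' \<longrightarrow> I (Suc i) s'''"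
        using well_formed' unfolding I_def by simp
    qed simp
  qed simp_all
  then show ?thesis unfolding I_def by simp
qed

section \<open>Replacing vertex names by positions, reading off the answer, and the whole
  program\<close>

definition index_vertices :: ram_prog where
  "index_vertices = For 6 0 (Load 9 0 6 ;; Store 3 9 6)"

lemma runs_index_vertices:
  assumes env: "env W n m s" and dist: "distinct vs" "length vs = n"
    and vs: "\<forall>i<n. arr s 0 i = vs ! i"
  shows "runs W index_vertices (4 * n + 2)
    (\<lambda>s'. (\<forall>i<n. arr s' 3 (vs ! i) = i) \<and> frame index_vertices s s') s"
  unfolding index_vertices_def
proof (rule runs_weaken[OF runs_For[where N = n and T = 2 and
      I = "\<lambda>i s'. \<forall>j<i. arr s' 3 (vs ! j) = j"]])
  fix i s'
  assume I: "\<forall>j<i. arr s' 3 (vs ! j) = j" and i: "reg s' 6 = i" "i < n"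
    and fr: "frame (For 6 0 (Load 9 0 6 ;; Store 3 9 6)) s s'"
  have "arr s' 0 i = vs ! i" using fr vs i by (auto simp: frame_def)
  moreover have "vs ! j \<noteq> vs ! i" if "j < i" for j using dist that i(2) by (simp add: nth_eq_iff_index_eq)
  ultimately show "runs W (Load 9 0 6 ;; Store 3 9 6) 2
      (\<lambda>s''. \<forall>s'''. reg s''' = (reg s'')(6 := Suc i) \<longrightarrow> arr s''' = arr s'' \<longrightarrow>
         (\<forall>j<Suc i. arr s''' 3 (vs ! j) = j)) s'"
    using I i by (intro runs_weaken[OF runs_wp]) (auto simp: less_Suc_eq)
qed (use env envD[OF env] in \<open>auto simp: env_def\<close>)

definition index_edges_body :: ram_prog where
  "index_edges_body = Load 9 1 6 ;; Load 9 3 9 ;; Load 10 2 6 ;; Load 10 3 10 ;;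
     IfLess 9 10 (Store 1 6 9 ;; Store 2 6 10) (Store 1 6 10 ;; Store 2 6 9)"

definition index_edges :: ram_prog where
  "index_edges = For 6 1 index_edges_body"

lemma runs_index_edges:
  assumes env: "env W n m s"
  shows "runs W index_edges (9 * m + 2)
    (\<lambda>s'. (\<forall>e<m. arr s' 1 e = min (arr s 3 (arr s 1 e)) (arr s 3 (arr s 2 e)) \<and>
      arr s' 2 e = max (arr s 3 (arr s 1 e)) (arr s 3 (arr s 2 e))) \<and> frame index_edges s s') s"
  unfolding index_edges_def
\<comment> \<open>The edges are overwritten in place, so the invariant also says that later entries
  are still the input.\<close>
proof (rule runs_weaken[OF runs_For[where N = m and T = 7 and
      I = "\<lambda>i s'. \<forall>e. arr s' 1 e = (if e < i then min (arr s 3 (arr s 1 e)) (arr s 3 (arr s 2 e)) else arr s 1 e) \<and>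
        arr s' 2 e = (if e < i then max (arr s 3 (arr s 1 e)) (arr s 3 (arr s 2 e)) else arr s 2 e)"]])
  let ?I = "\<lambda>i s'. \<forall>e. arr s' 1 e = (if e < i then min (arr s 3 (arr s 1 e)) (arr s 3 (arr s 2 e)) else arr s 1 e) \<and>
        arr s' 2 e = (if e < i then max (arr s 3 (arr s 1 e)) (arr s 3 (arr s 2 e)) else arr s 2 e)"
  fix i s'
  assume I: "?I i s'" and i: "reg s' 6 = i" and fr: "frame (For 6 1 index_edges_body) s s'"
  have "arr s' 3 = arr s 3" using fr by (auto simp: frame_def index_edges_body_def)
  then show "runs W index_edges_body 7
      (\<lambda>s''. \<forall>s'''. reg s''' = (reg s'')(6 := Suc i) \<longrightarrow> arr s''' = arr s'' \<longrightarrow> ?I (Suc i) s''') s'"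
    using I i
    by (intro runs_weaken[OF runs_wp]) (auto simp: index_edges_body_def less_Suc_eq)
qed (use env envD[OF env] in \<open>auto simp: env_def index_edges_body_def\<close>)

definition find_edge :: ram_prog where
  "find_edge = Const 11 0 ;; For 6 1 (Load 9 1 6 ;; Load 10 2 6 ;; IfLess 9 10 (Const 11 1) Skip) ;; Copy 0 11"

lemma runs_find_edge:
  assumes env: "env W n m s"
  shows "runs W find_edge (6 * m + 4) (\<lambda>s'. says_yes s' \<longleftrightarrow> (\<exists>e<m. arr s 1 e < arr s 2 e)) s"
proof -
  let ?body = "Load 9 1 6 ;; Load 10 2 6 ;; IfLess 9 10 (Const 11 1) Skip"
  let ?s1 = "s\<lparr>reg := (reg s)(11 := 0)\<rparr>"
  have 1: "runs W (Const 11 0) 1 (\<lambda>s1. s1 = ?s1) s"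
    by (rule runs_weaken[OF runs_wp]) simp_all
  have 2: "runs W (For 6 1 ?body) (m * (4 + 2) + 2)
      (\<lambda>s'. (0 < reg s' 11 \<longleftrightarrow> (\<exists>e<m. arr s 1 e < arr s 2 e)) \<and> frame (For 6 1 ?body) ?s1 s') ?s1"
  proof (rule runs_For[where I = "\<lambda>i s'. 0 < reg s' 11 \<longleftrightarrow> (\<exists>e<i. arr s 1 e < arr s 2 e)"])
    fix i s' assume "0 < reg s' 11 \<longleftrightarrow> (\<exists>e<i. arr s 1 e < arr s 2 e)" "reg s' 6 = i"
      and fr: "frame (For 6 1 ?body) ?s1 s'"
    moreover have "arr s' = arr s" using fr by (auto simp: frame_def)
    ultimately show "runs W ?body 4 (\<lambda>s''. \<forall>s'''. reg s''' = (reg s'')(6 := Suc i) \<longrightarrow>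
        arr s''' = arr s'' \<longrightarrow> (0 < reg s''' 11 \<longleftrightarrow> (\<exists>e<Suc i. arr s 1 e < arr s 2 e))) s'"
      using envD(7)[OF env] by (intro runs_weaken[OF runs_wp]) (auto simp: less_Suc_eq)
  qed (use env envD[OF env] in \<open>auto simp: env_def\<close>)
  have 3: "runs W (Copy 0 11) 1 (\<lambda>s'. says_yes s' \<longleftrightarrow> (\<exists>e<m. arr s 1 e < arr s 2 e)) s2"
    if "(0 < reg s2 11 \<longleftrightarrow> (\<exists>e<m. arr s 1 e < arr s 2 e)) \<and> frame (For 6 1 ?body) ?s1 s2" for s2
    by (rule runs_weaken[OF runs_wp]) (use that in \<open>simp_all add: says_yes_def\<close>)
  have "runs W find_edge (1 + ((m * (4 + 2) + 2) + 1)) (\<lambda>s'. says_yes s' \<longleftrightarrow> (\<exists>e<m. arr s 1 e < arr s 2 e)) s"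
    unfolding find_edge_def
    by (rule runs_Seq[OF 1], rule runs_Seq[where R = "\<lambda>s'. (0 < reg s' 11 \<longleftrightarrow> (\<exists>e<m. arr s 1 e < arr s 2 e)) \<and>
        frame (For 6 1 ?body) ?s1 s'"]) (use 2 3 in auto)
  then show ?thesis by (rule runs_weaken) simp_all
qed

text \<open>Without edges and with t equal to 1, register 0 keeps the number of vertices, which is
  nonzero exactly if there is a clique minor of size 1. With edges, the truncated subtraction makes
  t equal to 1 run no level.\<close>

definition clique_minor_prog :: ram_prog where
  "clique_minor_prog =
     Const 3 1 ;;
     IfLess 5 1
       (Op Mul 4 1 0 ;; Const 18 2 ;; Op Sub 19 2 18 ;;
        index_vertices ;; index_edges ;; levels ;; find_edge)
       (Const 18 2 ;; IfLess 2 18 Skip (Const 0 0))"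

lemma clique_minor_2_iff: "clique_minor (edges m U V) 2 \<longleftrightarrow> (\<exists>e<m. U e < V e)"
proof
  assume "clique_minor (edges m U V) 2"
  then obtain \<phi> :: "nat \<Rightarrow> nat" where \<phi>: "mono \<phi>"
    and ed: "\<And>i j. i < j \<Longrightarrow> j < 2 \<Longrightarrow> \<exists>u v. (u, v) \<in> edges m U V \<and> \<phi> u = i \<and> \<phi> v = j"
    by (rule clique_minorE) blast
  obtain e where "e < m" "\<phi> (U e) = 0" "\<phi> (V e) = 1" using ed[of 0 1] by (auto simp: edges_def)
  then show "\<exists>e<m. U e < V e" using mono_lessD[OF \<phi>, of "U e" "V e"] by auto
next
  assume "\<exists>e<m. U e < V e"
  then obtain e where e: "e < m" "U e < V e" by blast
  show "clique_minor (edges m U V) 2"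
  proof (rule clique_minorI[of "\<lambda>w. if w < V e then 0 else 1"])
    show "mono (\<lambda>w. if w < V e then 0 else 1 :: nat)" by (auto intro!: monoI)
    fix i j :: nat assume "i < j" "j < 2"
    then have "i = 0" "j = 1" by auto
    then show "\<exists>u v. (u, v) \<in> edges m U V \<and> (if u < V e then 0 else 1) = i \<and> (if v < V e then 0 else 1) = j"
      using e by (intro exI[of _ "U e"] exI[of _ "V e"]) (auto simp: edges_def)
  qed
qed

lemma runs_clique_minor_prog_nonempty:
  assumes graph: "ordered_graph V E r" and pres: "presents vs es V E r" and t: "1 \<le> t"
    and m: "m = length es" "0 < m" and n: "n = length vs"
    and W: "2 * (m * n) + 2 \<le> W" "t \<le> W"
  shows "runs W clique_minor_prog (150 * (t * (n * (m * n))))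
    (\<lambda>s. (says_yes s \<longrightarrow> has_clique_interval_minor V E r t) \<and>
      (\<not> says_yes s \<longrightarrow> \<not> has_clique_interval_minor V E r (2 ^ (2 ^ (2 ^ t)))))
    (input_state vs es t)" (is "runs _ _ _ ?Q ?s")
proof -
  have dist: "distinct vs" and set: "set vs = V" using pres by (auto simp: presents_def)
  have ends: "fst (es ! e) \<in> set vs \<and> snd (es ! e) \<in> set vs" if "e < m" for e
  proof -
    have "(\<lambda>(u, v). {u, v}) (es ! e) \<in> E"
      using pres that m(1) nth_mem[of e es] unfolding presents_def by blast
    then have "(\<lambda>(u, v). {u, v}) (es ! e) \<subseteq> V" using graph by (auto simp: ordered_graph_def)
    then show ?thesis using set by (auto simp: case_prod_unfold)
  qed
  have n0: "0 < n" using ends[OF m(2)] n by (cases vs) auto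
  define Z where "Z = n * (m * n)"
  have Z: "n \<le> Z" "m \<le> Z" "1 \<le> Z" "Z \<le> t * Z"
    using n0 m(2) t by (auto simp: Z_def)
  let ?R0 = "\<lambda>s. env W n m s \<and> reg s 2 = t \<and> reg s 19 = t - 2 \<and> arr s = arr ?s"
  let ?R1 = "\<lambda>s. env W n m s \<and> reg s 19 = t - 2 \<and> arr s 1 = arr ?s 1 \<and> arr s 2 = arr ?s 2 \<and>
    (\<forall>i<n. arr s 3 (vs ! i) = i)"
  let ?R2 = "\<lambda>s. env W n m s \<and> reg s 19 = t - 2 \<and> positions vs es (arr s 1) (arr s 2)"
  let ?E = "\<lambda>s. edges m (arr s 1) (arr s 2)"
  let ?R3 = "\<lambda>s. env W n m s \<and> (\<exists>U U'. positions vs es U U' \<and>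
    (clique_minor (?E s) 2 \<longrightarrow> clique_minor (edges m U U') (2 + (t - 2))) \<and>
    (\<not> clique_minor (?E s) 2 \<longrightarrow> \<not> clique_minor (edges m U U') ((minor_bound ^^ (t - 2)) 2)))"
  have input: "reg ?s 0 = n" "reg ?s 1 = m" "reg ?s 2 = t" "reg ?s 5 = 0"
    "\<forall>i<n. arr ?s 0 i = vs ! i"
    "\<forall>e<m. arr ?s 1 e = fst (es ! e) \<and> arr ?s 2 e = snd (es ! e)"
    using m n by (simp_all add: input_state_def list_cells_def)
  have one: "runs W (Const 3 1) 1 (\<lambda>s. s = ?s\<lparr>reg := (reg ?s)(3 := 1)\<rparr>) ?s"
    by (rule runs_weaken[OF runs_wp]) (use W in simp_all)
  let ?s1 = "?s\<lparr>reg := (reg ?s)(3 := 1)\<rparr>"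
  let ?s2 = "?s1\<lparr>reg := (reg ?s1)(4 := m * n)\<rparr>"
  let ?s3 = "?s2\<lparr>reg := (reg ?s2)(18 := 2)\<rparr>"
  have mul: "runs W (Op Mul 4 1 0) 1 (\<lambda>s. s = ?s2) ?s1"
    by (rule runs_weaken[OF runs_wp]) (use input W in simp_all)
  have two: "runs W (Const 18 2) 1 (\<lambda>s. s = ?s3) ?s2"
    by (rule runs_weaken[OF runs_wp]) (use W in simp_all)
  have sub: "runs W (Op Sub 19 2 18) 1 ?R0 ?s3"
    by (rule runs_weaken[OF runs_wp]) (use input W n0 m(2) in \<open>simp_all add: env_def\<close>)
  have 1: "runs W index_vertices (4 * n + 2) ?R1 s0" if R: "?R0 s0" for s0
  proof (rule runs_weaken[OF runs_index_vertices])
    show "env W n m s0" using R by simp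
    show "distinct vs" "length vs = n" using dist n by simp_all
    show "\<forall>i<n. arr s0 0 i = vs ! i" using R input(5) by simp
    fix s1 assume "(\<forall>i<n. arr s1 3 (vs ! i) = i) \<and> frame index_vertices s0 s1"
    then show "?R1 s1"
      using R env_frame[of index_vertices s0 s1 W n m] by (simp add: index_vertices_def frame_def)
  qed simp
  have 2: "runs W index_edges (9 * m + 2) ?R2 s1" if R: "?R1 s1" for s1
  proof (rule runs_weaken[OF runs_index_edges])
    show "env W n m s1" using R by simp
    fix s2 assume *: "(\<forall>e<m. arr s2 1 e = min (arr s1 3 (arr s1 1 e)) (arr s1 3 (arr s1 2 e)) \<and>
      arr s2 2 e = max (arr s1 3 (arr s1 1 e)) (arr s1 3 (arr s1 2 e))) \<and> frame index_edges s1 s2"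
    have "positions vs es (arr s2 1) (arr s2 2)"
      unfolding positions_def
    proof (intro allI impI)
      fix e assume "e < length es"
      then have e: "e < m" using m by simp
      obtain i j where ij: "i < n" "j < n" "fst (es ! e) = vs ! i" "snd (es ! e) = vs ! j"
        using ends[OF e] n by (auto simp: in_set_conv_nth)
      have "arr s1 1 e = vs ! i" "arr s1 2 e = vs ! j"
        using R input(6) e ij by auto
      then have "arr s2 1 e = min i j" "arr s2 2 e = max i j" using * R e ij by auto
      then show "arr s2 1 e \<le> arr s2 2 e \<and> arr s2 2 e < length vs \<and>
          {vs ! arr s2 1 e, vs ! arr s2 2 e} = {fst (es ! e), snd (es ! e)}"
        using ij n by (auto simp: min_def max_def)
    qed
    then show "?R2 s2"
      using R * env_frame[of index_edges s1 s2 W n m]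
      by (simp add: index_edges_def index_edges_body_def frame_def)
  qed simp
  have 3: "runs W levels ((t - 2) * (114 * Z + 2) + 2) ?R3 s2" if R: "?R2 s2" for s2
  proof -
    have wf: "well_formed n m (arr s2 1) (arr s2 2)"
    proof -
      have "arr s2 1 e \<le> arr s2 2 e \<and> arr s2 1 e div n = arr s2 2 e div n \<and> arr s2 2 e < m * n"
        if "e < m" for e
      proof -
        have le: "arr s2 1 e \<le> arr s2 2 e" "arr s2 2 e < n"
          using R that m n unfolding positions_def by blast+
        moreover have "n \<le> m * n" using m(2) by simp
        then have "arr s2 2 e < m * n" using le(2) by linarith
        ultimately show ?thesis by simp
      qed
      then show ?thesis by (simp add: well_formed_def)
    qed
    show ?thesis
      unfolding Z_def
    proof (rule runs_weaken[OF runs_levels[OF _ wf]])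
      show "env W n m s2" "reg s2 19 = t - 2" "t - 2 \<le> W" using R W(2) by auto
      fix s3 assume *: "well_formed n m (arr s3 1) (arr s3 2) \<and>
        (\<forall>k\<ge>2. clique_minor (?E s3) k \<longrightarrow> clique_minor (?E s2) (k + (t - 2))) \<and>
        (\<forall>b. \<not> clique_minor (?E s3) b \<longrightarrow> \<not> clique_minor (?E s2) ((minor_bound ^^ (t - 2)) b)) \<and>
        frame levels s2 s3"
      then have "env W n m s3"
        using R by (intro env_frame[of levels s2 s3]) (auto simp: levels_def level_defs collect_defs)
      then show "?R3 s3" using * R by blast
    qed simp
  qed
  have 4: "runs W find_edge (6 * m + 4) ?Q s3" if R: "?R3 s3" for s3
  proof (rule runs_weaken[OF runs_find_edge])
    show "env W n m s3" using R by simp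
    obtain U U' where pos: "positions vs es U U'"
      and up: "clique_minor (?E s3) 2 \<Longrightarrow> clique_minor (edges m U U') (2 + (t - 2))"
      and down: "\<not> clique_minor (?E s3) 2 \<Longrightarrow> \<not> clique_minor (edges m U U') ((minor_bound ^^ (t - 2)) 2)"
      using R by blast
    interpret presented_graph V E r vs es U U' by unfold_locales (rule graph pres pos)+
    fix s4 assume yes: "says_yes s4 \<longleftrightarrow> (\<exists>e<m. arr s3 1 e < arr s3 2 e)"
    have "has_clique_interval_minor V E r t" if "says_yes s4"
    \<comment> \<open>\<open>2 + (t - 2)\<close> equals t only for t at least 2. For t equal to 1 a
      nonempty vertex set is enough.\<close>
    proof (cases "t = 1")
      case True
      have "V \<noteq> {}" using set n n0 by auto
      then show ?thesis using True has_clique_interval_minor_1[of V E r] set by auto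
    next
      case False
      then have "2 + (t - 2) = t" "2 \<le> t" using t by auto
      then show ?thesis
        using up that yes clique_interval_minor_if_clique_minor[of t]
        unfolding clique_minor_2_iff m by metis
    qed
    moreover have "\<not> has_clique_interval_minor V E r (2 ^ (2 ^ (2 ^ t)))" if "\<not> says_yes s4"
    proof -
      have "\<not> clique_minor (edges m U U') ((minor_bound ^^ (t - 2)) 2)"
        using down that yes unfolding clique_minor_2_iff by blast
      then have "\<not> clique_minor (edges m U U') (2 ^ (2 ^ (2 ^ t)))"
        using clique_minor_antimono minor_bound_iterated[OF t] by blast
      then show ?thesis using clique_minor_if_clique_interval_minor unfolding m by blast
    qed
    ultimately show "?Q s4" by blast
  qed simp
  let ?T = "1 + (1 + (1 + ((4 * n + 2) + ((9 * m + 2) + (((t - 2) * (114 * Z + 2) + 2) + (6 * m + 4))))))"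
  have main: "runs W (Op Mul 4 1 0 ;; Const 18 2 ;; Op Sub 19 2 18 ;;
        index_vertices ;; index_edges ;; levels ;; find_edge) ?T ?Q ?s1"
  proof (rule runs_Seq[OF mul])
    fix s assume s: "s = ?s2"
    show "runs W (Const 18 2 ;; Op Sub 19 2 18 ;; index_vertices ;; index_edges ;; levels ;; find_edge)
        (1 + (1 + ((4 * n + 2) + ((9 * m + 2) + (((t - 2) * (114 * Z + 2) + 2) + (6 * m + 4)))))) ?Q s"
      unfolding s
    proof (rule runs_Seq[OF two])
      fix s assume s: "s = ?s3"
      show "runs W (Op Sub 19 2 18 ;; index_vertices ;; index_edges ;; levels ;; find_edge)
          (1 + ((4 * n + 2) + ((9 * m + 2) + (((t - 2) * (114 * Z + 2) + 2) + (6 * m + 4))))) ?Q s"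
        unfolding s by (rule runs_Seq[OF sub runs_Seq[OF 1 runs_Seq[OF 2 runs_Seq[OF 3 4]]]])
    qed
  qed
  have "runs W clique_minor_prog (1 + Suc ?T) ?Q ?s"
    unfolding clique_minor_prog_def
  proof (rule runs_Seq[OF one])
    fix s assume s: "s = ?s1"
    show "runs W (IfLess 5 1 (Op Mul 4 1 0 ;; Const 18 2 ;; Op Sub 19 2 18 ;;
        index_vertices ;; index_edges ;; levels ;; find_edge)
       (Const 18 2 ;; IfLess 2 18 Skip (Const 0 0))) (Suc ?T) ?Q s"
    proof (rule runs_IfLess)
      assume "\<not> reg s 5 < reg s 1"
      then show "runs W (Const 18 2 ;; IfLess 2 18 Skip (Const 0 0)) ?T ?Q s"
        using input m(2) unfolding s by simp
    qed (use main s in simp)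
  qed
  then show ?thesis
    unfolding Z_def[symmetric]
  proof (rule runs_weaken)
    \<comment> \<open>The constant 150 is 114 + 2 + 4 + 15 + 15: the levels, their loop control,
      then the terms in n, in m and the constants.\<close>
    have "(t - 2) * (114 * Z + 2) \<le> t * (114 * Z + 2)" by (intro mult_le_mono1) simp
    also have "\<dots> = 114 * (t * Z) + 2 * t" by (simp add: algebra_simps)
    finally have "(t - 2) * (114 * Z + 2) \<le> 114 * (t * Z) + 2 * t" .
    moreover have "t \<le> t * Z" using Z(3) by simp
    ultimately show "1 + Suc ?T \<le> 150 * (t * Z)"
      using Z t by linarith
  qed
qed

text \<open>Two distinct parts would need an edge between them, so only size at most 1 is possible,
  and the size to be refuted exceeds 1.\<close>

lemma runs_clique_minor_prog_empty:
  assumes pres: "presents vs [] V E r" and t: "1 \<le> t" and W: "2 \<le> W"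
  shows "runs W clique_minor_prog 5
    (\<lambda>s. (says_yes s \<longrightarrow> has_clique_interval_minor V E r t) \<and>
      (\<not> says_yes s \<longrightarrow> \<not> has_clique_interval_minor V E r (2 ^ (2 ^ (2 ^ t)))))
    (input_state vs [] t)"
proof -
  have V: "set vs = V" and E: "E = {}" using pres by (auto simp: presents_def)
  have yes: "has_clique_interval_minor V E r 1" if "vs \<noteq> []"
    using has_clique_interval_minor_1[of V E r] that V by auto
  have no: "k \<le> 1" "k = 1 \<Longrightarrow> vs \<noteq> []" if K: "has_clique_interval_minor V E r k" for k
  proof -
    obtain P where P: "partition_on V P" "finite P" "card P = k"
      and adj: "\<forall>I\<in>P. \<forall>J\<in>P. I \<noteq> J \<longrightarrow> (\<exists>u\<in>I. \<exists>v\<in>J. {u, v} \<in> E)"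
      using K unfolding has_clique_interval_minor_def by (elim exE conjE)
    have "I = J" if "I \<in> P" "J \<in> P" for I J using adj that E by blast
    then show "k \<le> 1" using P(2,3) by (metis card_le_Suc0_iff_eq One_nat_def)
    show "vs \<noteq> []" if "k = 1"
      using P V that by (auto simp: partition_on_empty)
  qed
  have big: "1 < (2::nat) ^ (2 ^ (2 ^ t))" by (intro one_less_power) auto
  have wp: "wp W (Const 18 2 ;; IfLess 2 18 Skip (Const 0 0))
    (\<lambda>s. (says_yes s \<longrightarrow> has_clique_interval_minor V E r t) \<and>
      (\<not> says_yes s \<longrightarrow> \<not> has_clique_interval_minor V E r (2 ^ (2 ^ (2 ^ t)))))
    ((input_state vs [] t)\<lparr>reg := (reg (input_state vs [] t))(3 := 1)\<rparr>)"
    using W t yes no(1)[of "2 ^ (2 ^ (2 ^ t))"] big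
    by (cases "t = 1") (auto simp: input_state_def says_yes_def)
  have one: "runs W (Const 3 1) 1 (\<lambda>s. s = (input_state vs [] t)\<lparr>reg := (reg (input_state vs [] t))(3 := 1)\<rparr>)
      (input_state vs [] t)"
    by (rule runs_weaken[OF runs_wp]) (use W in simp_all)
  have "runs W clique_minor_prog (1 + Suc 3)
    (\<lambda>s. (says_yes s \<longrightarrow> has_clique_interval_minor V E r t) \<and>
      (\<not> says_yes s \<longrightarrow> \<not> has_clique_interval_minor V E r (2 ^ (2 ^ (2 ^ t)))))
    (input_state vs [] t)"
    unfolding clique_minor_prog_def
  proof (rule runs_Seq[OF one], rule runs_IfLess)
    fix s assume s: "s = (input_state vs [] t)\<lparr>reg := (reg (input_state vs [] t))(3 := 1)\<rparr>"
    show "runs W (Const 18 2 ;; IfLess 2 18 Skip (Const 0 0)) 3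
      (\<lambda>s. (says_yes s \<longrightarrow> has_clique_interval_minor V E r t) \<and>
        (\<not> says_yes s \<longrightarrow> \<not> has_clique_interval_minor V E r (2 ^ (2 ^ (2 ^ t))))) s"
      unfolding s by (rule runs_weaken[OF runs_wp[OF wp]]) simp_all
  qed (simp add: input_state_def)
  then show ?thesis by simp
qed

theorem theorem4:
  shows "\<exists>(f :: nat \<Rightarrow> nat) (P :: ram_prog) (C :: nat) (d :: nat).
    (\<exists>g :: nat \<Rightarrow> real. g \<in> O(\<lambda>t. real t) \<and>
        (\<forall>t\<ge>1. real (f t) = 2 powr (2 powr (2 powr g t)))) \<and>
    (\<forall>(V :: nat set) (E :: nat set set) (r :: nat rel) vs es (t :: nat).
        ordered_graph V E r \<longrightarrow> presents vs es V E r \<longrightarrow> t \<ge> 1 \<longrightarrow>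
        (\<exists>k s. exec (max_word d vs es t) P (input_state vs es t) k s \<and>
               k \<le> C * (t * card E * (card V)^2 + 1) \<and>
               (says_yes s \<longrightarrow> has_clique_interval_minor V E r t) \<and>
               (\<not> says_yes s \<longrightarrow> \<not> has_clique_interval_minor V E r (f t))))"
proof (rule exI[of _ "\<lambda>t. 2 ^ (2 ^ (2 ^ t))"], rule exI[of _ clique_minor_prog], rule exI[of _ 150],
    rule exI[of _ 2], intro conjI allI impI)
  have "real ((2::nat) ^ (2 ^ (2 ^ t))) = 2 powr (2 powr (2 powr real t))" for t
  proof -
    have "2 powr real t = real (2 ^ t)" by (simp add: powr_realpow)
    moreover have "2 powr real (2 ^ t) = real (2 ^ (2 ^ t))" by (subst powr_realpow) simp_all
    moreover have "2 powr real (2 ^ (2 ^ t)) = real (2 ^ (2 ^ (2 ^ t)))" by (subst powr_realpow) simp_all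
    ultimately show ?thesis by simp
  qed
  then show "\<exists>g :: nat \<Rightarrow> real. g \<in> O(\<lambda>t. real t) \<and>
      (\<forall>t\<ge>1. real (2 ^ (2 ^ (2 ^ t))) = 2 powr (2 powr (2 powr g t)))"
    by (intro exI[of _ real]) simp
next
  fix V :: "nat set" and E :: "nat set set" and r :: "nat rel" and vs es and t :: nat
  assume graph: "ordered_graph V E r" and pres: "presents vs es V E r" and t: "t \<ge> 1"
  define n m where "n = length vs" and "m = length es"
  define W where "W = max_word 2 vs es t"
  have card: "card V = n" "card E = m"
    using pres distinct_card by (auto simp: presents_def n_def m_def)
  \<comment> \<open>Words as large as the square of x suffice, since \<open>2 * (m * n) + 2\<close>
    is at most the square of \<open>n + m + 2\<close>. This gives the exponent 2 in
    \<open>max_word\<close>.\<close>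
  define x where "x = n + m + t + Max (insert 0 (set vs)) + 2"
  have le_x: "n + m + 2 \<le> x" "t \<le> x" "2 \<le> x" by (simp_all add: x_def)
  then have "(n + m + 2) * (n + m + 2) \<le> x * x" "x \<le> x * x"
    using mult_le_mono[OF le_x(1) le_x(1)] le_square[of x] by simp_all
  moreover have "W = x * x"
    by (simp add: W_def max_word_def x_def n_def m_def power2_eq_square)
  moreover have "2 * (m * n) + 2 \<le> (n + m + 2) * (n + m + 2)" by (simp add: algebra_simps)
  ultimately have W: "2 * (m * n) + 2 \<le> W" "t \<le> W" "2 \<le> W" using le_x by linarith+
  have "runs W clique_minor_prog (150 * (t * card E * (card V)\<^sup>2 + 1))
    (\<lambda>s. (says_yes s \<longrightarrow> has_clique_interval_minor V E r t) \<and>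
      (\<not> says_yes s \<longrightarrow> \<not> has_clique_interval_minor V E r (2 ^ (2 ^ (2 ^ t)))))
    (input_state vs es t)"
  \<comment> \<open>For m equal to 0 the product in the time bound vanishes, and the added 1 pays
    for the five steps.\<close>
  proof (cases "m = 0")
    case True
    then have "es = []" by (simp add: m_def)
    show ?thesis
      unfolding \<open>es = []\<close>
      by (rule runs_weaken[OF runs_clique_minor_prog_empty[OF pres[unfolded \<open>es = []\<close>] t W(3)]]) simp_all
  next
    case False
    then have "runs W clique_minor_prog (150 * (t * (n * (m * n))))
      (\<lambda>s. (says_yes s \<longrightarrow> has_clique_interval_minor V E r t) \<and>
        (\<not> says_yes s \<longrightarrow> \<not> has_clique_interval_minor V E r (2 ^ (2 ^ (2 ^ t)))))
      (input_state vs es t)"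
      using graph pres t W by (intro runs_clique_minor_prog_nonempty) (simp_all add: m_def n_def)
    then show ?thesis
      by (rule runs_weaken) (simp_all add: card power2_eq_square algebra_simps)
  qed
  then show "\<exists>k s. exec (max_word 2 vs es t) clique_minor_prog (input_state vs es t) k s \<and>
      k \<le> 150 * (t * card E * (card V)\<^sup>2 + 1) \<and>
      (says_yes s \<longrightarrow> has_clique_interval_minor V E r t) \<and>
      (\<not> says_yes s \<longrightarrow> \<not> has_clique_interval_minor V E r (2 ^ (2 ^ (2 ^ t))))"
    unfolding runs_def W_def by blast
qed

end
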